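(* Let $q\in L^1(0,\pi)$ be real-valued, $\alpha_1,\alpha_2,\beta\in[0,\pi)$ and $\sin(\alpha_2-\alpha_1)\neq0$. Let $\sigma_{\alpha_2,\beta}=\{a_n\}_{n\in\mathbb{N}}$ and $\sigma_{\alpha_1,\beta}=\{b_n\}_{n\in\mathbb{N}}$ be the two spectra of $q$, assumed to be contained in $(0,\infty)$, and let $\{\gamma_n\}_{n\in\mathbb{N}}$ be the point masses of the spectral measure $\mu_{\alpha_1,\alpha_2,\beta}=\sum_{n\in\mathbb{N}}\gamma_n\delta_{a_n}$. Let $\{a_{k_n}\}_{n\in\mathbb{N}}\subset\sigma_{\alpha_2,\beta}$ and $\{b_{l_n}\}_{n\in\mathbb{N}}\subset\sigma_{\alpha_1,\beta}$ be subsequences (with $k_n$ and $l_n$ strictly increasing) such that $\prod_{n\in\mathbb{N}}a_{k_n}/b_{l_n}$ is absolutely convergent. Then: (i) If $\alpha_1=0$ or $\alpha_2=0$, then $\{a_n\}_{n\in\mathbb{N}}$, $\{b_n\}_{n\in\mathbb{N}}\setminus\{b_{l_n}\}_{n\in\mathbb{N}}$ and $\{\gamma_{k_n}\}_{n\in\mathbb{N}}$ determine the potential $q$. (ii) If $\alpha_1\neq0$, $\alpha_2\neq0$ and there exists $N\in\mathbb{N}$ such that $k_n\neq l_n$ for all $n>N$, then $\{a_n\}_{n\in\mathbb{N}}$, $\{b_n\}_{n\in\mathbb{N}}\setminus\{b_{l_n}\}_{n\in\mathbb{N}}$ and $\{\gamma_{k_n}\}_{n\in\mathbb{N}}$ determine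 the potential $q$. Here "determine the potential $q$" means: if $\widetilde q\in L^1(0,\pi)$ is real-valued, with corresponding quantities $\widetilde a_n,\widetilde b_n,\widetilde\gamma_n$ (for the same $\alpha_1,\alpha_2,\beta$), and $\widetilde a_n=a_n$ for all $n\in\mathbb{N}$, $\widetilde b_j=b_j$ for all $j\in\mathbb{N}\setminus\{l_n:n\in\mathbb{N}\}$, and $\widetilde\gamma_{k_n}=\gamma_{k_n}$ for all $n\in\mathbb{N}$, then $\widetilde q=q$ almost everywhere on $(0,\pi)$.
   Context: $\mathbb{N}=\{1,2,3,\dots\}$. For a real-valued potential $q\in L^1(0,\pi)$ and $\alpha,\beta\in[0,\pi)$, $\sigma_{\alpha,\beta}$ denotes the spectrum of the operator $u\mapsto-u''+qu$ on $(0,\pi)$ with boundary conditions $u(0)\cos\alpha-u'(0)\sin\alpha=0$ and $u(\pi)\cos\beta+u'(\pi)\sin\beta=0$. It is a discrete subset of $\mathbb{R}$, bounded below, and is enumerated in increasing order with index set $\mathbb{N}$. Let $u_z$ be the solution of $-u''+qu=zu$ with $u_z(\pi)=\sin\beta$, $u_z'(\pi)=-\cos\beta$. For $\alpha_1,\alpha_2,\beta\in[0,\pi)$ with $\sin(\alpha_2-\alpha_1)\neq0$, define $$m_{\alpha_1,\alpha_2,\beta}(z):=\frac{1}{\sin(\alpha_2-\alpha_1)}\left[\frac{-\sin(\alpha_1)u_z'(0)+\cos(\alpha_1)u_z(0)}{-\sin(\alpha_2)u_z'(0)+\cos(\alpha_2)u_z(0)}\right].$$ This is a meromorphic Herglotz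 function (real on the real line where defined, positive imaginary part on the upper half-plane) whose zero set is $\sigma_{\alpha_1,\beta}$ and whose poles are simple and form $\sigma_{\alpha_2,\beta}$. It has a Herglotz representation $m_{\alpha_1,\alpha_2,\beta}(z)=az+b+\int\left[\frac1{t-z}-\frac{t}{1+t^2}\right]d\mu_{\alpha_1,\alpha_2,\beta}(t)$ with $a,b\in\mathbb{R}$ and $\mu_{\alpha_1,\alpha_2,\beta}$ a positive discrete measure supported on $\sigma_{\alpha_2,\beta}$ with $\int\frac{d\mu_{\alpha_1,\alpha_2,\beta}(t)}{1+t^2}<\infty$; this measure is called the spectral measure corresponding to $(\alpha_1,\alpha_2,\beta)$. Thus its point mass at $a_n\in\sigma_{\alpha_2,\beta}$ is $\gamma_n=-\operatorname{Res}(m_{\alpha_1,\alpha_2,\beta},a_n)$. Absolute convergence of $\prod_{n\in\mathbb{N}}a_{k_n}/b_{l_n}$ means $\sum_{n\in\mathbb{N}}\left|a_{k_n}/b_{l_n}-1\right|<\infty$. *)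

theory Defs
  imports "HOL-Analysis.Analysis"
begin

text \<open>
  \<open>g\<close> plays the role of the derivative of \<open>f\<close>: \<open>f\<close> is absolutely continuous on \<open>[0, \<pi>]\<close>
  iff it is the indefinite integral of an integrable \<open>g\<close>, and then \<open>f' = g\<close> almost everywhere.
  If \<open>g\<close> is continuous on \<open>[0, \<pi>]\<close>, then \<open>f' = g\<close> holds everywhere there, with one-sided
  derivatives at the endpoints.
\<close>

definition ac_deriv :: "(real \<Rightarrow> complex) \<Rightarrow> (real \<Rightarrow> complex) \<Rightarrow> bool" where
  "ac_deriv f g \<longleftrightarrow> g absolutely_integrable_on {0..pi} \<and>
     (\<forall>x\<in>{0..pi}. f x = f 0 + integral {0..x} g)"

text \<open>
  \<open>sl_expr q u v f\<close>: \<open>u\<close> and \<open>v = u'\<close> are absolutely continuous on \<open>[0, \<pi>]\<close> and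
  \<open>- u'' + q u = f\<close> almost everywhere.  The derivative is kept as a separate argument so that
  \<open>u' 0\<close> and \<open>u' \<pi>\<close> can be referred to.
\<close>

definition sl_expr ::
    "(real \<Rightarrow> real) \<Rightarrow> (real \<Rightarrow> complex) \<Rightarrow> (real \<Rightarrow> complex) \<Rightarrow> (real \<Rightarrow> complex) \<Rightarrow> bool" where
  "sl_expr q u v f \<longleftrightarrow> ac_deriv u v \<and>
     (\<exists>w. ac_deriv v w \<and>
       (AE x in lebesgue_on {0<..<pi}. - w x + of_real (q x) * u x = f x))"

subsection \<open>The operator in \<open>L\<^sup>2(0,\<pi>)\<close> and its spectrum\<close>

definition in_L2 :: "(real \<Rightarrow> complex) \<Rightarrow> bool" where
  "in_L2 f \<longleftrightarrow> f \<in> borel_measurable (lebesgue_on {0<..<pi}) \<and>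
     integrable (lebesgue_on {0<..<pi}) (\<lambda>x. (cmod (f x))\<^sup>2)"

definition norm_L2 :: "(real \<Rightarrow> complex) \<Rightarrow> real" where
  "norm_L2 f = sqrt (integral\<^sup>L (lebesgue_on {0<..<pi}) (\<lambda>x. (cmod (f x))\<^sup>2))"

text \<open>
  The graph of the operator: \<open>sl_op q \<alpha> \<beta> u f\<close> says that \<open>u\<close> lies in the domain and is mapped
  to \<open>f\<close>.  The function \<open>u\<close> is the continuous representative of its class; \<open>f\<close> is determined
  almost everywhere.
\<close>

definition sl_op ::
    "(real \<Rightarrow> real) \<Rightarrow> real \<Rightarrow> real \<Rightarrow> (real \<Rightarrow> complex) \<Rightarrow> (real \<Rightarrow> complex) \<Rightarrow> bool" where
  "sl_op q \<alpha> \<beta> u f \<longleftrightarrow> in_L2 u \<and> in_L2 f \<and>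
     (\<exists>v. sl_expr q u v f \<and>
       u 0 * of_real (cos \<alpha>) - v 0 * of_real (sin \<alpha>) = 0 \<and>
       u pi * of_real (cos \<beta>) + v pi * of_real (sin \<beta>) = 0)"

definition sl_op_minus ::
    "(real \<Rightarrow> real) \<Rightarrow> real \<Rightarrow> real \<Rightarrow> complex \<Rightarrow> (real \<Rightarrow> complex) \<Rightarrow> (real \<Rightarrow> complex) \<Rightarrow> bool" where
  "sl_op_minus q \<alpha> \<beta> z u f \<longleftrightarrow>
     (\<exists>g. sl_op q \<alpha> \<beta> u g \<and> (AE x in lebesgue_on {0<..<pi}. f x = g x - z * u x))"

text \<open>
  The resolvent set consists of those \<open>z\<close> for which the operator minus \<open>z\<close> is a bijection from
  the domain onto \<open>L\<^sup>2(0,\<pi>)\<close> with bounded inverse.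
\<close>

definition sl_resolvent_set :: "(real \<Rightarrow> real) \<Rightarrow> real \<Rightarrow> real \<Rightarrow> complex set" where
  "sl_resolvent_set q \<alpha> \<beta> = {z.
     (\<forall>f. in_L2 f \<longrightarrow> (\<exists>u. sl_op_minus q \<alpha> \<beta> z u f)) \<and>
     (\<forall>u. sl_op_minus q \<alpha> \<beta> z u (\<lambda>_. 0) \<longrightarrow> (AE x in lebesgue_on {0<..<pi}. u x = 0)) \<and>
     (\<exists>C. \<forall>u f. sl_op_minus q \<alpha> \<beta> z u f \<longrightarrow> norm_L2 u \<le> C * norm_L2 f)}"

definition sl_spectrum :: "(real \<Rightarrow> real) \<Rightarrow> real \<Rightarrow> real \<Rightarrow> complex set" where
  "sl_spectrum q \<alpha> \<beta> = - sl_resolvent_set q \<alpha> \<beta>"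

text \<open>
  Enumerations start at index \<open>0\<close> instead of \<open>1\<close>; only coincidences between indices matter
  below, so the shift is immaterial.
\<close>

definition enumerates_incr :: "(nat \<Rightarrow> real) \<Rightarrow> complex set \<Rightarrow> bool" where
  "enumerates_incr a S \<longleftrightarrow> strict_mono a \<and> S = range (\<lambda>n. complex_of_real (a n))"

subsection \<open>The \<open>m\<close>-function and its spectral measure\<close>

text \<open>
  The pair \<open>(u\<^sub>z, u\<^sub>z')\<close>; for integrable \<open>q\<close> it exists and is unique on \<open>[0, \<pi>]\<close>.
  Its values outside \<open>[0, \<pi>]\<close> are arbitrary and never used.
\<close>

definition sl_sol ::
    "(real \<Rightarrow> real) \<Rightarrow> real \<Rightarrow> complex \<Rightarrow> (real \<Rightarrow> complex) \<times> (real \<Rightarrow> complex)" where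
  "sl_sol q \<beta> z = (SOME (u, v). sl_expr q u v (\<lambda>x. z * u x) \<and>
     u pi = of_real (sin \<beta>) \<and> v pi = - of_real (cos \<beta>))"

definition m_fun :: "(real \<Rightarrow> real) \<Rightarrow> real \<Rightarrow> real \<Rightarrow> real \<Rightarrow> complex \<Rightarrow> complex" where
  "m_fun q \<alpha>1 \<alpha>2 \<beta> z = (let (u, v) = sl_sol q \<beta> z in
     1 / of_real (sin (\<alpha>2 - \<alpha>1)) *
     ((- of_real (sin \<alpha>1) * v 0 + of_real (cos \<alpha>1) * u 0) /
      (- of_real (sin \<alpha>2) * v 0 + of_real (cos \<alpha>2) * u 0)))"

definition spectral_measure ::
    "(real \<Rightarrow> real) \<Rightarrow> real \<Rightarrow> real \<Rightarrow> real \<Rightarrow> real measure \<Rightarrow> bool" where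
  "spectral_measure q \<alpha>1 \<alpha>2 \<beta> \<mu> \<longleftrightarrow>
     sets \<mu> = sets borel \<and>
     (AE t in \<mu>. complex_of_real t \<in> sl_spectrum q \<alpha>2 \<beta>) \<and>
     integrable \<mu> (\<lambda>t. 1 / (1 + t\<^sup>2)) \<and>
     (\<exists>c d :: real. \<forall>z. z \<notin> sl_spectrum q \<alpha>2 \<beta> \<longrightarrow>
        m_fun q \<alpha>1 \<alpha>2 \<beta> z = of_real c * z + of_real d +
          integral\<^sup>L \<mu> (\<lambda>t. 1 / (of_real t - z) - of_real (t / (1 + t\<^sup>2))))"

subsection \<open>Spectral data and determination of the potential\<close>

definition potential :: "(real \<Rightarrow> real) \<Rightarrow> bool" where
  "potential q \<longleftrightarrow> integrable (lebesgue_on {0<..<pi}) q"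

definition spectral_data ::
    "(real \<Rightarrow> real) \<Rightarrow> real \<Rightarrow> real \<Rightarrow> real \<Rightarrow>
     (nat \<Rightarrow> real) \<Rightarrow> (nat \<Rightarrow> real) \<Rightarrow> (nat \<Rightarrow> real) \<Rightarrow> bool" where
  "spectral_data q \<alpha>1 \<alpha>2 \<beta> a b \<gamma> \<longleftrightarrow>
     enumerates_incr a (sl_spectrum q \<alpha>2 \<beta>) \<and>
     enumerates_incr b (sl_spectrum q \<alpha>1 \<beta>) \<and>
     (\<exists>\<mu>. spectral_measure q \<alpha>1 \<alpha>2 \<beta> \<mu> \<and> (\<forall>n. \<gamma> n = measure \<mu> {a n}))"

definition determines_potential ::
    "(real \<Rightarrow> real) \<Rightarrow> real \<Rightarrow> real \<Rightarrow> real \<Rightarrow>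
     (nat \<Rightarrow> real) \<Rightarrow> (nat \<Rightarrow> real) \<Rightarrow> (nat \<Rightarrow> real) \<Rightarrow> (nat \<Rightarrow> nat) \<Rightarrow> (nat \<Rightarrow> nat) \<Rightarrow> bool" where
  "determines_potential q \<alpha>1 \<alpha>2 \<beta> a b \<gamma> k l \<longleftrightarrow>
     (\<forall>q' a' b' \<gamma>'.
        potential q' \<and> spectral_data q' \<alpha>1 \<alpha>2 \<beta> a' b' \<gamma>' \<and>
        (\<forall>n. a' n = a n) \<and> (\<forall>j. j \<notin> range l \<longrightarrow> b' j = b j) \<and> (\<forall>n. \<gamma>' (k n) = \<gamma> (k n)) \<longrightarrow>
        (AE x in lebesgue_on {0<..<pi}. q' x = q x))"

end

theory Submission
  imports Defs "HOL-Complex_Analysis.Complex_Analysis" "HOL-Real_Asymp.Real_Asymp"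
begin

text \<open>
  For the solution \<open>u\<^sub>z\<close> fixed at \<open>\<pi>\<close>, the function
  \<open>\<Delta>\<^sub>i z = cos \<alpha>\<^sub>i u\<^sub>z(0) - sin \<alpha>\<^sub>i u\<^sub>z'(0)\<close> is entire of order \<open>1/2\<close>, its zeros form the spectrum, and
  the \<open>m\<close>-function is \<open>\<Delta>\<^sub>1 / \<Delta>\<^sub>2\<close> up to a constant.  A star marks objects of a second potential with the same data.
  The Herglotz representation bounds \<open>\<Delta>\<^sub>1 / \<Delta>\<^sub>2\<close> and its inverse by \<open>C (1 + \<bar>z\<bar>\<^sup>2) / \<bar>Im z\<bar>\<close>.  So all zeros are simple,
  and \<open>\<Delta>\<^sub>2* / \<Delta>\<^sub>2\<close> is an entire function of order \<open>1/2\<close>; it tends to \<open>1\<close> along the imaginary axis and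
  equals \<open>1\<close> by Phragmen--Lindelof.  The point masses are residues, so \<open>D = \<Delta>\<^sub>1 - \<Delta>\<^sub>1*\<close> vanishes at the \<open>a\<close> with index
  in the range of \<open>k\<close>, and also at the \<open>b\<close> with index outside the range of \<open>l\<close>.  With
  \<open>P z = \<Prod>\<^sub>n (b\<^bsub>l n\<^esub> - z) / (a\<^bsub>k n\<^esub> - z)\<close> the quotient \<open>D P / \<Delta>\<^sub>1\<close> is therefore entire.  Absolute convergence gives
  \<open>\<bar>P z\<bar> \<le> exp (C \<bar>z\<bar> / \<bar>Im z\<bar>)\<close>, which by a maximum principle on squares still yields polynomial growth of
  \<open>D P / \<Delta>\<^sub>1\<close>; as it tends to \<open>0\<close> along the imaginary axis, \<open>D = 0\<close>.

  Hence \<open>u\<^sub>z(0)\<close> and \<open>u\<^sub>z'(0)\<close> agree for both potentials.  Let \<open>\<theta>\<close>, \<open>\<phi>\<close> be the solutions normalised at \<open>0\<close>.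
  For fixed \<open>x\<close> the entire function \<open>\<phi> \<theta>* - \<theta> \<phi>*\<close> has order \<open>1/2\<close>
  and tends to \<open>0\<close> along the imaginary axis, so it vanishes; the Wronskians then force \<open>\<theta>* = \<theta>\<close> and \<open>\<phi>* = \<phi>\<close>,
  and the equation returns the potential.
\<close>

subsection \<open>Entire functions\<close>

text \<open>What is known about zeros comes from bounds of the shape
  \<open>C * (1 + (norm z)\<^sup>2) / \<bar>Im z\<bar>\<close>, which break down on the real axis,
  exactly where all zeros lie. So each quotient is first bounded by a multiple of
  \<open>exp (C * norm z / \<bar>Im z\<bar>)\<close> off the axis and then carried across it by
  squares with two corners on the axis; the right angle there is what makes
  \<open>exp (- A / w)\<close> decay up to the boundary. Order 1/2 lies below the critical order 1
  of a half-plane, so the behaviour on one line decides. The infinite product \<open>P\<close> is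
  never formed. Partial products move finitely many zeros of \<open>D\<close> at a time; their
  bounds off the axis do not depend on the number of factors, and Montel's theorem provides the
  limit. That \<open>\<phi> \<theta>* - \<theta> \<phi>*\<close> is small on the imaginary axis is a
  cancellation, since both products may grow like \<open>exp (2 x Re \<kappa>)\<close> with
  \<open>z = - \<kappa>\<^sup>2\<close>. It becomes visible after multiplication by the common
  characteristic function, which turns the difference into products of a left solution on
  \<open>[0, x]\<close> and a right solution on \<open>[x, pi]\<close>.\<close>

lemma norm_bounded_on_compact:
  fixes f :: "'a::topological_space \<Rightarrow> 'b::real_normed_vector"
  assumes "compact K" "continuous_on K f"
  obtains B where "B \<ge> 0" "\<And>x. x \<in> K \<Longrightarrow> norm (f x) \<le> B"
proof -
  have "bounded (f ` K)" using compact_continuous_image[OF assms(2,1)] by (rule compact_imp_bounded)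
  then obtain B where "\<And>x. x \<in> K \<Longrightarrow> norm (f x) \<le> B" unfolding bounded_iff by blast
  then show thesis using that[of "max B 0"] by (simp add: le_max_iff_disj)
qed

text \<open>The estimates for characteristic functions live off the real axis; this carries the
  resulting identities over to it.\<close>

lemma entire_eq_zero_of_nonreal:
  assumes f: "f holomorphic_on UNIV" and zero: "\<And>z. Im z \<noteq> 0 \<Longrightarrow> f z = 0"
  shows "f z = 0"
proof (rule analytic_continuation[OF f, of "{z. Im z \<noteq> 0}" \<i>])
  have "open {z. Im z \<noteq> 0}" by (intro open_Collect_neq continuous_intros)
  then show "\<i> islimpt {z. Im z \<noteq> 0}"
    by (intro interior_limit_point) (simp add: interior_open)
qed (use zero in auto)

text \<open>Near a zero \<open>a\<close> of \<open>g\<close> both functions are divisible by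
  \<open>z - a\<close>, and the divided denominator takes the value
  \<open>deriv g a \<noteq> 0\<close> at \<open>a\<close>. Simplicity of zeros thus has to be known
  before any division by a characteristic function.\<close>

lemma entire_divide_simple_zeros:
  fixes f g :: "complex \<Rightarrow> complex"
  assumes f: "f holomorphic_on UNIV" and g: "g holomorphic_on UNIV"
    and zeros: "\<And>z. g z = 0 \<Longrightarrow> f z = 0 \<and> deriv g z \<noteq> 0"
  shows "\<exists>h. h holomorphic_on UNIV \<and> (\<forall>z. f z = h z * g z)"
proof -
  \<comment> \<open>The value at a zero of \<open>g\<close> is the limit prescribed by l'Hopital's
    rule.\<close>
  define h where "h = (\<lambda>z. if g z = 0 then deriv f z / deriv g z else f z / g z)"
  have "h field_differentiable at a" for a
  proof (cases "g a = 0")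
    case False
    have "open {z. g z \<noteq> 0}"
      using holomorphic_on_imp_continuous_on[OF g] by (intro open_Collect_neq) auto
    then have ev: "eventually (\<lambda>z. g z \<noteq> 0) (nhds a)"
      using False eventually_nhds_in_open by fastforce
    have "(\<lambda>z. f z / g z) field_differentiable at a"
      using f g False by (intro field_differentiable_divide)
        (auto simp: holomorphic_on_def)
    then obtain D where "((\<lambda>z. f z / g z) has_field_derivative D) (at a)"
      by (auto simp: field_differentiable_def)
    then have "(h has_field_derivative D) (at a)"
      by (subst DERIV_cong_ev[OF refl _ refl, where g = "\<lambda>z. f z / g z"])
        (use ev in \<open>auto elim!: eventually_mono simp: h_def\<close>)
    then show ?thesis
      by (auto simp: field_differentiable_def)
  next
    case True
    define f1 where "f1 = (\<lambda>z. if z = a then deriv f a else (f z - f a) / (z - a))"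
    define g1 where "g1 = (\<lambda>z. if z = a then deriv g a else (g z - g a) / (z - a))"
    have f1: "f1 holomorphic_on UNIV" and g1: "g1 holomorphic_on UNIV"
      unfolding f1_def g1_def by (rule pole_lemma[OF f] pole_lemma[OF g]; simp)+
    have nz: "g1 a \<noteq> 0" using zeros[OF True] by (simp add: g1_def)
    have "open {z. g1 z \<noteq> 0}"
      using holomorphic_on_imp_continuous_on[OF g1] by (intro open_Collect_neq) auto
    then have ev: "eventually (\<lambda>z. g1 z \<noteq> 0) (nhds a)"
      using nz eventually_nhds_in_open by fastforce
    have eq: "h z = f1 z / g1 z" if "g1 z \<noteq> 0" for z
    proof (cases "z = a")
      case True
      then show ?thesis using \<open>g a = 0\<close> by (simp add: h_def f1_def g1_def)
    next
      case False
      then have "g z \<noteq> 0" using that True by (auto simp: g1_def)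
      then show ?thesis using False True zeros[OF True] by (simp add: h_def f1_def g1_def)
    qed
    have "(\<lambda>z. f1 z / g1 z) field_differentiable at a"
      using f1 g1 nz by (intro field_differentiable_divide)
        (auto simp: holomorphic_on_def)
    then obtain D where "((\<lambda>z. f1 z / g1 z) has_field_derivative D) (at a)"
      by (auto simp: field_differentiable_def)
    then have "(h has_field_derivative D) (at a)"
      by (subst DERIV_cong_ev[OF refl _ refl, where g = "\<lambda>z. f1 z / g1 z"])
        (use ev eq in \<open>auto elim!: eventually_mono\<close>)
    then show ?thesis
      by (auto simp: field_differentiable_def)
  qed
  then have "h holomorphic_on UNIV"
    by (simp add: holomorphic_on_def)
  moreover have "f z = h z * g z" for z
    using zeros[of z] by (auto simp: h_def)
  ultimately show ?thesis by blast
qed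

section \<open>Bounds across the real axis\<close>

text \<open>In the right-angled sector \<open>Re (A / w) = A * Re w / (norm w)\<^sup>2\<close> is at
  least \<open>A / (2 * norm w)\<close>. So the essential singularity of
  \<open>exp (- A / w)\<close> at the vertex is harmless inside the sector.\<close>

lemma norm_exp_inverse_le:
  fixes w :: complex
  assumes "\<bar>Im w\<bar> \<le> Re w" "A > 0"
  shows "w \<noteq> 0 \<Longrightarrow> norm (exp (- (of_real A / w))) \<le> 2 * norm w / A"
    and "norm (exp (- (of_real A / w))) \<le> 1"
proof -
  have re: "Re (of_real A / w) = A * Re w / (norm w)\<^sup>2"
    by (simp add: Re_divide cmod_def power2_eq_square)
  have nn: "Re (of_real A / w) \<ge> 0"
    using assms re by simp
  then show "norm (exp (- (of_real A / w))) \<le> 1" by simp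
  assume w: "w \<noteq> 0"
  have "norm w \<le> \<bar>Re w\<bar> + \<bar>Im w\<bar>" by (rule cmod_le)
  also have "\<dots> \<le> 2 * Re w" using assms by simp
  finally have 2: "norm w \<le> 2 * Re w" .
  have pos: "norm w > 0" using w by simp
  have "A / (2 * norm w) \<le> A * Re w / (norm w)\<^sup>2"
    using 2 pos assms(2) by (simp add: field_simps power2_eq_square)
  then have ge: "Re (of_real A / w) \<ge> A / (2 * norm w)" using re by simp
  have "A / (2 * norm w) \<le> exp (A / (2 * norm w))"
    using exp_ge_add_one_self[of "A / (2 * norm w)"] by linarith
  also have "\<dots> \<le> exp (Re (of_real A / w))" using ge by simp
  finally have "inverse (exp (Re (of_real A / w))) \<le> inverse (A / (2 * norm w))"
    using pos assms(2) by (intro le_imp_inverse_le) auto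
  then show "norm (exp (- (of_real A / w))) \<le> 2 * norm w / A"
    by (simp add: exp_minus norm_inverse)
qed

text \<open>The maximum principle needs a barrier that is continuous up to the corners of the
  square; within the sector the value \<open>0\<close> at the vertex achieves this.\<close>

lemma continuous_on_exp_inverse:
  assumes "A > (0::real)"
  shows "continuous_on {w. \<bar>Im w\<bar> \<le> Re w}
    (\<lambda>w::complex. if w = 0 then 0 else exp (- (of_real A / w)))" (is "continuous_on ?S ?g")
  unfolding continuous_on_def
proof
  fix w assume w: "w \<in> ?S"
  show "(?g \<longlongrightarrow> ?g w) (at w within ?S)"
  proof (cases "w = 0")
    case False
    have "(?g \<longlongrightarrow> ?g w) (at w)"
    proof (rule Lim_transform_eventually)
      show "((\<lambda>w. exp (- (of_real A / w))) \<longlongrightarrow> ?g w) (at w)"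
        using False by (auto intro!: tendsto_eq_intros)
      show "\<forall>\<^sub>F x in at w. exp (- (of_real A / x)) = ?g x"
        using eventually_at_in_open'[of "- {0}" w] False by (auto elim!: eventually_mono)
    qed
    then show ?thesis by (rule tendsto_within_subset) simp
  next
    case True
    have "((\<lambda>w. 2 * norm w / A) \<longlongrightarrow> 0) (at 0 within ?S)"
      by (intro tendsto_eq_intros tendsto_norm_zero tendsto_ident_at) (use assms in \<open>auto intro!: tendsto_eq_intros\<close>)
    moreover have "\<forall>\<^sub>F w in at 0 within ?S. norm (?g w) \<le> 2 * norm w / A"
      using norm_exp_inverse_le(1)[OF _ assms] assms by (auto simp: eventually_at_filter)
    ultimately have "(?g \<longlongrightarrow> 0) (at 0 within ?S)"
      by (rule Lim_null_comparison[rotated])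
    then show ?thesis using True by simp
  qed
qed

text \<open>
  Maximum principle on the square \<open>\<bar>Re w - x\<bar> + \<bar>Im w\<bar> \<le> \<rho>\<close>: at its two real corners the factor
  \<open>exp (- A / (w - x + \<rho>) - A / (x + \<rho> - w))\<close> decays as fast as the assumed bound grows.
\<close>

lemma holomorphic_bound_off_real_axis:
  fixes f :: "complex \<Rightarrow> complex"
  assumes f: "f holomorphic_on UNIV" and C: "C > 0" and M: "M \<ge> 0" and z: "z \<noteq> 0"
    and bound: "\<And>w. Im w \<noteq> 0 \<Longrightarrow> norm z / 4 \<le> norm w \<Longrightarrow> norm w \<le> 2 * norm z \<Longrightarrow>
      norm (f w) \<le> M * exp (C * norm w / \<bar>Im w\<bar>)"
  shows "norm (f z) \<le> M * exp (40 * C)"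
proof (cases "\<bar>Im z\<bar> \<ge> norm z / 4")
  case True
  then have "Im z \<noteq> 0" using z by auto
  then have "norm (f z) \<le> M * exp (C * norm z / \<bar>Im z\<bar>)"
    by (intro bound) auto
  also have "C * norm z / \<bar>Im z\<bar> \<le> 40 * C"
  proof -
    have "C * norm z \<le> C * (40 * \<bar>Im z\<bar>)"
      using True C by (intro mult_left_mono) auto
    then show ?thesis using \<open>Im z \<noteq> 0\<close> by (simp add: field_simps)
  qed
  finally show ?thesis using M by (simp add: mult_left_mono)
next
  case False
  define x where "x = Re z"
  \<comment> \<open>For \<open>z\<close> close to the axis
    \<open>\<bar>x\<bar> \<ge> 4/5 * norm z\<close>. Half of \<open>\<bar>x\<bar>\<close> keeps the
    square inside the range of \<open>norm w\<close> where the bound is assumed, and leaves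
    \<open>z\<close> at a distance comparable to \<open>norm z\<close> from both corners.\<close>
  define \<rho> where "\<rho> = \<bar>x\<bar> / 2"
  \<comment> \<open>At a boundary point of height \<open>t\<close> one corner factor has modulus
    exactly \<open>exp (- (A / (2 * t)))\<close>. Since \<open>norm w \<le> 2 * norm z\<close>, this
    choice gives \<open>C * norm w / t \<le> A / (2 * t)\<close>.\<close>
  define A where "A = 4 * C * norm z"
  have nz: "norm z > 0" using z by simp
  have A: "A > 0" using C nz by (simp add: A_def)
  have "(norm z)\<^sup>2 = x\<^sup>2 + (Im z)\<^sup>2" by (simp add: cmod_power2 x_def)
  moreover have "(Im z)\<^sup>2 \<le> (norm z / 4)\<^sup>2"
    using False by (metis abs_le_square_iff abs_norm_cancel less_eq_real_def not_le abs_of_nonneg divide_nonneg_pos norm_ge_zero zero_less_numeral)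
  moreover have "(norm z / 4)\<^sup>2 = (norm z)\<^sup>2 / 16" "(4/5 * norm z)\<^sup>2 = 16/25 * (norm z)\<^sup>2"
    by (simp_all add: power_mult_distrib power_divide)
  moreover have "\<bar>x\<bar>\<^sup>2 = x\<^sup>2" "x\<^sup>2 \<ge> 0" by simp_all
  ultimately have "(4/5 * norm z)\<^sup>2 \<le> \<bar>x\<bar>\<^sup>2"
    by linarith
  then have x: "\<bar>x\<bar> \<ge> 4/5 * norm z"
    by (rule power2_le_imp_le) simp
  have xz: "\<bar>x\<bar> \<le> norm z" using abs_Re_le_cmod by (simp add: x_def)
  have \<rho>: "\<rho> \<ge> 2/5 * norm z" "\<rho> > 0" using x nz by (auto simp: \<rho>_def)
  define S where "S = {w. \<bar>Re w - x\<bar> + \<bar>Im w\<bar> \<le> \<rho>}"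
  define I where "I = {w. \<bar>Re w - x\<bar> + \<bar>Im w\<bar> < \<rho>}"
  define g where "g = (\<lambda>w::complex. if w = 0 then 0 else exp (- (of_real A / w)))"
  define c1 where "c1 = (\<lambda>w::complex. w - of_real (x - \<rho>))"
  define c2 where "c2 = (\<lambda>w::complex. of_real (x + \<rho>) - w)"
  define G where "G = (\<lambda>w. f w * (g (c1 w) * g (c2 w)))"
  have cS: "\<bar>Im (c1 w)\<bar> \<le> Re (c1 w)" "\<bar>Im (c2 w)\<bar> \<le> Re (c2 w)" if "w \<in> S" for w
    using that by (auto simp: S_def c1_def c2_def)
  have gle: "norm (g w) \<le> 1" if "\<bar>Im w\<bar> \<le> Re w" for w
    using norm_exp_inverse_le(2)[OF that A] by (simp add: g_def)
  have closedS: "closed S" unfolding S_def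
    by (intro closed_Collect_le continuous_intros)
  have openI: "open I" unfolding I_def
    by (intro open_Collect_less continuous_intros)
  have IS: "I \<subseteq> S" by (auto simp: I_def S_def)
  have normS: "norm z / 4 \<le> norm w" "norm w \<le> 2 * norm z" if "w \<in> S" for w
  proof -
    have "\<bar>Re w\<bar> + \<bar>Im w\<bar> \<le> \<bar>x\<bar> + \<rho>" using that by (auto simp: S_def)
    then show "norm w \<le> 2 * norm z" using cmod_le[of w] xz unfolding \<rho>_def by linarith
    have "\<bar>x\<bar> - \<rho> \<le> \<bar>Re w\<bar>" using that by (auto simp: S_def)
    then show "norm z / 4 \<le> norm w" using abs_Re_le_cmod[of w] x nz unfolding \<rho>_def by linarith
  qed
  have zI: "z \<in> I" using False \<rho> nz by (auto simp: I_def x_def)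
  have bnd: "norm (G w) \<le> M" if w: "w \<in> S - I" for w
  proof (cases "Im w = 0")
    case True
    then have "c1 w = 0 \<or> c2 w = 0"
      using w by (auto simp: S_def I_def c1_def c2_def complex_eq_iff abs_if split: if_splits)
    then show ?thesis using M by (auto simp: G_def g_def)
  next
    case False
    define t where "t = \<bar>Im w\<bar>"
    have t: "t > 0" using False by (simp add: t_def)
    have wS: "w \<in> S" using w by simp
    have "norm (f w) \<le> M * exp (C * norm w / t)"
      unfolding t_def using bound[OF False] normS[OF wS] by blast
    also have "C * norm w / t \<le> A / (2 * t)"
      using normS(2)[OF wS] C t by (simp add: A_def field_simps)
    finally have fw: "norm (f w) \<le> M * exp (A / (2 * t))" using M by (simp add: mult_left_mono)
    have ne: "c1 w \<noteq> 0" "c2 w \<noteq> 0" using False by (auto simp: c1_def c2_def complex_eq_iff)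
    \<comment> \<open>On an edge the vector to \<open>w\<close> from the nearer corner lies on a
      diagonal, which makes \<open>Re (A / c)\<close> explicit. The factor of the other corner is
      only bounded by \<open>1\<close>.\<close>
    have corner: "norm (g c) = exp (- (A / (2 * t)))" if "Re c = t" "\<bar>Im c\<bar> = t" for c
    proof -
      have "(Im c)\<^sup>2 = t\<^sup>2" using that(2) by (metis power2_abs)
      then have "Re (of_real A / c) = A / (2 * t)"
        using that t by (simp add: Re_divide power2_eq_square)
      moreover have "c \<noteq> 0" using that t by auto
      ultimately show ?thesis by (simp add: g_def)
    qed
    have gg: "norm (g (c1 w) * g (c2 w)) \<le> exp (- (A / (2 * t)))"
    proof (cases "Re w \<le> x")
      case True
      then have "Re (c1 w) = t" "\<bar>Im (c1 w)\<bar> = t"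
        using w by (auto simp: S_def I_def c1_def t_def)
      then have "norm (g (c1 w)) = exp (- (A / (2 * t)))" by (rule corner)
      then show ?thesis using gle[OF cS(2)[OF wS]] by (simp add: norm_mult mult_left_le)
    next
      case False
      then have "Re (c2 w) = t" "\<bar>Im (c2 w)\<bar> = t"
        using w by (auto simp: S_def I_def c2_def t_def)
      then have "norm (g (c2 w)) = exp (- (A / (2 * t)))" by (rule corner)
      then show ?thesis using gle[OF cS(1)[OF wS]] by (simp add: norm_mult mult_left_le_one_le)
    qed
    have "norm (G w) \<le> M * exp (A / (2 * t)) * exp (- (A / (2 * t)))"
      unfolding G_def norm_mult[of "f w"] using fw gg by (rule mult_mono) (use M in auto)
    also have "\<dots> = M" by (simp add: exp_minus)
    finally show ?thesis .
  qed
  have "norm (G z) \<le> M"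
  proof (rule maximum_modulus_frontier[where S = I and f = G])
    show "bounded I"
      using normS(2) IS by (intro boundedI[of _ "2 * norm z"]) auto
    have cl: "closure I \<subseteq> S" using IS closedS by (simp add: closure_minimal)
    have cg: "continuous_on {w. \<bar>Im w\<bar> \<le> Re w} g"
      unfolding g_def by (rule continuous_on_exp_inverse[OF A])
    have "continuous_on S G" unfolding G_def
    proof (intro continuous_on_mult)
      show "continuous_on S f"
        using f holomorphic_on_imp_continuous_on holomorphic_on_subset by blast
      show "continuous_on S (\<lambda>w. g (c1 w))"
        by (rule continuous_on_compose2[OF cg]) (use cS(1) in \<open>auto simp: c1_def intro!: continuous_intros\<close>)
      show "continuous_on S (\<lambda>w. g (c2 w))"
        by (rule continuous_on_compose2[OF cg]) (use cS(2) in \<open>auto simp: c2_def intro!: continuous_intros\<close>)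
    qed
    then show "continuous_on (closure I) G" using cl continuous_on_subset by blast
    show "norm (G w) \<le> M" if "w \<in> frontier I" for w
      using that cl openI bnd by (auto simp: frontier_def interior_open)
    have ne: "c1 w \<noteq> 0" "c2 w \<noteq> 0" if "w \<in> I" for w
      using that by (auto simp: I_def c1_def c2_def complex_eq_iff)
    have "(\<lambda>w. f w * (exp (- (of_real A / c1 w)) * exp (- (of_real A / c2 w)))) holomorphic_on I"
      using ne holomorphic_on_subset[OF f, of I]
      by (auto simp: c1_def c2_def intro!: holomorphic_intros)
    then have "G holomorphic_on I"
      by (rule holomorphic_transform) (use ne in \<open>auto simp: G_def g_def\<close>)
    then show "G holomorphic_on interior I" using openI by (simp add: interior_open)
  qed (rule zI)
  \<comment> \<open>At \<open>z\<close> both corner vectors have real part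
    \<open>\<rho> \<ge> 2/5 * norm z\<close>, so \<open>A / norm c \<le> 10 * C\<close>. Undoing the
    two factors therefore costs \<open>exp (20 * C)\<close>, whatever the size of
    \<open>z\<close>.\<close>
  moreover have gz: "norm (g c) \<ge> exp (- (20 * C) / 2)" if "Re c = \<rho>" for c
  proof -
    have "c \<noteq> 0" using that \<rho> by auto
    have "2/5 * norm z \<le> norm c" using complex_Re_le_cmod[of c] that \<rho>(1) by linarith
    then have "A / norm c \<le> A / (2/5 * norm z)"
      using A nz by (intro divide_left_mono) (auto intro!: mult_pos_pos simp: \<open>c \<noteq> 0\<close>)
    also have "\<dots> = 10 * C" using nz by (simp add: A_def)
    finally have "norm (of_real A / c) \<le> 10 * C" using A by (simp add: norm_divide)
    then have "Re (of_real A / c) \<le> 10 * C"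
      using complex_Re_le_cmod order_trans by blast
    then show ?thesis using \<open>c \<noteq> 0\<close> by (simp add: g_def)
  qed
  ultimately have "norm (f z) * (exp (- (20 * C) / 2) * exp (- (20 * C) / 2)) \<le> M"
  proof -
    have "exp (- (20 * C) / 2) * exp (- (20 * C) / 2) \<le> norm (g (c1 z)) * norm (g (c2 z))"
      by (intro mult_mono gz) (auto simp: c1_def c2_def x_def)
    then have "norm (f z) * (exp (- (20 * C) / 2) * exp (- (20 * C) / 2)) \<le> norm (G z)"
      by (simp add: G_def norm_mult mult_left_mono)
    then show ?thesis using \<open>norm (G z) \<le> M\<close> by linarith
  qed
  then have "norm (f z) * exp (- (20 * C)) \<le> M" by (simp flip: exp_add)
  then have "norm (f z) \<le> M * exp (20 * C)" by (simp add: exp_minus field_simps)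
  also have "\<dots> \<le> M * exp (40 * C)" using M C by (intro mult_left_mono) auto
  finally show ?thesis .
qed

section \<open>Entire functions of order 1/2 and their limits along the imaginary axis\<close>

text \<open>The comparison function is \<open>exp (- e * (1 + w) powr (3/4))\<close>. The exponent
  exceeds the growth order \<open>1/2\<close>, so it wins on large arcs, and is below
  \<open>1\<close>, so the power keeps a positive real part up to the imaginary axis. Finally
  \<open>e\<close> tends to \<open>0\<close>.\<close>

lemma Phragmen_Lindelof_right_half_plane:
  fixes f :: "complex \<Rightarrow> complex"
  assumes f: "f holomorphic_on UNIV" and K: "K \<ge> 0"
    and growth: "\<And>z. norm (f z) \<le> K * exp (K * sqrt (norm z))"
    and axis: "\<And>z. Re z = 0 \<Longrightarrow> norm (f z) \<le> B"
    and z: "Re z \<ge> 0"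
  shows "norm (f z) \<le> B"
proof -
  \<comment> \<open>In the half-plane the argument of \<open>1 + w\<close> is below
    \<open>pi / 2\<close> in modulus, that of its power \<open>3/4\<close> below
    \<open>3/8 * pi\<close>.\<close>
  define c where "c = cos (3/8 * pi)"
  have c: "c > 0" unfolding c_def by (rule cos_gt_zero_pi) (use pi_gt_zero in linarith)+
  \<comment> \<open>The shift by \<open>1\<close> makes \<open>h\<close> holomorphic across the
    imaginary axis, which is part of the boundary.\<close>
  define h where "h = (\<lambda>w::complex. exp (3/4 * Ln (1 + w)))"
  have B: "B \<ge> 0" using axis[of 0] norm_ge_zero[of "f 0"] by (simp del: norm_ge_zero)
  have Re_h: "Re (h w) \<ge> c * norm w powr (3/4)" if "Re w \<ge> 0" for w
  proof -
    have nz: "1 + w \<noteq> 0" using that by (auto simp: complex_eq_iff)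
    have "\<bar>Im (Ln (1 + w))\<bar> < pi / 2" using Re_Ln_pos_lt[OF nz] that by simp
    then have "cos (3/8 * pi) \<le> cos \<bar>3/4 * Im (Ln (1 + w))\<bar>"
      by (intro cos_monotone_0_pi_le) auto
    then have cc: "c \<le> cos (3/4 * Im (Ln (1 + w)))" by (simp only: cos_abs_real c_def)
    have "(norm w)\<^sup>2 \<le> (norm (1 + w))\<^sup>2" using that unfolding cmod_power2 by (simp add: power2_eq_square algebra_simps)
    then have "norm w \<le> norm (1 + w)" by (rule power2_le_imp_le) simp
    then have "norm w powr (3/4) \<le> norm (1 + w) powr (3/4)" by (intro powr_mono2) auto
    also have "\<dots> = exp (3/4 * Re (Ln (1 + w)))" using nz by (simp add: powr_def)
    finally have "c * norm w powr (3/4) \<le> cos (3/4 * Im (Ln (1 + w))) * exp (3/4 * Re (Ln (1 + w)))"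
      using cc c by (intro mult_mono) auto
    then show ?thesis by (simp add: h_def Re_exp mult.commute)
  qed
  have "norm (f z) * exp (- (e * Re (h z))) \<le> B + e" if e: "e > 0" for e
  proof -
    have "((\<lambda>R. K * exp (K * sqrt R - e * c * R powr (3/4))) \<longlongrightarrow> 0) at_top"
    proof -
      have "e * c > 0" using e c by simp
      then have "filterlim (\<lambda>R. K * sqrt R - (e * c) * R powr (3/4)) at_bot at_top"
        by real_asymp
      then have "((\<lambda>R. exp (K * sqrt R - e * c * R powr (3/4))) \<longlongrightarrow> 0) at_top"
        by (rule filterlim_compose[OF exp_at_bot])
      then show ?thesis by (rule tendsto_mult_right_zero)
    qed
    then have "\<forall>\<^sub>F R in at_top. K * exp (K * sqrt R - e * c * R powr (3/4)) < e"
      using e by (rule order_tendstoD)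
    then obtain R0 where R0: "\<And>R. R \<ge> R0 \<Longrightarrow> K * exp (K * sqrt R - e * c * R powr (3/4)) < e"
      by (auto simp: eventually_at_top_linorder)
    define R where "R = max (norm z + 1) R0"
    define S where "S = {w. Re w > 0} \<inter> ball 0 R"
    define G where "G = (\<lambda>w. f w * exp (- (of_real e * h w)))"
    have openS: "open S" unfolding S_def
      by (intro open_Int open_ball open_halfspace_Re_gt)
    have normG: "norm (G w) = norm (f w) * exp (- (e * Re (h w)))" for w
      by (simp add: G_def norm_mult)
    have clS: "closure S \<subseteq> {w. Re w \<ge> 0} \<inter> cball 0 R"
      by (rule closure_minimal) (auto simp: S_def intro!: closed_Int closed_halfspace_Re_ge)
    have holG: "G holomorphic_on {w. Re w > -1}"
      unfolding G_def h_def using holomorphic_on_subset[OF f subset_UNIV]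
      by (intro holomorphic_intros) (auto simp: complex_nonpos_Reals_iff)
    have frontier: "norm (G w) \<le> B + e" if "w \<in> frontier S" for w
    proof (cases "Re w = 0")
      case True
      have "e * Re (h w) \<ge> 0"
        using Re_h[of w] True e c by (smt (verit) mult_nonneg_nonneg powr_ge_zero)
      then have "norm (f w) * exp (- (e * Re (h w))) \<le> B * 1"
        using axis[OF True] B by (intro mult_mono) auto
      then show ?thesis using e by (simp add: normG)
    next
      case False
      have "w \<in> closure S" "w \<notin> S"
        using that openS by (auto simp: frontier_def interior_open)
      then have "Re w \<ge> 0" "norm w \<le> R" "\<not> (Re w > 0 \<and> norm w < R)"
        using clS by (auto simp: S_def)
      then have w: "Re w > 0" "norm w = R" using False by auto
      have "norm (G w) \<le> K * exp (K * sqrt R) * exp (- (e * (c * R powr (3/4))))"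
        unfolding normG using growth[of w] Re_h[of w] w e K
        by (intro mult_mono) auto
      also have "\<dots> = K * exp (K * sqrt R - e * c * R powr (3/4))"
        by (simp add: exp_diff exp_minus field_simps)
      also have "\<dots> < e" by (rule R0) (simp add: R_def)
      finally show ?thesis using B by simp
    qed
    have bound: "norm (G w) \<le> B + e" if "w \<in> S" for w
    proof (rule maximum_modulus_frontier[where S = S and f = G])
      show "G holomorphic_on interior S"
        by (rule holomorphic_on_subset[OF holG]) (use interior_subset in \<open>fastforce simp: S_def\<close>)
      show "continuous_on (closure S) G"
        by (rule continuous_on_subset[OF holomorphic_on_imp_continuous_on[OF holG]]) (use clS in force)
      show "bounded S" unfolding S_def by (rule bounded_Int) simp
    qed (use that frontier in auto)
    show ?thesis
    proof (cases "Re z = 0")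
      case True
      have "e * Re (h z) \<ge> 0"
        using Re_h[of z] True e c by (smt (verit) mult_nonneg_nonneg powr_ge_zero)
      then have "norm (f z) * exp (- (e * Re (h z))) \<le> B * 1"
        using axis[OF True] B by (intro mult_mono) auto
      then show ?thesis using e by simp
    next
      case False
      then have "z \<in> S" using z by (simp add: S_def R_def)
      then show ?thesis using bound normG by metis
    qed
  qed
  note * = this
  have lim1: "((\<lambda>e. norm (f z) * exp (- (e * Re (h z)))) \<longlongrightarrow> norm (f z) * exp (- (0 * Re (h z)))) (at_right 0)"
    by (intro tendsto_intros)
  have lim2: "((\<lambda>e. B + e) \<longlongrightarrow> B + 0) (at_right 0)"
    by (intro tendsto_intros)
  have "norm (f z) * exp (- (0 * Re (h z))) \<le> B + 0"
    by (rule tendsto_le[OF _ lim2 lim1]) (use * in \<open>auto simp: eventually_at_filter\<close>)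
  then show ?thesis by simp
qed

text \<open>Both halves of the imaginary axis are included at once, because the axis is the whole
  boundary of the two half-planes to which the growth argument is applied.\<close>

definition imag_infinity :: "complex filter" where
  "imag_infinity = inf at_infinity (principal {z. Re z = 0})"

lemma eventually_imag_infinity:
  "eventually P imag_infinity \<longleftrightarrow> (\<exists>R. \<forall>z. Re z = 0 \<longrightarrow> norm z \<ge> R \<longrightarrow> P z)"
  by (auto simp: imag_infinity_def eventually_inf_principal eventually_at_infinity)

lemma imag_infinity_neq_bot [simp]: "imag_infinity \<noteq> bot"
proof -
  have "\<exists>z. Re z = 0 \<and> norm z \<ge> R" for R
    by (rule exI[of _ "Complex 0 \<bar>R\<bar>"]) (simp add: cmod_def)
  then show ?thesis
    unfolding trivial_limit_def eventually_imag_infinity by blast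
qed

text \<open>Boundedness on the imaginary axis spreads to both half-planes, to the left one through
  \<open>f (- z)\<close>. Liouville's theorem leaves a constant, which can only be \<open>L\<close>.
  Three identities rest on this: equality of the second characteristic functions, equality of the
  first ones, and parallel fundamental solutions.\<close>

theorem entire_eq_limit:
  fixes f :: "complex \<Rightarrow> complex"
  assumes f: "f holomorphic_on UNIV" and lim: "(f \<longlongrightarrow> L) imag_infinity"
    and growth: "\<And>z. norm z \<ge> R \<Longrightarrow> norm (f z) \<le> K * exp (K * sqrt (norm z))"
  shows "f z = L"
proof -
  have bdd: "\<exists>B\<ge>0. \<forall>z. norm z \<le> r \<longrightarrow> norm (f z) \<le> B" for r
    by (rule norm_bounded_on_compact[of "cball 0 r" f])
      (use continuous_on_subset[OF holomorphic_on_imp_continuous_on[OF f]] in auto)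
  obtain B0 where B0: "B0 \<ge> 0" "\<And>z. norm z \<le> R \<Longrightarrow> norm (f z) \<le> B0" using bdd by blast
  define K' where "K' = max \<bar>K\<bar> B0"
  have K': "K' \<ge> 0" by (simp add: K'_def)
  have growth': "norm (f z) \<le> K' * exp (K' * sqrt (norm z))" for z
  proof (cases "norm z \<le> R")
    case True
    have "norm (f z) \<le> K' * 1" using B0(2)[OF True] by (simp add: K'_def)
    also have "\<dots> \<le> K' * exp (K' * sqrt (norm z))"
      using K' by (intro mult_left_mono) auto
    finally show ?thesis .
  next
    case False
    then have "norm (f z) \<le> K * exp (K * sqrt (norm z))" using growth by simp
    also have "\<dots> \<le> K' * exp (K' * sqrt (norm z))"
      by (intro mult_mono) (auto simp: K'_def intro!: mult_right_mono)
    finally show ?thesis .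
  qed
  have "\<forall>\<^sub>F z in imag_infinity. dist (f z) L < 1" using lim by (rule tendstoD) simp
  then obtain R1 where R1: "\<And>z. Re z = 0 \<Longrightarrow> norm z \<ge> R1 \<Longrightarrow> dist (f z) L < 1"
    by (auto simp: eventually_imag_infinity)
  obtain B1 where B1: "B1 \<ge> 0" "\<And>z. norm z \<le> R1 \<Longrightarrow> norm (f z) \<le> B1" using bdd by blast
  define B where "B = max B1 (norm L + 1)"
  have axis: "norm (f z) \<le> B" if "Re z = 0" for z
  proof (cases "norm z \<le> R1")
    case False
    then have "dist (f z) L < 1" using R1 that by simp
    then have "norm (f z) \<le> norm L + 1"
      using norm_triangle_ineq2[of "f z" L] by (simp add: dist_norm)
    then show ?thesis by (simp add: B_def)
  qed (use B1 in \<open>auto simp: B_def le_max_iff_disj\<close>)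
  have bounded: "norm (f z) \<le> B" for z
  proof (cases "Re z \<ge> 0")
    case True
    then show ?thesis using Phragmen_Lindelof_right_half_plane[OF f K' growth' axis] by simp
  next
    case False
    have "(f \<circ> uminus) holomorphic_on UNIV"
      by (rule holomorphic_on_compose[OF _ holomorphic_on_subset[OF f]]) (auto intro: holomorphic_intros)
    then have "(\<lambda>z. f (- z)) holomorphic_on UNIV" by (simp add: o_def)
    then have "norm (f (- (- z))) \<le> B"
      by (rule Phragmen_Lindelof_right_half_plane[OF _ K']) (use growth'[of "- _"] axis False in auto)
    then show ?thesis by simp
  qed
  then have "bounded (range f)" by (auto intro!: boundedI)
  then obtain c where c: "\<And>z. f z = c" using Liouville_theorem[OF f]
    by (metis constant_on_def UNIV_I)
  have "((\<lambda>_. c) \<longlongrightarrow> L) imag_infinity" using lim by (simp add: c[abs_def])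
  then show ?thesis using c by (simp add: tendsto_const_iff)
qed

lemma tendsto_imag_approach:
  "filterlim (\<lambda>e. c + \<i> * complex_of_real e) (at c) (at_right 0)"
proof -
  have "((\<lambda>e. c + \<i> * complex_of_real e) \<longlongrightarrow> c + \<i> * complex_of_real 0) (at_right 0)"
    by (intro tendsto_intros)
  then show ?thesis
    by (auto simp: filterlim_at eventually_at_filter)
qed

text \<open>At height \<open>e\<close> above the real zero \<open>c\<close> the bound controls
  \<open>g\<close> by a bounded multiple of \<open>f / e\<close>, whose modulus tends to that of
  \<open>deriv f c\<close>. A multiple zero of \<open>f\<close> would force
  \<open>g c = 0\<close>.\<close>

lemma deriv_nonzero_of_vertical_bound:
  fixes f g :: "complex \<Rightarrow> complex"
  assumes f: "f holomorphic_on UNIV" and g: "g holomorphic_on UNIV"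
    and bound: "\<And>z. Im z \<noteq> 0 \<Longrightarrow> norm (g z) \<le> C * (1 + (norm z)\<^sup>2) / \<bar>Im z\<bar> * norm (f z)"
    and zero: "f c = 0" "g c \<noteq> 0" "Im c = 0"
  shows "deriv f c \<noteq> 0"
proof
  assume 0: "deriv f c = 0"
  define \<gamma> where "\<gamma> = (\<lambda>e. c + \<i> * complex_of_real e)"
  have \<gamma>: "filterlim \<gamma> (at c) (at_right 0)"
    unfolding \<gamma>_def by (rule tendsto_imag_approach)
  have "(f has_field_derivative 0) (at c)"
    using holomorphic_derivI[OF f open_UNIV, of c] 0 by simp
  then have "((\<lambda>z. (f z - f c) / (z - c)) \<longlongrightarrow> 0) (at c)"
    by (simp add: has_field_derivative_iff)
  then have "((\<lambda>e. (f (\<gamma> e) - f c) / (\<gamma> e - c)) \<longlongrightarrow> 0) (at_right 0)"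
    by (rule filterlim_compose[OF _ \<gamma>])
  then have lim1: "((\<lambda>e. norm ((f (\<gamma> e) - f c) / (\<gamma> e - c))) \<longlongrightarrow> 0) (at_right 0)"
    by (rule tendsto_norm_zero)
  have \<gamma>n: "(\<gamma> \<longlongrightarrow> c) (at_right 0)"
    using \<gamma> by (simp add: filterlim_at)
  have "isCont g c"
    using holomorphic_on_imp_continuous_on[OF g] by (simp add: continuous_on_eq_continuous_at)
  then have lim2: "((\<lambda>e. norm (g (\<gamma> e))) \<longlongrightarrow> norm (g c)) (at_right 0)"
    by (intro tendsto_norm isCont_tendsto_compose[OF _ \<gamma>n])
  have lim3: "((\<lambda>e. C * (1 + (norm (\<gamma> e))\<^sup>2) * norm ((f (\<gamma> e) - f c) / (\<gamma> e - c))) \<longlongrightarrow> C * (1 + (norm c)\<^sup>2) * 0) (at_right 0)"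
    by (intro tendsto_intros lim1 \<gamma>n)
  have "norm (g c) \<le> C * (1 + (norm c)\<^sup>2) * 0"
  proof (rule tendsto_le[OF _ lim3 lim2])
    have "norm (g (\<gamma> e)) \<le> C * (1 + (norm (\<gamma> e))\<^sup>2) * norm ((f (\<gamma> e) - f c) / (\<gamma> e - c))" if "e > 0" for e
      using bound[of "\<gamma> e"] that zero by (simp add: \<gamma>_def norm_divide norm_mult)
    then show "\<forall>\<^sub>F e in at_right 0. norm (g (\<gamma> e)) \<le> C * (1 + (norm (\<gamma> e))\<^sup>2) * norm ((f (\<gamma> e) - f c) / (\<gamma> e - c))"
      by (auto simp: eventually_at_filter)
  qed simp
  then show False using zero by simp
qed

section \<open>Moving infinitely many zeros\<close>

text \<open>One induction step trades the zero \<open>p N\<close> for the zero \<open>r N\<close>.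
  Stating the result with both products multiplied out avoids division at the points
  \<open>p n\<close>.\<close>

lemma entire_move_zeros:
  fixes D :: "complex \<Rightarrow> complex" and p r :: "nat \<Rightarrow> complex"
  assumes D: "D holomorphic_on UNIV" and p: "inj p" "\<And>n. D (p n) = 0"
  shows "\<exists>h. h holomorphic_on UNIV \<and> (\<forall>z. h z * (\<Prod>n<N. p n - z) = D z * (\<Prod>n<N. r n - z))"
proof (induction N)
  case 0
  then show ?case using D by auto
next
  case (Suc N)
  then obtain h where h: "h holomorphic_on UNIV"
    "\<And>z. h z * (\<Prod>n<N. p n - z) = D z * (\<Prod>n<N. r n - z)" by blast
  \<comment> \<open>Distinctness of the \<open>p n\<close> ensures that the zero of \<open>D\<close>
    at \<open>p N\<close> has not been divided out yet and is inherited by \<open>h\<close>.\<close>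
  have "(\<Prod>n<N. p n - p N) \<noteq> 0" using p(1) by (auto simp: inj_def)
  then have hN: "h (p N) = 0" using h(2)[of "p N"] p(2)[of N] by auto
  have der: "deriv (\<lambda>z. p N - z) z = -1" for z
    by (rule DERIV_imp_deriv) (auto intro!: derivative_eq_intros)
  obtain h' where h': "h' holomorphic_on UNIV" "\<And>z. h z * (r N - z) = h' z * (p N - z)"
  proof -
    have "\<exists>h'. h' holomorphic_on UNIV \<and> (\<forall>z. h z * (r N - z) = h' z * (p N - z))"
      by (rule entire_divide_simple_zeros) (use hN der h(1) in \<open>auto intro!: holomorphic_intros\<close>)
    then show ?thesis using that by blast
  qed
  have "h' z * (\<Prod>n<Suc N. p n - z) = D z * (\<Prod>n<Suc N. r n - z)" for z
  proof -
    have "h' z * (\<Prod>n<Suc N. p n - z) = (h' z * (p N - z)) * (\<Prod>n<N. p n - z)" by (simp add: mult_ac)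
    also have "\<dots> = (h z * (\<Prod>n<N. p n - z)) * (r N - z)" by (simp add: mult_ac flip: h'(2))
    finally show ?thesis by (simp add: h(2) mult_ac)
  qed
  then show ?case using h' by blast
qed

text \<open>Each factor satisfies
  \<open>norm (r - z) \<le> norm (p - z) + \<bar>r / p - 1\<bar> * p\<close>. Taking the imaginary
  part of \<open>(p - z) * cnj z\<close> gives
  \<open>p * \<bar>Im z\<bar> \<le> norm (p - z) * norm z\<close>, so the relative error is
  multiplied by \<open>norm z / \<bar>Im z\<bar>\<close> at most. The resulting bound does not
  depend on \<open>N\<close>.\<close>

lemma norm_prod_quotient_le:
  fixes p r :: "nat \<Rightarrow> real"
  assumes p: "\<And>n. p n > 0" and sum: "summable (\<lambda>n. \<bar>r n / p n - 1\<bar>)" and z: "Im z \<noteq> 0"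
  shows "norm (\<Prod>n<N. of_real (r n) - z) \<le>
    exp ((\<Sum>n. \<bar>r n / p n - 1\<bar>) * norm z / \<bar>Im z\<bar>) * norm (\<Prod>n<N. of_real (p n) - z)"
proof -
  define t where "t = norm z / \<bar>Im z\<bar>"
  have t: "t \<ge> 0" by (simp add: t_def)
  have step: "norm (of_real (r n) - z) \<le> exp (\<bar>r n / p n - 1\<bar> * t) * norm (of_real (p n) - z)" for n
  proof -
    have "p n * \<bar>Im z\<bar> = \<bar>Im ((of_real (p n) - z) * cnj z)\<bar>"
      using p[of n] by (simp add: abs_mult algebra_simps)
    also have "\<dots> \<le> norm (of_real (p n) - z) * norm z"
      using abs_Im_le_cmod[of "(of_real (p n) - z) * cnj z"] by (simp add: norm_mult)
    finally have pt: "p n \<le> norm (of_real (p n) - z) * t"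
      using z by (simp add: t_def field_simps)
    have "norm (of_real (r n) - z) \<le> norm (of_real (p n) - z) + norm (of_real (r n - p n) :: complex)"
      by (rule order_trans[OF _ norm_triangle_ineq]) simp
    also have "norm (of_real (r n - p n) :: complex) = \<bar>r n / p n - 1\<bar> * p n"
      using p[of n] by (simp add: field_simps flip: abs_mult_pos del: of_real_diff)
    also have "\<dots> \<le> \<bar>r n / p n - 1\<bar> * (norm (of_real (p n) - z) * t)"
      using pt by (intro mult_left_mono) auto
    finally have "norm (of_real (r n) - z) \<le> (1 + \<bar>r n / p n - 1\<bar> * t) * norm (of_real (p n) - z)"
      by (simp add: algebra_simps)
    also have "\<dots> \<le> exp (\<bar>r n / p n - 1\<bar> * t) * norm (of_real (p n) - z)"
      by (intro mult_right_mono exp_ge_add_one_self) auto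
    finally show ?thesis .
  qed
  have "norm (\<Prod>n<N. of_real (r n) - z) \<le> (\<Prod>n<N. exp (\<bar>r n / p n - 1\<bar> * t) * norm (of_real (p n) - z))"
    unfolding prod_norm[symmetric] by (intro prod_mono) (use step in auto)
  also have "\<dots> = exp ((\<Sum>n<N. \<bar>r n / p n - 1\<bar>) * t) * norm (\<Prod>n<N. of_real (p n) - z)"
    by (simp add: prod.distrib exp_sum sum_distrib_right prod_norm)
  also have "\<dots> \<le> exp ((\<Sum>n. \<bar>r n / p n - 1\<bar>) * t) * norm (\<Prod>n<N. of_real (p n) - z)"
    using sum_le_suminf[OF sum, of "{..<N}"] t by (intro mult_right_mono) (auto intro!: mult_right_mono)
  finally show ?thesis by (simp add: t_def)
qed

text \<open>Partial products are compared in both directions: the quotients \<open>r / p\<close>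
  bound the functions with moved zeros by \<open>D\<close>, the quotients \<open>p / r\<close>
  recover \<open>D\<close> from them.\<close>

lemma summable_quotient_swap:
  fixes p r :: "nat \<Rightarrow> real"
  assumes p: "\<And>n. p n > 0" and r: "\<And>n. r n > 0" and sum: "summable (\<lambda>n. \<bar>p n / r n - 1\<bar>)"
  shows "summable (\<lambda>n. \<bar>r n / p n - 1\<bar>)"
proof (rule summable_comparison_test_ev)
  have "(\<lambda>n. \<bar>p n / r n - 1\<bar>) \<longlonglongrightarrow> 0" using sum by (rule summable_LIMSEQ_zero)
  then have "\<forall>\<^sub>F n in sequentially. \<bar>p n / r n - 1\<bar> < 1/2" by (rule order_tendstoD) simp
  then show "\<forall>\<^sub>F n in sequentially. norm \<bar>r n / p n - 1\<bar> \<le> 2 * \<bar>p n / r n - 1\<bar>"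
  proof eventually_elim
    case (elim n)
    then have "r n / p n < 2" using p[of n] r[of n] by (simp add: field_simps abs_if split: if_splits)
    moreover have "\<bar>r n / p n - 1\<bar> = r n / p n * \<bar>p n / r n - 1\<bar>"
      using p[of n] r[of n] by (simp add: field_simps abs_if)
    ultimately have "\<bar>r n / p n - 1\<bar> \<le> 2 * \<bar>p n / r n - 1\<bar>" by (simp only: mult_right_mono less_imp_le abs_ge_zero)
    then show ?case by simp
  qed
qed (use sum in simp)


text \<open>To be read with \<open>f\<close>, \<open>f'\<close> as the first characteristic
  functions of the two potentials (\<open>f'\<close> is no derivative), \<open>g\<close> as the
  common second one, \<open>p\<close> the points \<open>a (k n)\<close> and \<open>r\<close> the
  points \<open>b (l n)\<close>. The functions \<open>H N = D * R N / P N\<close> form a normal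
  family. A limit \<open>G\<close> vanishes at all zeros of \<open>f\<close>, and
  \<open>E = G / f\<close> turns out to be zero; the estimate of \<open>D\<close> by
  \<open>H N\<close>, uniform in \<open>N\<close>, then gives \<open>D = 0\<close>.\<close>

theorem entire_eq_of_shifted_zeros:
  fixes f f' g :: "complex \<Rightarrow> complex" and p r :: "nat \<Rightarrow> real"
  assumes f: "f holomorphic_on UNIV" and f': "f' holomorphic_on UNIV" and g: "g holomorphic_on UNIV"
    and f'_le: "\<And>z. Im z \<noteq> 0 \<Longrightarrow> norm (f' z) \<le> C * (1 + (norm z)\<^sup>2) / \<bar>Im z\<bar> * norm (g z)"
    and g_le: "\<And>z. Im z \<noteq> 0 \<Longrightarrow> norm (g z) \<le> C * (1 + (norm z)\<^sup>2) / \<bar>Im z\<bar> * norm (f z)"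
    and zeros: "\<And>z. f z = 0 \<Longrightarrow> Im z = 0 \<and> g z \<noteq> 0 \<and> (f' z = 0 \<or> z \<in> range (\<lambda>n. of_real (r n)))"
    and p: "inj p" "\<And>n. p n > 0" "\<And>n. g (of_real (p n)) = 0" "\<And>n. f (of_real (p n)) = f' (of_real (p n))"
    and r: "\<And>n. r n > 0"
    and sum: "summable (\<lambda>n. \<bar>p n / r n - 1\<bar>)"
    and lim: "((\<lambda>z. f' z / f z) \<longlongrightarrow> 1) imag_infinity"
  shows "f z = f' z"
proof -
  define D where "D = (\<lambda>z. f z - f' z)"
  have D: "D holomorphic_on UNIV" unfolding D_def by (intro holomorphic_intros f f')
  define P where "P = (\<lambda>N z. \<Prod>n<N. complex_of_real (p n) - z)"
  define R where "R = (\<lambda>N z. \<Prod>n<N. complex_of_real (r n) - z)"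
  have Pnz: "P N z \<noteq> 0" if "Im z \<noteq> 0" for N z using that by (auto simp: P_def)
  have Rnz: "R N z \<noteq> 0" if "Im z \<noteq> 0" for N z using that by (auto simp: R_def)
  have fnz: "f z \<noteq> 0" if "Im z \<noteq> 0" for z using zeros that by blast
  define c1 where "c1 = (\<Sum>n. \<bar>p n / r n - 1\<bar>)"
  \<comment> \<open>The added \<open>1\<close> makes \<open>c2\<close> strictly positive, as the
    bound across the real axis requires.\<close>
  define c2 where "c2 = (\<Sum>n. \<bar>r n / p n - 1\<bar>) + 1"
  have sum': "summable (\<lambda>n. \<bar>r n / p n - 1\<bar>)"
    by (rule summable_quotient_swap[OF p(2) r sum])
  have c2: "c2 > 0" unfolding c2_def using suminf_nonneg[OF sum'] by simp
  have R_le: "norm (R N z) \<le> exp (c2 * norm z / \<bar>Im z\<bar>) * norm (P N z)" if "Im z \<noteq> 0" for N z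
  proof -
    have "norm (R N z) \<le> exp ((c2 - 1) * norm z / \<bar>Im z\<bar>) * norm (P N z)"
      unfolding R_def P_def c2_def using norm_prod_quotient_le[OF p(2) sum' that] by simp
    also have "\<dots> \<le> exp (c2 * norm z / \<bar>Im z\<bar>) * norm (P N z)"
      by (intro mult_right_mono) (auto intro!: divide_right_mono mult_right_mono)
    finally show ?thesis .
  qed
  have P_le: "norm (P N z) \<le> exp (c1 * norm z / \<bar>Im z\<bar>) * norm (R N z)" if "Im z \<noteq> 0" for N z
    unfolding R_def P_def c1_def using norm_prod_quotient_le[OF r sum that] by simp
  have "\<exists>h. h holomorphic_on UNIV \<and> (\<forall>z. h z * P N z = D z * R N z)" for N
    unfolding P_def R_def
    by (rule entire_move_zeros[OF D]) (use p in \<open>auto simp: inj_def D_def\<close>)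
  then obtain H where H: "\<And>N. H N holomorphic_on UNIV" "\<And>N z. H N z * P N z = D z * R N z"
    by metis
  have H_le: "norm (H N z) \<le> norm (D z) * exp (c2 * norm z / \<bar>Im z\<bar>)" if "Im z \<noteq> 0" for N z
  proof -
    have "norm (H N z) * norm (P N z) = norm (D z) * norm (R N z)"
      by (metis H(2) norm_mult)
    also have "\<dots> \<le> norm (D z) * exp (c2 * norm z / \<bar>Im z\<bar>) * norm (P N z)"
      using mult_left_mono[OF R_le[OF that], of "norm (D z)"] by (simp add: mult_ac)
    finally show ?thesis using Pnz[OF that] by simp
  qed
  have D_le: "norm (D z) \<le> norm (H N z) * exp (c1 * norm z / \<bar>Im z\<bar>)" if "Im z \<noteq> 0" for N z
  proof -
    have "norm (D z) * norm (R N z) = norm (H N z) * norm (P N z)"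
      by (metis H(2) norm_mult)
    also have "\<dots> \<le> norm (H N z) * exp (c1 * norm z / \<bar>Im z\<bar>) * norm (R N z)"
      using mult_left_mono[OF P_le[OF that], of "norm (H N z)"] by (simp add: mult_ac)
    finally show ?thesis using Rnz[OF that] by simp
  qed
  have bddD: "\<exists>B\<ge>0. \<forall>z. norm z \<le> \<rho> \<longrightarrow> norm (D z) \<le> B" for \<rho>
    by (rule norm_bounded_on_compact[of "cball 0 \<rho>" D])
      (use continuous_on_subset[OF holomorphic_on_imp_continuous_on[OF D]] in auto)
  have bdd: "\<exists>B. \<forall>h\<in>range H. \<forall>z\<in>K. norm (h z) \<le> B" if cK: "compact K" for K
  proof -
    obtain \<rho> where \<rho>: "\<And>z. z \<in> K \<Longrightarrow> norm z \<le> \<rho>"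
      using compact_imp_bounded[OF cK] unfolding bounded_iff by blast
    define \<rho>' where "\<rho>' = max \<rho> 1"
    obtain M where M: "M \<ge> 0" "\<And>z. norm z \<le> 2 * \<rho>' \<Longrightarrow> norm (D z) \<le> M" using bddD by blast
    have *: "norm (H N z) \<le> M * exp (40 * c2)" if "z \<noteq> 0" "norm z \<le> \<rho>'" for N z
    proof (rule holomorphic_bound_off_real_axis[OF H(1) c2 M(1) that(1)])
      fix w assume w: "Im w \<noteq> 0" "norm w \<le> 2 * norm z"
      show "norm (H N w) \<le> M * exp (c2 * norm w / \<bar>Im w\<bar>)"
        by (rule order_trans[OF H_le[OF w(1)] mult_right_mono]) (use M(2)[of w] w that in auto)
    qed
    \<comment> \<open>The bound across the real axis excludes the origin, which is the centre of no
      suitable square; the unit circle takes over.\<close>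
    have "norm (H N 0) \<le> M * exp (40 * c2)" for N
    proof (rule maximum_modulus_frontier[where S = "ball 0 1" and f = "H N"])
      show "H N holomorphic_on interior (ball 0 1)" "continuous_on (closure (ball 0 1)) (H N)"
        using H(1) holomorphic_on_subset holomorphic_on_imp_continuous_on continuous_on_subset subset_UNIV by blast+
      show "norm (H N z) \<le> M * exp (40 * c2)" if "z \<in> frontier (ball 0 1)" for z
        using that by (intro *) (auto simp: \<rho>'_def)
    qed auto
    then have "norm (H N z) \<le> M * exp (40 * c2)" if "z \<in> K" for N z
      using *[of z N] \<rho>[OF that] by (cases "z = 0") (auto simp: \<rho>'_def)
    then show ?thesis by blast
  qed
  obtain G s where G: "G holomorphic_on UNIV" and s: "strict_mono (s :: nat \<Rightarrow> nat)"
    and Glim: "\<And>z. (\<lambda>n. H (s n) z) \<longlonglongrightarrow> G z"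
    by (rule Montel[of UNIV "range H" H]) (use H(1) bdd in auto)
  \<comment> \<open>A zero of \<open>f\<close> is either a zero of \<open>f'\<close>, hence of
    \<open>D\<close>, or equals some \<open>r j\<close>, which is a factor of \<open>R N\<close> as
    soon as \<open>N > j\<close>. The denominators \<open>P N\<close> do not vanish there because
    \<open>g\<close> does not.\<close>
  have Gzero: "G z = 0" if z: "f z = 0" for z
  proof -
    have ev: "\<forall>\<^sub>F n in sequentially. H (s n) z = 0"
    proof -
      have "P N z \<noteq> 0" for N
        using zeros[OF z] p(3) by (auto simp: P_def)
      moreover have "\<forall>\<^sub>F n in sequentially. D z * R (s n) z = 0"
        using zeros[OF z]
      proof (elim conjE disjE)
        assume "f' z = 0"
        then show ?thesis using z by (simp add: D_def)
      next
        assume "z \<in> range (\<lambda>n. complex_of_real (r n))"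
        then obtain j where j: "z = of_real (r j)" by blast
        have "R (s n) z = 0" if "n > j" for n
          using seq_suble[OF s, of n] that j by (auto simp: R_def intro!: bexI[of _ j])
        then show ?thesis by (intro eventually_mono[OF eventually_gt_at_top[of j]]) auto
      qed
      moreover have "H N z = 0" if "D z * R N z = 0" "P N z \<noteq> 0" for N
        using H(2)[of N z] that by simp
      ultimately show ?thesis by (blast intro: eventually_mono)
    qed
    then have "(\<lambda>n. H (s n) z) \<longlonglongrightarrow> 0" by (rule tendsto_eventually)
    then show "G z = 0" using Glim[of z] LIMSEQ_unique by blast
  qed
  have simple: "deriv f z \<noteq> 0" if "f z = 0" for z
    by (rule deriv_nonzero_of_vertical_bound[OF f g g_le that]) (use zeros[OF that] in auto)
  obtain E where E: "E holomorphic_on UNIV" "\<And>z. G z = E z * f z"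
    using entire_divide_simple_zeros[OF G f] Gzero simple by blast
  have G_le: "norm (G z) \<le> norm (D z) * exp (c2 * norm z / \<bar>Im z\<bar>)" if "Im z \<noteq> 0" for z
    using tendsto_norm[OF Glim[of z]] by (rule tendsto_upperbound) (use H_le[OF that] in auto)
  have E_le: "norm (E z) \<le> norm (f' z / f z - 1) * exp (c2 * norm z / \<bar>Im z\<bar>)" if "Im z \<noteq> 0" for z
  proof -
    have "norm (E z) * norm (f z) \<le> norm (f z - f' z) * exp (c2 * norm z / \<bar>Im z\<bar>)"
      using G_le[OF that] by (simp add: E(2) norm_mult D_def)
    also have "norm (f z - f' z) = norm (f' z / f z - 1) * norm (f z)"
    proof -
      have "f z - f' z = - ((f' z / f z - 1) * f z)" using fnz[OF that] by (simp add: field_simps)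
      then show ?thesis by (simp only: norm_minus_cancel norm_mult)
    qed
    finally show ?thesis using fnz[OF that] by (simp add: mult_ac)
  qed
  define C' where "C' = (2 * C)\<^sup>2 + 1"
  have C': "C' > 0" by (simp add: C'_def add_nonneg_pos)
  \<comment> \<open>Only polynomial growth of \<open>E\<close> has to be converted:
    \<open>(norm z)\<^sup>2 \<le> exp (4 * sqrt (norm z))\<close> explains the \<open>4\<close>, and
    the other numerical factors are generous.\<close>
  define K where "K = max 4 (24 * 16 * (C' * exp (40 * (c2 + 2))))"
  have E0: "E z = 0" for z
  proof (rule entire_eq_limit[OF E(1), where K = K and R = 4])
    have "((\<lambda>z. norm (f' z / f z - 1) * exp c2) \<longlongrightarrow> norm (1 - 1 :: complex) * exp c2) imag_infinity"
      by (intro tendsto_intros lim)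
    then have "((\<lambda>z. norm (f' z / f z - 1) * exp c2) \<longlongrightarrow> 0) imag_infinity" by simp
    then show "(E \<longlongrightarrow> 0) imag_infinity"
    proof (rule Lim_null_comparison[rotated])
      have "norm (E z) \<le> norm (f' z / f z - 1) * exp c2" if "Re z = 0" "norm z \<ge> 1" for z
      proof -
        have "norm z = \<bar>Im z\<bar>" using that by (simp add: cmod_eq_Im)
        moreover have "Im z \<noteq> 0" using that calculation by auto
        ultimately show ?thesis using E_le[of z] by simp
      qed
      then show "\<forall>\<^sub>F z in imag_infinity. norm (E z) \<le> norm (f' z / f z - 1) * exp c2"
        unfolding eventually_imag_infinity by blast
    qed
    show "norm (E z) \<le> K * exp (K * sqrt (norm z))" if z: "norm z \<ge> 4" for z
    proof -
      have "norm (E z) \<le> C' * (2 * norm z)\<^sup>2 * exp (40 * (c2 + 2))"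
      proof (rule holomorphic_bound_off_real_axis[OF E(1)])
        fix w assume w: "Im w \<noteq> 0" "norm z / 4 \<le> norm w" "norm w \<le> 2 * norm z"
        \<comment> \<open>The quotient \<open>f' / f\<close> is controlled by the product of the two
          assumed bounds, at the cost of \<open>t\<^sup>2\<close>. By \<open>t \<le> exp t\<close>
          this moves into the exponent and turns \<open>c2\<close> into
          \<open>c2 + 2\<close>.\<close>
        define t where "t = norm w / \<bar>Im w\<bar>"
        have w1: "norm w \<ge> 1" using w z by simp
        have "C * (1 + (norm w)\<^sup>2) / \<bar>Im w\<bar> \<le> \<bar>C\<bar> * (1 + (norm w)\<^sup>2) / \<bar>Im w\<bar>"
          by (intro divide_right_mono mult_right_mono) auto
        also have "\<dots> \<le> \<bar>C\<bar> * (2 * (norm w)\<^sup>2) / \<bar>Im w\<bar>"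
          using w1 by (intro divide_right_mono mult_left_mono) (auto simp: one_le_power)
        also have "\<dots> = 2 * \<bar>C\<bar> * norm w * t" by (simp add: t_def power2_eq_square)
        finally have q: "C * (1 + (norm w)\<^sup>2) / \<bar>Im w\<bar> \<le> 2 * \<bar>C\<bar> * norm w * t" .
        have t: "t \<ge> 1" unfolding t_def using w abs_Im_le_cmod[of w] by (simp add: field_simps)
        have tt: "0 \<le> 2 * \<bar>C\<bar> * norm w * t" using t by simp
        have gw: "norm (g w) \<le> 2 * \<bar>C\<bar> * norm w * t * norm (f w)"
          by (rule order_trans[OF g_le[OF w(1)] mult_right_mono[OF q]]) simp
        have "norm (f' w) \<le> 2 * \<bar>C\<bar> * norm w * t * norm (g w)"
          by (rule order_trans[OF f'_le[OF w(1)] mult_right_mono[OF q]]) simp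
        also have "\<dots> \<le> 2 * \<bar>C\<bar> * norm w * t * (2 * \<bar>C\<bar> * norm w * t * norm (f w))"
          by (rule mult_left_mono[OF gw tt])
        finally have "norm (f' w / f w) \<le> (2 * \<bar>C\<bar>)\<^sup>2 * (norm w)\<^sup>2 * t\<^sup>2"
          using fnz[OF w(1)] by (simp add: norm_divide field_simps power2_eq_square)
        then have "norm (f' w / f w) \<le> (2 * C)\<^sup>2 * (norm w)\<^sup>2 * t\<^sup>2"
          by (simp add: power_mult_distrib)
        then have "norm (f' w / f w - 1) \<le> (2 * C)\<^sup>2 * (norm w)\<^sup>2 * t\<^sup>2 + 1"
          using norm_triangle_ineq4[of "f' w / f w" 1] by simp
        also have "1 \<le> 1 * (norm w)\<^sup>2 * t\<^sup>2"
          using mult_mono[of 1 "(norm w)\<^sup>2" 1 "t\<^sup>2"] w1 t by (simp add: one_le_power)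
        also have "(2 * C)\<^sup>2 * (norm w)\<^sup>2 * t\<^sup>2 + 1 * (norm w)\<^sup>2 * t\<^sup>2 = C' * (norm w)\<^sup>2 * t\<^sup>2"
          by (simp add: C'_def algebra_simps)
        also have "\<dots> \<le> C' * (2 * norm z)\<^sup>2 * (exp t)\<^sup>2"
          using C' w t order_trans[OF _ exp_ge_add_one_self[of t], of t] by (intro mult_mono power_mono) auto
        finally have "norm (f' w / f w - 1) \<le> C' * (2 * norm z)\<^sup>2 * (exp t)\<^sup>2" by simp
        then have "norm (E w) \<le> C' * (2 * norm z)\<^sup>2 * (exp t)\<^sup>2 * exp (c2 * norm w / \<bar>Im w\<bar>)"
          using order_trans[OF E_le[OF w(1)] mult_right_mono] by simp
        also have "\<dots> = C' * (2 * norm z)\<^sup>2 * exp ((c2 + 2) * norm w / \<bar>Im w\<bar>)"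
          by (simp add: t_def power2_eq_square add_divide_distrib algebra_simps flip: exp_add)
        finally show "norm (E w) \<le> C' * (2 * norm z)\<^sup>2 * exp ((c2 + 2) * norm w / \<bar>Im w\<bar>)" .
      qed (use c2 C' z in auto)
      also have "\<dots> \<le> 24 * 16 * (C' * exp (40 * (c2 + 2))) * ((norm z)\<^sup>2 / 24)"
        using C' by (simp add: power_mult_distrib)
      also have "\<dots> \<le> K * exp (K * sqrt (norm z))"
      proof (rule mult_mono)
        have "(norm z)\<^sup>2 = (sqrt (norm z)) ^ 4"
          by (simp add: power4_eq_xxxx power2_eq_square mult.assoc)
        also have "\<dots> \<le> (exp (sqrt (norm z))) ^ 4"
          using exp_ge_add_one_self[of "sqrt (norm z)"] by (intro power_mono) (auto simp del: exp_ge_add_one_self)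
        also have "\<dots> = exp (4 * sqrt (norm z))" by (simp flip: exp_of_nat_mult)
        also have "\<dots> \<le> exp (K * sqrt (norm z))" by (auto simp: K_def intro!: mult_right_mono)
        finally have "(norm z)\<^sup>2 \<le> exp (K * sqrt (norm z))" .
        moreover have "(norm z)\<^sup>2 \<ge> 0" by simp
        ultimately show "(norm z)\<^sup>2 / 24 \<le> exp (K * sqrt (norm z))" by linarith
      qed (use C' in \<open>auto simp: K_def\<close>)
      finally show ?thesis .
    qed
  qed
  \<comment> \<open>The lower estimate survives the limit because \<open>c1\<close> is the same for
    all \<open>N\<close>; so \<open>D\<close> cannot hide behind a vanishing limit of the
    \<open>H N\<close>.\<close>
  have "D z = 0" if "Im z \<noteq> 0" for z
  proof -
    have "G z = 0" using E E0 by simp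
    then have "(\<lambda>n. norm (H (s n) z) * exp (c1 * norm z / \<bar>Im z\<bar>)) \<longlonglongrightarrow> norm (0::complex) * exp (c1 * norm z / \<bar>Im z\<bar>)"
      using Glim[of z] by (intro tendsto_intros) simp
    then have "norm (D z) \<le> norm (0::complex) * exp (c1 * norm z / \<bar>Im z\<bar>)"
      by (rule tendsto_lowerbound) (use D_le[OF that] in auto)
    then show ?thesis by simp
  qed
  then have "D z = 0" by (rule entire_eq_zero_of_nonreal[OF D])
  then show ?thesis by (simp add: D_def)
qed

subsection \<open>Absolutely continuous functions\<close>

text \<open>Continuity of \<open>K\<close> sends the difference quotients of \<open>F\<close> to
  \<open>0\<close> at every point. It serves the product rule, where the derivatives involved exist
  only almost everywhere.\<close>

lemma constant_on_interval_of_local_bound: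
  fixes F :: "real \<Rightarrow> complex" and K :: "real \<Rightarrow> real"
  assumes K: "continuous_on {a..b} K"
    and bound: "\<And>s t. a \<le> s \<Longrightarrow> s < t \<Longrightarrow> t \<le> b \<Longrightarrow> norm (F t - F s) \<le> (t - s) * \<bar>K t - K s\<bar>"
    and x: "x \<in> {a..b}"
  shows "F x = F a"
proof -
  have "(F has_vector_derivative 0) (at s within {a..b})" if s: "s \<in> {a..b}" for s
    unfolding has_vector_derivative_def has_derivative_within
  proof (intro conjI)
    have "((\<lambda>t. \<bar>K t - K s\<bar>) \<longlongrightarrow> \<bar>K s - K s\<bar>) (at s within {a..b})"
      using K s by (intro tendsto_intros) (auto simp: continuous_on_def)
    then have "((\<lambda>t. \<bar>K t - K s\<bar>) \<longlongrightarrow> 0) (at s within {a..b})" by simp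
    then show "((\<lambda>y. (1 / norm (y - s)) *\<^sub>R (F y - (F s + (y - s) *\<^sub>R 0))) \<longlongrightarrow> 0) (at s within {a..b})"
    proof (rule Lim_null_comparison[rotated])
      have "norm ((1 / norm (y - s)) *\<^sub>R (F y - (F s + (y - s) *\<^sub>R 0))) \<le> \<bar>K y - K s\<bar>"
        if y: "y \<in> {a..b}" "y \<noteq> s" for y
      proof -
        have "norm (F y - F s) \<le> \<bar>y - s\<bar> * \<bar>K y - K s\<bar>"
          using bound[of s y] bound[of y s] s y
          by (cases "s < y") (auto simp: norm_minus_commute abs_minus_commute)
        moreover have "norm ((1 / norm (y - s)) *\<^sub>R (F y - (F s + (y - s) *\<^sub>R 0))) = norm (F y - F s) / \<bar>y - s\<bar>"
          by (simp only: norm_scaleR scaleR_zero_right add_0_right real_norm_def) simp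
        ultimately show ?thesis using y by (simp add: divide_le_eq mult.commute)
      qed
      then show "\<forall>\<^sub>F y in at s within {a..b}.
        norm ((1 / norm (y - s)) *\<^sub>R (F y - (F s + (y - s) *\<^sub>R 0))) \<le> \<bar>K y - K s\<bar>"
        by (auto simp: eventually_at_filter)
    qed
  qed simp
  then obtain c where "\<And>s. s \<in> {a..b} \<Longrightarrow> F s = c"
    using has_vector_derivative_zero_constant[of "{a..b}" F] by auto
  then show ?thesis using x by fastforce
qed

lemma ac_deriv_absint: "ac_deriv f g \<Longrightarrow> g absolutely_integrable_on {0..pi}"
  by (simp add: ac_deriv_def)

lemma ac_deriv_eq: "ac_deriv f g \<Longrightarrow> 0 \<le> x \<Longrightarrow> x \<le> pi \<Longrightarrow> f x = f 0 + integral {0..x} g"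
  unfolding ac_deriv_def by (metis atLeastAtMost_iff)

lemma absint_integrable_on_sub:
  fixes g :: "real \<Rightarrow> 'a::euclidean_space"
  assumes "g absolutely_integrable_on {0..pi}" "0 \<le> s" "t \<le> pi"
  shows "g integrable_on {s..t}" "(\<lambda>x. norm (g x)) integrable_on {s..t}"
proof -
  have "g absolutely_integrable_on {s..t}"
    by (rule absolutely_integrable_on_subinterval[OF assms(1)]) (use assms in auto)
  then show "g integrable_on {s..t}" "(\<lambda>x. norm (g x)) integrable_on {s..t}"
    by (auto simp: absolutely_integrable_on_def)
qed

lemma ac_deriv_diff:
  assumes "ac_deriv f g" "0 \<le> s" "s \<le> t" "t \<le> pi"
  shows "f t - f s = integral {s..t} g"
proof -
  have "integral {0..s} g + integral {s..t} g = integral {0..t} g"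
    using absint_integrable_on_sub[OF ac_deriv_absint[OF assms(1)]] assms
    by (intro Henstock_Kurzweil_Integration.integral_combine) auto
  then show ?thesis
    using ac_deriv_eq[OF assms(1), of s] ac_deriv_eq[OF assms(1), of t] assms by (simp add: algebra_simps)
qed

lemma ac_deriv_continuous:
  assumes "ac_deriv f g" shows "continuous_on {0..pi} f"
proof -
  have "continuous_on {0..pi} (\<lambda>x. f 0 + integral {0..x} g)"
    by (intro continuous_intros indefinite_integral_continuous_1)
      (use absint_integrable_on_sub[OF ac_deriv_absint[OF assms]] in auto)
  then show ?thesis
    by (rule continuous_on_eq) (simp add: ac_deriv_eq[OF assms, symmetric])
qed

lemma ac_derivI:
  assumes "g absolutely_integrable_on {0..pi}" "\<And>x. 0 \<le> x \<Longrightarrow> x \<le> pi \<Longrightarrow> f x = c + integral {0..x} g"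
  shows "ac_deriv f g"
  using assms(2)[of 0] assms by (auto simp: ac_deriv_def)

lemma ac_deriv_cong:
  assumes "ac_deriv f g" "\<And>x. 0 \<le> x \<Longrightarrow> x \<le> pi \<Longrightarrow> f x = f' x" "\<And>x. 0 \<le> x \<Longrightarrow> x \<le> pi \<Longrightarrow> g x = g' x"
  shows "ac_deriv f' g'"
proof (rule ac_derivI)
  show "g' absolutely_integrable_on {0..pi}"
    by (rule absolutely_integrable_spike[OF ac_deriv_absint[OF assms(1)] negligible_empty]) (use assms(3) in auto)
  fix x :: real assume x: "0 \<le> x" "x \<le> pi"
  have "integral {0..x} g = integral {0..x} g'"
    by (rule integral_cong) (use assms(3) x in auto)
  then show "f' x = f 0 + integral {0..x} g'"
    using ac_deriv_eq[OF assms(1) x] assms(2)[OF x] by simp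
qed

lemma ac_deriv_add:
  assumes "ac_deriv f g" "ac_deriv f' g'"
  shows "ac_deriv (\<lambda>x. f x + f' x) (\<lambda>x. g x + g' x)"
proof (rule ac_derivI)
  fix x assume x: "0 \<le> x" "x \<le> pi"
  have "integral {0..x} (\<lambda>x. g x + g' x) = integral {0..x} g + integral {0..x} g'"
    by (rule integral_add) (use absint_integrable_on_sub(1) assms[THEN ac_deriv_absint] x in auto)
  then show "f x + f' x = (f 0 + f' 0) + integral {0..x} (\<lambda>x. g x + g' x)"
    using assms[THEN ac_deriv_eq, OF x] by simp
qed (use assms[THEN ac_deriv_absint] in auto)

lemma ac_deriv_cmult:
  assumes "ac_deriv f g"
  shows "ac_deriv (\<lambda>x. c * f x) (\<lambda>x. c * g x)"
proof (rule ac_derivI)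
  fix x assume x: "0 \<le> x" "x \<le> pi"
  show "c * f x = c * f 0 + integral {0..x} (\<lambda>x. c * g x)"
    using ac_deriv_eq[OF assms x] by (simp add: algebra_simps)
next
  show "(\<lambda>x. c * g x) absolutely_integrable_on {0..pi}"
    using absolutely_integrable_linear[OF ac_deriv_absint[OF assms] bounded_linear_mult_right]
    by (simp add: o_def)
qed

lemma ac_deriv_lincomb:
  assumes "ac_deriv f g" "ac_deriv f' g'"
  shows "ac_deriv (\<lambda>x. c * f x + c' * f' x) (\<lambda>x. c * g x + c' * g' x)"
  by (intro ac_deriv_add ac_deriv_cmult assms)

lemma absint_mult_continuous:
  fixes g h :: "real \<Rightarrow> 'a::{real_normed_field, euclidean_space}"
  assumes "g absolutely_integrable_on {a..b}" "continuous_on {a..b} h"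
  shows "(\<lambda>x. g x * h x) absolutely_integrable_on {a..b}"
proof -
  have "(\<lambda>x. h x * g x) absolutely_integrable_on {a..b}"
  proof (rule absolutely_integrable_bounded_measurable_product[where h = "(*)"])
    show "bilinear ((*) :: 'a \<Rightarrow> 'a \<Rightarrow> 'a)"
      by (simp add: bilinear_conv_bounded_bilinear bounded_bilinear_mult)
    show "bounded (h ` {a..b})"
      using assms(2) compact_continuous_image compact_imp_bounded by blast
    show "h \<in> borel_measurable (lebesgue_on {a..b})"
      using assms(2) by (intro continuous_imp_measurable_on_sets_lebesgue) auto
  qed (use assms in auto)
  then show ?thesis by (simp add: mult.commute)
qed

lemma absint_continuous:
  fixes h :: "real \<Rightarrow> complex"
  shows "continuous_on {a..b} h \<Longrightarrow> h absolutely_integrable_on {a..b}"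
  using absolutely_integrable_continuous[of a b h] by simp

lemma potential_iff: "potential q \<longleftrightarrow> q absolutely_integrable_on {0..pi}"
proof -
  have "potential q \<longleftrightarrow> q absolutely_integrable_on {0<..<pi}"
    by (simp add: potential_def integrable_restrict_space set_integrable_def)
  also have "\<dots> \<longleftrightarrow> q absolutely_integrable_on {0..pi}"
  proof (rule absolutely_integrable_spike_set_eq)
    show "negligible {x \<in> {0<..<pi} - {0..pi}. q x \<noteq> 0}" by (rule negligible_subset[of "{}"]) auto
    show "negligible {x \<in> {0..pi} - {0<..<pi}. q x \<noteq> 0}"
      by (rule negligible_subset[of "{0,pi}"]) auto
  qed
  finally show ?thesis .
qed

lemma potential_absint:
  assumes "potential q"
  shows "(\<lambda>x. complex_of_real (q x)) absolutely_integrable_on {0..pi}"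
  using absolutely_integrable_linear[OF assms[unfolded potential_iff] bounded_linear_of_real]
  by (simp add: o_def)

lemma norm_integral_sub_le:
  fixes g :: "real \<Rightarrow> complex"
  assumes g: "g absolutely_integrable_on {0..pi}" and "0 \<le> s" "s \<le> t" "t \<le> pi"
    and le: "\<And>x. x \<in> {s..t} \<Longrightarrow> norm (h x) \<le> C * norm (g x)" and h: "h integrable_on {s..t}"
  shows "norm (integral {s..t} h :: complex) \<le> C * integral {s..t} (\<lambda>x. norm (g x))"
proof -
  have "(\<lambda>x. C * norm (g x)) integrable_on {s..t}"
    by (rule integrable_on_mult_right) (rule absint_integrable_on_sub(2)[OF g assms(2,4)])
  then have "norm (integral {s..t} h) \<le> integral {s..t} (\<lambda>x. C * norm (g x))"
    using le by (rule integral_norm_bound_integral[OF h])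
  then show ?thesis by simp
qed

text \<open>
  The increment over \<open>[s, t]\<close> of the difference of both sides is at most \<open>t - s\<close> times the increment of a
  continuous function, so this difference has derivative \<open>0\<close> everywhere, not only almost everywhere.
\<close>

lemma ac_deriv_mult:
  assumes f: "ac_deriv f g" and h: "ac_deriv h h'" and h': "continuous_on {0..pi} h'"
  shows "ac_deriv (\<lambda>x. f x * h x) (\<lambda>x. g x * h x + f x * h' x)"
proof -
  note cf = ac_deriv_continuous[OF f] and ch = ac_deriv_continuous[OF h]
  have i1: "(\<lambda>x. g x * h x) absolutely_integrable_on {0..pi}"
    by (rule absint_mult_continuous[OF ac_deriv_absint[OF f] ch])
  have i2: "(\<lambda>x. f x * h' x) absolutely_integrable_on {0..pi}"
    by (intro absint_continuous continuous_intros cf h')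
  have i3: "(\<lambda>x. g x * h x + f x * h' x) absolutely_integrable_on {0..pi}"
    using i1 i2 by auto
  define F where "F = (\<lambda>x. f x * h x - integral {0..x} (\<lambda>x. g x * h x + f x * h' x))"
  define K where "K = (\<lambda>x. integral {0..x} (\<lambda>x. norm (g x)))"
  have gn: "(\<lambda>x. norm (g x)) integrable_on {s..t}" if "0 \<le> s" "t \<le> pi" for s t
    using absint_integrable_on_sub(2)[OF ac_deriv_absint[OF f]] that .
  have Kdiff: "K t - K s = integral {s..t} (\<lambda>x. norm (g x))" if "0 \<le> s" "s \<le> t" "t \<le> pi" for s t
    using Henstock_Kurzweil_Integration.integral_combine[OF that(1,2) gn] that by (auto simp: K_def)
  have Knn: "0 \<le> K t - K s" if "0 \<le> s" "s \<le> t" "t \<le> pi" for s t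
    using Kdiff[OF that] gn[OF that(1,3)] by (simp add: integral_nonneg)
  obtain M where M: "M \<ge> 0" "\<And>x. x \<in> {0..pi} \<Longrightarrow> norm (h' x) \<le> M"
    by (rule norm_bounded_on_compact[OF compact_Icc h']) blast
  have "F x = F 0" if "x \<in> {0..pi}" for x
  proof (rule constant_on_interval_of_local_bound[of 0 pi "\<lambda>x. 2 * M * K x" F, OF _ _ that])
    show "continuous_on {0..pi} (\<lambda>x. 2 * M * K x)" unfolding K_def
      by (intro continuous_intros indefinite_integral_continuous_1 gn) auto
    fix s t :: real assume st: "0 \<le> s" "s < t" "t \<le> pi"
    have fst: "norm (f t - f r) \<le> K t - K s" if "r \<in> {s..t}" for r
    proof -
      have "norm (integral {r..t} g) \<le> 1 * integral {r..t} (\<lambda>x. norm (g x))"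
        by (rule norm_integral_sub_le[OF ac_deriv_absint[OF f]])
          (use that st absint_integrable_on_sub(1)[OF ac_deriv_absint[OF f], of r t] in auto)
      then have "norm (f t - f r) \<le> 1 * integral {r..t} (\<lambda>x. norm (g x))"
        using ac_deriv_diff[OF f, of r t] that st by simp
      also have "\<dots> = K t - K r" using Kdiff that st by simp
      also have "\<dots> \<le> K t - K s" using Knn[of s r] that st by simp
      finally show ?thesis .
    qed
    have hst: "norm (h s - h r) \<le> M * (t - s)" if "r \<in> {s..t}" for r
    proof -
      have "norm (h r - h s) \<le> integral {s..r} (\<lambda>_. M)"
        unfolding ac_deriv_diff[OF h st(1), of r, OF atLeastAtMost_iff[THEN iffD1, OF that, THEN conjunct1] order_trans[OF atLeastAtMost_iff[THEN iffD1, OF that, THEN conjunct2] st(3)]]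
        by (rule integral_norm_bound_integral)
          (use M that st absint_integrable_on_sub(1)[OF ac_deriv_absint[OF h], of s r] in auto)
      also have "\<dots> = M * (r - s)" using that by simp
      also have "\<dots> \<le> M * (t - s)" using that M by (intro mult_left_mono) auto
      finally show ?thesis by (simp add: norm_minus_commute)
    qed
    have sub: "{s..t} \<subseteq> {0..pi}" using st by auto
    have j1: "(\<lambda>r. (f t - f r) * h' r) integrable_on {s..t}"
      by (intro integrable_continuous_real continuous_intros continuous_on_subset[OF cf sub] continuous_on_subset[OF h' sub])
    have j2: "(\<lambda>r. g r * (h s - h r)) absolutely_integrable_on {0..pi}"
      by (intro absint_mult_continuous[OF ac_deriv_absint[OF f]] continuous_intros ch)
    \<comment> \<open>The increment is split as \<open>f t * h t - f s * h s = f t * (h t - h s) +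
      (f t - f s) * h s\<close>. Subtracting the integrals of \<open>f h'\<close> and
      \<open>g h\<close> leaves remainders in which a small increment of \<open>f\<close> or
      \<open>h\<close> stands under the integral.\<close>
    have I1: "integral {s..t} (\<lambda>r. (f t - f r) * h' r) = f t * (h t - h s) - integral {s..t} (\<lambda>r. f r * h' r)"
    proof -
      have "integral {s..t} (\<lambda>r. (f t - f r) * h' r) = integral {s..t} (\<lambda>r. f t * h' r - f r * h' r)"
        by (simp add: algebra_simps)
      also have "\<dots> = integral {s..t} (\<lambda>r. f t * h' r) - integral {s..t} (\<lambda>r. f r * h' r)"
        by (intro Henstock_Kurzweil_Integration.integral_diff integrable_continuous_real continuous_intros continuous_on_subset[OF cf sub] continuous_on_subset[OF h' sub])
      finally show ?thesis using ac_deriv_diff[OF h, of s t] st by simp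
    qed
    have I2: "integral {s..t} (\<lambda>r. g r * (h s - h r)) = (f t - f s) * h s - integral {s..t} (\<lambda>r. g r * h r)"
    proof -
      have "integral {s..t} (\<lambda>r. g r * (h s - h r)) = integral {s..t} (\<lambda>r. g r * h s - g r * h r)"
        by (simp add: algebra_simps)
      also have "\<dots> = integral {s..t} (\<lambda>r. g r * h s) - integral {s..t} (\<lambda>r. g r * h r)"
        using absint_integrable_on_sub(1)[OF i1, of s t] absint_integrable_on_sub(1)[OF ac_deriv_absint[OF f], of s t] st
        by (intro Henstock_Kurzweil_Integration.integral_diff integrable_on_mult_left) auto
      finally show ?thesis using ac_deriv_diff[OF f, of s t] st by simp
    qed
    have "integral {0..t} (\<lambda>x. g x * h x + f x * h' x) - integral {0..s} (\<lambda>x. g x * h x + f x * h' x)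
        = integral {s..t} (\<lambda>x. g x * h x + f x * h' x)"
      using Henstock_Kurzweil_Integration.integral_combine[of 0 s t "\<lambda>x. g x * h x + f x * h' x"] absint_integrable_on_sub(1)[OF i3, of 0 t] st
      by (simp add: algebra_simps)
    also have "\<dots> = integral {s..t} (\<lambda>r. g r * h r) + integral {s..t} (\<lambda>r. f r * h' r)"
      using absint_integrable_on_sub(1)[OF i1, of s t] absint_integrable_on_sub(1)[OF i2, of s t] st
      by (intro integral_add) auto
    finally have "F t - F s = integral {s..t} (\<lambda>r. (f t - f r) * h' r) + integral {s..t} (\<lambda>r. g r * (h s - h r))"
      unfolding I1 I2 F_def by (simp add: algebra_simps)
    also have "norm \<dots> \<le> (K t - K s) * M * (t - s) + M * (t - s) * (K t - K s)"
    proof (rule norm_triangle_mono)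
      have "norm (integral {s..t} (\<lambda>r. (f t - f r) * h' r)) \<le> integral {s..t} (\<lambda>r. (K t - K s) * M)"
        using fst M sub Knn[of s t] st
        by (intro integral_norm_bound_integral[OF j1]) (auto simp: norm_mult intro!: mult_mono)
      then show "norm (integral {s..t} (\<lambda>r. (f t - f r) * h' r)) \<le> (K t - K s) * M * (t - s)"
        using st by (simp add: mult_ac)
      have "norm (g r * (h s - h r)) \<le> M * (t - s) * norm (g r)" if "r \<in> {s..t}" for r
        using mult_left_mono[OF hst[OF that], of "norm (g r)"] by (simp add: norm_mult mult.commute)
      then have "norm (integral {s..t} (\<lambda>r. g r * (h s - h r))) \<le> M * (t - s) * integral {s..t} (\<lambda>x. norm (g x))"
        using absint_integrable_on_sub(1)[OF j2, of s t] st
        by (intro norm_integral_sub_le[OF ac_deriv_absint[OF f]]) auto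
      then show "norm (integral {s..t} (\<lambda>r. g r * (h s - h r))) \<le> M * (t - s) * (K t - K s)"
        using Kdiff[of s t] st by simp
    qed
    also have "\<dots> = (t - s) * \<bar>2 * M * K t - 2 * M * K s\<bar>"
    proof -
      have "2 * M * K t - 2 * M * K s = 2 * M * (K t - K s)" by (simp add: algebra_simps)
      then have "\<bar>2 * M * K t - 2 * M * K s\<bar> = 2 * M * (K t - K s)"
        using Knn[of s t] M(1) st by simp
      then show ?thesis by (simp add: algebra_simps)
    qed
    finally show "norm (F t - F s) \<le> (t - s) * \<bar>2 * M * K t - 2 * M * K s\<bar>" .
  qed
  note F_const = this
  have "f x * h x = f 0 * h 0 + integral {0..x} (\<lambda>x. g x * h x + f x * h' x)"
    if "0 \<le> x" "x \<le> pi" for x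
  proof -
    have "F x = F 0" by (rule F_const) (use that in simp)
    then show ?thesis unfolding F_def by (simp add: diff_eq_eq)
  qed
  with i3 show ?thesis by (rule ac_derivI)
qed

subsection \<open>Sturm--Liouville equations with integrable potential\<close>

text \<open>First-order form of \<open>- u'' + q u - z u = f\<close>. The derivative of
  \<open>v\<close> is one fixed integrand rather than some function equal to it almost everywhere;
  \<open>solves_iff_sl_expr\<close> gives the translation.\<close>

definition solves ::
    "(real \<Rightarrow> real) \<Rightarrow> complex \<Rightarrow> (real \<Rightarrow> complex) \<Rightarrow> (real \<Rightarrow> complex) \<Rightarrow> (real \<Rightarrow> complex) \<Rightarrow> bool" where
  "solves q z f u v \<longleftrightarrow> ac_deriv u v \<and> ac_deriv v (\<lambda>x. (of_real (q x) - z) * u x - f x)"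

text \<open>
  The weight \<open>exp (- \<kappa> x)\<close> makes Volterra operators with a merely integrable kernel \<open>k\<close> contractions:
  in \<open>k \<le> n + max (k - n) 0\<close> the last term is small in \<open>L\<^sup>1\<close>, and the constant is handled by a large \<open>\<kappa>\<close>.
\<close>

lemma exponential_weight:
  fixes k :: "real \<Rightarrow> real"
  assumes k: "k absolutely_integrable_on {0..pi}" "\<And>x. 0 \<le> k x"
  obtains \<kappa> where "\<kappa> > 0"
    "\<And>x. 0 \<le> x \<Longrightarrow> x \<le> pi \<Longrightarrow> integral {0..x} (\<lambda>t. exp (- \<kappa> * (x - t)) * k t) \<le> 1 / 2"
proof -
  define g where "g = (\<lambda>n::nat. \<lambda>x. max (k x - of_nat n) 0)"
  have g_alt: "g n x = (\<bar>k x - of_nat n\<bar> + (k x - of_nat n)) / 2" for n x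
    by (simp add: g_def abs_if max_def)
  have c: "(\<lambda>x. k x - of_nat n) absolutely_integrable_on {0..pi}" for n :: nat
    using k(1) by (intro set_integral_diff(1)) auto
  have gi: "g n absolutely_integrable_on {0..pi}" for n
  proof -
    have "(\<lambda>x. norm (k x - of_nat n)) absolutely_integrable_on {0..pi}"
      using absolutely_integrable_norm[OF c[of n]] by (simp add: o_def)
    then have "(\<lambda>x. (norm (k x - of_nat n) + (k x - of_nat n))) absolutely_integrable_on {0..pi}"
      using c[of n] by (intro set_integral_add(1)) auto
    then have "(\<lambda>x. (norm (k x - of_nat n) + (k x - of_nat n)) / 2) absolutely_integrable_on {0..pi}"
      by (intro set_integrable_divide) auto
    then show ?thesis by (simp add: g_alt[abs_def])
  qed
  have "(\<lambda>n. integral {0..pi} (g n)) \<longlonglongrightarrow> integral {0..pi} (\<lambda>x. 0)"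
  proof (rule dominated_convergence(2))
    show "g n integrable_on {0..pi}" for n using gi[of n] by (simp add: absolutely_integrable_on_def)
    show "k integrable_on {0..pi}" using k by (simp add: absolutely_integrable_on_def)
    show "norm (g n x) \<le> k x" for n x using k(2)[of x] by (simp add: g_def)
    show "(\<lambda>n. g n x) \<longlonglongrightarrow> 0" for x
    proof (rule tendsto_eventually)
      obtain N :: nat where N: "k x \<le> of_nat N" using real_arch_simple by blast
      show "\<forall>\<^sub>F n in sequentially. g n x = 0"
        using eventually_ge_at_top[of N] by eventually_elim (use N in \<open>auto simp: g_def max_def\<close>)
    qed
  qed
  then have "(\<lambda>n. integral {0..pi} (g n)) \<longlonglongrightarrow> 0" by simp
  then have "\<forall>\<^sub>F n in sequentially. integral {0..pi} (g n) < 1/4" by (rule order_tendstoD) simp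
  then obtain n where n: "integral {0..pi} (g n) < 1/4"
    by (auto simp: eventually_sequentially)
  \<comment> \<open>The bounded part contributes at most \<open>n / \<kappa> \<le> 1/4\<close>; the
    tail \<open>g n\<close> contributes the other quarter.\<close>
  define \<kappa> where "\<kappa> = 4 * real n + 4"
  have \<kappa>: "\<kappa> > 0" by (simp add: \<kappa>_def)
  have "integral {0..x} (\<lambda>t. exp (- \<kappa> * (x - t)) * k t) \<le> 1 / 2" if x: "0 \<le> x" "x \<le> pi" for x
  proof -
    have sub: "{0..x} \<subseteq> {0..pi}" using x by auto
    have kx: "k absolutely_integrable_on {0..x}"
      by (rule absolutely_integrable_on_subinterval[OF k(1) sub])
    have gx: "g n absolutely_integrable_on {0..x}"
      by (rule absolutely_integrable_on_subinterval[OF gi sub])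
    have gint: "g n integrable_on {0..x}" using gx by (simp add: absolutely_integrable_on_def)
    have ki: "(\<lambda>t. exp (- \<kappa> * (x - t)) * k t) integrable_on {0..x}"
    proof -
      have "(\<lambda>t. k t * exp (- \<kappa> * (x - t))) absolutely_integrable_on {0..x}"
        by (rule absint_mult_continuous[OF kx]) (intro continuous_intros)
      then show ?thesis by (simp add: absolutely_integrable_on_def mult.commute)
    qed
    have "((\<lambda>t. exp (- \<kappa> * (x - t))) has_integral
        (exp (- \<kappa> * (x - x)) / \<kappa> - exp (- \<kappa> * (x - 0)) / \<kappa>)) {0..x}"
      by (rule fundamental_theorem_of_calculus)
        (use x \<kappa> in \<open>auto intro!: derivative_eq_intros simp flip: has_real_derivative_iff_has_vector_derivative\<close>)
    then have ei: "((\<lambda>t. exp (- \<kappa> * (x - t))) has_integral ((1 - exp (- \<kappa> * x)) / \<kappa>)) {0..x}"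
      by (simp add: diff_divide_distrib)
    then have ei': "((\<lambda>t. real n * exp (- \<kappa> * (x - t))) has_integral (real n * ((1 - exp (- \<kappa> * x)) / \<kappa>))) {0..x}"
      by (rule has_integral_mult_right)
    have "integral {0..x} (\<lambda>t. exp (- \<kappa> * (x - t)) * k t) \<le> integral {0..x} (\<lambda>t. real n * exp (- \<kappa> * (x - t)) + g n t)"
    proof (rule integral_le[OF ki integrable_add[OF has_integral_integrable[OF ei'] gint]])
      fix t assume t: "t \<in> {0..x}"
      have "exp (- \<kappa> * (x - t)) * k t \<le> exp (- \<kappa> * (x - t)) * (real n + g n t)"
        by (intro mult_left_mono) (auto simp: g_def)
      also have "\<dots> \<le> real n * exp (- \<kappa> * (x - t)) + 1 * g n t"
        using t \<kappa> by (auto simp: algebra_simps g_def intro!: mult_left_le)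
      finally show "exp (- \<kappa> * (x - t)) * k t \<le> real n * exp (- \<kappa> * (x - t)) + g n t" by simp
    qed
    also have "\<dots> = real n * ((1 - exp (- \<kappa> * x)) / \<kappa>) + integral {0..x} (g n)"
      unfolding integral_add[OF has_integral_integrable[OF ei'] gint] integral_unique[OF ei'] ..
    also have "real n * ((1 - exp (- \<kappa> * x)) / \<kappa>) \<le> 1/4"
    proof -
      have "real n * (1 - exp (- \<kappa> * x)) \<le> real n * 1" by (intro mult_left_mono) auto
      then show ?thesis using \<kappa> by (simp add: field_simps \<kappa>_def)
    qed
    also have "integral {0..x} (g n) \<le> integral {0..pi} (g n)"
      using gi[of n] gint sub by (intro integral_subset_le) (auto simp: absolutely_integrable_on_def g_def)
    finally show ?thesis using n by simp
  qed
  then show thesis using that \<kappa> by blast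
qed

lemma potential_norm_absint:
  assumes "potential q"
  shows "(\<lambda>x. \<bar>q x\<bar> + c) absolutely_integrable_on {0..pi}"
proof -
  have "(\<lambda>x. norm (complex_of_real (q x))) absolutely_integrable_on {0..pi}"
    using absolutely_integrable_norm[OF potential_absint[OF assms]] by (simp add: o_def)
  then show ?thesis by (intro set_integral_add(1)) auto
qed

lemma solves_rhs_absint:
  fixes u f :: "real \<Rightarrow> complex"
  assumes "potential q" "continuous_on {0..pi} u" "f absolutely_integrable_on {0..pi}"
  shows "(\<lambda>x. (of_real (q x) - z) * u x - f x) absolutely_integrable_on {0..pi}"
proof -
  have "(\<lambda>x. of_real (q x) - z) absolutely_integrable_on {0..pi}"
    by (rule set_integral_diff(1)[OF potential_absint[OF assms(1)] absint_continuous]) simp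
  then show ?thesis
    by (rule set_integral_diff(1)[OF absint_mult_continuous[OF _ assms(2)] assms(3)])
qed

section \<open>A priori bounds, existence and uniqueness for initial values at
  \<open>0\<close>\<close>

text \<open>Pulling out \<open>exp (\<kappa> * x)\<close> leaves precisely the integral that
  \<open>exponential_weight\<close> makes at most \<open>1/2\<close>.\<close>

lemma norm_integral_Volterra_le:
  fixes k :: "real \<Rightarrow> real" and h :: "real \<Rightarrow> complex"
  assumes k: "k absolutely_integrable_on {0..pi}" and x: "0 \<le> x" "x \<le> pi"
    and le: "\<And>t. 0 \<le> t \<Longrightarrow> t \<le> x \<Longrightarrow> norm (h t) \<le> S * (exp (\<kappa> * t) * k t)"
    and h: "h integrable_on {0..x}"
  shows "norm (integral {0..x} h) \<le> S * (exp (\<kappa> * x) * integral {0..x} (\<lambda>t. exp (- \<kappa> * (x - t)) * k t))"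
proof -
  have "k absolutely_integrable_on {0..x}"
    by (rule absolutely_integrable_on_subinterval[OF k]) (use x in auto)
  then have "(\<lambda>t. k t * exp (\<kappa> * t)) absolutely_integrable_on {0..x}"
    by (rule absint_mult_continuous) (intro continuous_intros)
  then have i: "(\<lambda>t. exp (\<kappa> * t) * k t) integrable_on {0..x}"
    by (simp add: absolutely_integrable_on_def mult.commute)
  have "norm (integral {0..x} h) \<le> integral {0..x} (\<lambda>t. S * (exp (\<kappa> * t) * k t))"
    by (rule integral_norm_bound_integral[OF h integrable_on_mult_right[OF i]]) (use le in auto)
  also have "\<dots> = S * integral {0..x} (\<lambda>t. exp (\<kappa> * t) * k t)" by simp
  also have "(\<lambda>t. exp (\<kappa> * t) * k t) = (\<lambda>t. exp (\<kappa> * x) * (exp (- \<kappa> * (x - t)) * k t))"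
    by (simp add: algebra_simps flip: exp_add mult.assoc)
  finally show ?thesis by simp
qed

text \<open>Gronwall's inequality for a merely integrable coefficient: with \<open>a\<close> the
  size of the data, the maximum \<open>S\<close> of
  \<open>exp (- \<kappa> x) (norm (u x) + norm (v x))\<close> satisfies
  \<open>S \<le> a + S / 2\<close>. Uniformity for \<open>norm z \<le> R\<close> is what
  differentiation in \<open>z\<close> relies on.\<close>

lemma solves_bound:
  assumes q: "potential q"
  obtains C where "C > 0"
    "\<And>z f u v x. norm z \<le> R \<Longrightarrow> f absolutely_integrable_on {0..pi} \<Longrightarrow> solves q z f u v \<Longrightarrow> 0 \<le> x \<Longrightarrow> x \<le> pi \<Longrightarrow>
      norm (u x) + norm (v x) \<le> C * (norm (u 0) + norm (v 0) + integral {0..pi} (\<lambda>t. norm (f t)))"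
proof -
  \<comment> \<open>One kernel dominates both equations of the system: \<open>1\<close> for
    \<open>u' = v\<close>, and \<open>norm (q - z)\<close> for \<open>v'\<close>.\<close>
  define k where "k = (\<lambda>x. \<bar>q x\<bar> + (1 + \<bar>R\<bar>))"
  have k: "k absolutely_integrable_on {0..pi}"
    unfolding k_def by (rule potential_norm_absint[OF q])
  have k_pos: "0 \<le> k x" for x by (simp add: k_def)
  obtain \<kappa> where \<kappa>: "\<kappa> > 0"
    "\<And>x. 0 \<le> x \<Longrightarrow> x \<le> pi \<Longrightarrow> integral {0..x} (\<lambda>t. exp (- \<kappa> * (x - t)) * k t) \<le> 1 / 2"
    by (rule exponential_weight[OF k k_pos]) blast
  have "norm (u x) + norm (v x) \<le> (2 * exp (\<kappa> * pi)) * (norm (u 0) + norm (v 0) + integral {0..pi} (\<lambda>t. norm (f t)))"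
    if z: "norm z \<le> R" and f: "f absolutely_integrable_on {0..pi}" and s: "solves q z f u v"
      and x: "0 \<le> x" "x \<le> pi" for z f u v x
  proof -
    have u: "ac_deriv u v" and v: "ac_deriv v (\<lambda>x. (of_real (q x) - z) * u x - f x)"
      using s by (auto simp: solves_def)
    note cu = ac_deriv_continuous[OF u] and cv = ac_deriv_continuous[OF v]
    define a where "a = norm (u 0) + norm (v 0) + integral {0..pi} (\<lambda>t. norm (f t))"
    define N where "N = (\<lambda>x. norm (u x) + norm (v x))"
    have "continuous_on {0..pi} (\<lambda>x. exp (- \<kappa> * x) * N x)"
      unfolding N_def by (intro continuous_intros cu cv)
    then obtain x0 where x0: "0 \<le> x0" "x0 \<le> pi"
      and max: "\<And>x. 0 \<le> x \<Longrightarrow> x \<le> pi \<Longrightarrow> exp (- \<kappa> * x) * N x \<le> exp (- \<kappa> * x0) * N x0"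
      using continuous_attains_sup[of "{0..pi}" "\<lambda>x. exp (- \<kappa> * x) * N x"] by auto
    define S where "S = exp (- \<kappa> * x0) * N x0"
    have N_le: "N t \<le> S * exp (\<kappa> * t)" if "0 \<le> t" "t \<le> pi" for t
      using max[OF that] by (simp add: S_def exp_minus field_simps)
    have S: "S \<ge> 0" by (simp add: S_def N_def)
    have N0: "N x0 \<le> a + S * (exp (\<kappa> * x0) * integral {0..x0} (\<lambda>t. exp (- \<kappa> * (x0 - t)) * k t))"
    proof -
      define h where "h = (\<lambda>t. norm (v t) + norm ((of_real (q t) - z) * u t))"
      have i1: "(\<lambda>t. (of_real (q t) - z) * u t) absolutely_integrable_on {0..pi}"
        using solves_rhs_absint[OF q cu, of "\<lambda>_. 0"] absint_continuous[of 0 pi "\<lambda>_. 0"] by simp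
      have iv: "v integrable_on {0..x0}" "(\<lambda>t. norm (v t)) integrable_on {0..x0}"
        using absint_integrable_on_sub[OF ac_deriv_absint[OF u], of 0 x0] x0 by auto
      have iq: "(\<lambda>t. (of_real (q t) - z) * u t) integrable_on {0..x0}" "(\<lambda>t. norm ((of_real (q t) - z) * u t)) integrable_on {0..x0}"
        using absint_integrable_on_sub[OF i1, of 0 x0] x0 by auto
      have fi: "f integrable_on {0..x0}" "(\<lambda>t. norm (f t)) integrable_on {0..x0}" "(\<lambda>t. norm (f t)) integrable_on {0..pi}"
        using absint_integrable_on_sub[OF f, of 0 x0] absint_integrable_on_sub[OF f, of 0 pi] x0 by auto
      have hi: "h integrable_on {0..x0}" unfolding h_def by (rule integrable_add[OF iv(2) iq(2)])
      have nu: "norm (u x0) \<le> norm (u 0) + integral {0..x0} (\<lambda>t. norm (v t))"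
        unfolding ac_deriv_eq[OF u x0]
        by (rule norm_triangle_mono[OF order_refl]) (rule integral_norm_bound_integral[OF iv]; simp)
      have vx0: "v x0 = v 0 + integral {0..x0} (\<lambda>t. (of_real (q t) - z) * u t) - integral {0..x0} f"
        using ac_deriv_eq[OF v x0] Henstock_Kurzweil_Integration.integral_diff[OF iq(1) fi(1)] by simp
      have "norm (integral {0..x0} (\<lambda>t. (of_real (q t) - z) * u t)) \<le> integral {0..x0} (\<lambda>t. norm ((of_real (q t) - z) * u t))"
        by (rule integral_norm_bound_integral[OF iq]) simp
      moreover have "norm (integral {0..x0} f) \<le> integral {0..x0} (\<lambda>t. norm (f t))"
        by (rule integral_norm_bound_integral[OF fi(1,2)]) simp
      moreover have "integral {0..x0} (\<lambda>t. norm (f t)) \<le> integral {0..pi} (\<lambda>t. norm (f t))"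
        using x0 by (intro integral_subset_le fi) auto
      ultimately have nv: "norm (v x0) \<le> norm (v 0) + integral {0..x0} (\<lambda>t. norm ((of_real (q t) - z) * u t)) + integral {0..pi} (\<lambda>t. norm (f t))"
        unfolding vx0 using norm_triangle_ineq4[of "v 0 + integral {0..x0} (\<lambda>t. (of_real (q t) - z) * u t)" "integral {0..x0} f"]
          norm_triangle_ineq[of "v 0" "integral {0..x0} (\<lambda>t. (of_real (q t) - z) * u t)"] by linarith
      have "N x0 \<le> a + integral {0..x0} h"
        using nu nv integral_add[OF iv(2) iq(2)] by (simp add: N_def a_def h_def)
      also have "integral {0..x0} h \<le> norm (integral {0..x0} (\<lambda>t. complex_of_real (h t)))"
      proof -
        have "integral {0..x0} (\<lambda>t. complex_of_real (h t)) = of_real (integral {0..x0} h)"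
          using integral_linear[OF hi bounded_linear_of_real] by (simp add: o_def)
        then show ?thesis by simp
      qed
      also have "\<dots> \<le> S * (exp (\<kappa> * x0) * integral {0..x0} (\<lambda>t. exp (- \<kappa> * (x0 - t)) * k t))"
      proof (rule norm_integral_Volterra_le[OF k x0])
        show "(\<lambda>t. complex_of_real (h t)) integrable_on {0..x0}"
          using integrable_linear[OF hi bounded_linear_of_real] by (simp add: o_def)
        fix t assume t: "0 \<le> t" "t \<le> x0"
        have "norm (of_real (q t) - z) \<le> k t"
          using norm_triangle_ineq4[of "of_real (q t)" z] z by (simp add: k_def)
        then have "h t \<le> k t * norm (v t) + k t * norm (u t)"
          unfolding h_def norm_mult
          by (intro add_mono mult_right_mono) (auto simp: k_def intro!: mult_le_cancel_right1[THEN iffD2])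
        also have "\<dots> = k t * N t" by (simp add: N_def algebra_simps)
        also have "\<dots> \<le> k t * (S * exp (\<kappa> * t))"
          using N_le[of t] t x0 k_pos by (intro mult_left_mono) auto
        finally have "h t \<le> S * (exp (\<kappa> * t) * k t)" by (simp only: mult_ac)
        moreover have "h t \<ge> 0" by (simp add: h_def)
        ultimately show "norm (complex_of_real (h t)) \<le> S * (exp (\<kappa> * t) * k t)"
          by (simp only: norm_of_real abs_of_nonneg)
      qed
      finally show ?thesis by simp
    qed
    have "exp (- \<kappa> * x0) * N x0 \<le> exp (- \<kappa> * x0) * a + S * integral {0..x0} (\<lambda>t. exp (- \<kappa> * (x0 - t)) * k t)"
      using mult_left_mono[OF N0, of "exp (- \<kappa> * x0)"] by (simp add: exp_minus field_simps)
    moreover have "S * integral {0..x0} (\<lambda>t. exp (- \<kappa> * (x0 - t)) * k t) \<le> S * (1/2)"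
      by (rule mult_left_mono[OF \<kappa>(2)[OF x0] S])
    moreover have a: "a \<ge> 0" using absint_integrable_on_sub(2)[OF f, of 0 pi] by (simp add: a_def integral_nonneg)
    moreover have "exp (- \<kappa> * x0) * a \<le> 1 * a" using a \<kappa> x0 by (intro mult_right_mono) auto
    ultimately have "S \<le> 2 * a" unfolding S_def by linarith
    have "N x \<le> S * exp (\<kappa> * x)" using N_le x by simp
    also have "\<dots> \<le> 2 * a * exp (\<kappa> * pi)"
      using \<open>S \<le> 2 * a\<close> S a x \<kappa> by (intro mult_mono) auto
    also have "\<dots> = 2 * exp (\<kappa> * pi) * a" by simp
    finally show ?thesis unfolding N_def a_def .
  qed
  then show thesis using that[of "2 * exp (\<kappa> * pi)"] by simp
qed

text \<open>Picard iteration as a single contraction on all of \<open>[0, pi]\<close>: the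
  exponential weight replaces a subdivision into short intervals.\<close>

lemma solves_exists:
  assumes q: "potential q" and f: "f absolutely_integrable_on {0..pi}"
  obtains u v where "solves q z f u v" "u 0 = c" "v 0 = d"
proof -
  define k where "k = (\<lambda>x. \<bar>q x\<bar> + (1 + norm z))"
  have k: "k absolutely_integrable_on {0..pi}"
    unfolding k_def by (rule potential_norm_absint[OF q])
  have k_pos: "0 \<le> k x" for x by (simp add: k_def)
  \<comment> \<open>With the weight taken for \<open>4 * k\<close>, each of the two components
    contributes at most a quarter of the distance, which adds up to the contraction factor
    \<open>1/2\<close>.\<close>
  obtain \<kappa> where \<kappa>: "\<kappa> > 0"
    "\<And>x. 0 \<le> x \<Longrightarrow> x \<le> pi \<Longrightarrow> integral {0..x} (\<lambda>t. exp (- \<kappa> * (x - t)) * (4 * k t)) \<le> 1 / 2"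
    by (rule exponential_weight[of "\<lambda>t. 4 * k t"])
      (use k k_pos in \<open>auto intro!: set_integrable_mult_right\<close>)
  \<comment> \<open>The complete space used consists of bounded continuous functions on the whole
    line, so values are frozen outside \<open>[0, pi]\<close> by clamping the argument.\<close>
  define cl :: "real \<Rightarrow> real" where "cl = (\<lambda>x. max 0 (min pi x))"
  have cl: "0 \<le> cl x" "cl x \<le> pi" for x by (auto simp: cl_def)
  have cl_id: "cl x = x" if "0 \<le> x" "x \<le> pi" for x using that by (auto simp: cl_def)
  \<comment> \<open>The unknown \<open>Y\<close> stands for
    \<open>exp (- \<kappa> x) (u, v)\<close>, so the plain supremum metric already carries the
    weight.\<close>
  define A where "A = (\<lambda>(Y :: real \<Rightarrow>\<^sub>C (complex \<times> complex)) t. exp (of_real (\<kappa> * t)) * snd (Y t))"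
  define B where "B = (\<lambda>(Y :: real \<Rightarrow>\<^sub>C (complex \<times> complex)) t. (of_real (q t) - z) * (exp (of_real (\<kappa> * t)) * fst (Y t)) - f t)"
  define \<Phi> where "\<Phi> = (\<lambda>Y x. (exp (- of_real (\<kappa> * cl x)) * (c + integral {0..cl x} (A Y)),
    exp (- of_real (\<kappa> * cl x)) * (d + integral {0..cl x} (B Y))))"
  have cont: "continuous_on S (\<lambda>t. fst (apply_bcontfun Y t))" "continuous_on S (\<lambda>t. snd (apply_bcontfun Y t))" for S and Y :: "real \<Rightarrow>\<^sub>C (complex \<times> complex)"
    by (intro continuous_on_fst continuous_on_snd continuous_on_apply_bcontfun)+
  have Ai: "A Y absolutely_integrable_on {0..pi}" for Y
    unfolding A_def by (intro absint_continuous continuous_intros cont)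
  have Bi: "B Y absolutely_integrable_on {0..pi}" for Y
    unfolding B_def by (intro solves_rhs_absint q f continuous_intros cont)
  have \<Phi>_bcont: "\<Phi> Y \<in> bcontfun" for Y
  proof -
    have "continuous_on {0..pi} (\<lambda>x. integral {0..x} (A Y))" "continuous_on {0..pi} (\<lambda>x. integral {0..x} (B Y))"
      using Ai[of Y] Bi[of Y] by (auto intro!: indefinite_integral_continuous_1 simp: absolutely_integrable_on_def)
    moreover have ccl: "continuous_on UNIV cl" unfolding cl_def by (intro continuous_intros)
    ultimately have c: "continuous_on UNIV (\<lambda>x. integral {0..cl x} (A Y))" "continuous_on UNIV (\<lambda>x. integral {0..cl x} (B Y))"
      using cl by (auto intro: continuous_on_compose2[where t = "{0..pi}"])
    have cont\<Phi>: "continuous_on UNIV (\<Phi> Y)"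
      unfolding \<Phi>_def by (intro continuous_intros c ccl)
    have "\<Phi> Y ` UNIV = \<Phi> Y ` {0..pi}"
    proof -
      have "\<Phi> Y x = \<Phi> Y (cl x)" for x unfolding \<Phi>_def using cl_id cl by simp
      then show ?thesis using cl by (auto simp: image_iff) (metis atLeastAtMost_iff)
    qed
    moreover have "bounded (\<Phi> Y ` {0..pi})"
      using cont\<Phi> by (intro compact_imp_bounded compact_continuous_image) (auto intro: continuous_on_subset)
    ultimately show ?thesis using cont\<Phi> by (simp add: bcontfun_def)
  qed
  define T where "T = (\<lambda>Y. Bcontfun (\<Phi> Y))"
  have T: "apply_bcontfun (T Y) = \<Phi> Y" for Y
    unfolding T_def by (rule Bcontfun_inverse[OF \<Phi>_bcont])
  have "\<exists>!Y. T Y = Y"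
  proof (rule banach_fix_type[of "1/2"])
    show "\<forall>Y Y'. dist (T Y) (T Y') \<le> 1/2 * dist Y Y'"
    proof (intro allI dist_bound)
      fix Y Y' :: "real \<Rightarrow>\<^sub>C (complex \<times> complex)" and x' :: real
      define x where "x = cl x'"
      have x: "0 \<le> x" "x \<le> pi" using cl by (auto simp: x_def)
      define \<delta> where "\<delta> = dist Y Y'"
      have \<delta>: "\<delta> \<ge> 0" by (simp add: \<delta>_def)
      have fs: "norm (fst (Y t) - fst (Y' t)) \<le> \<delta>" "norm (snd (Y t) - snd (Y' t)) \<le> \<delta>" for t
        using dist_bounded[of Y t Y'] dist_fst_le[of "Y t" "Y' t"] dist_snd_le[of "Y t" "Y' t"]
        by (auto simp: \<delta>_def dist_norm)
      have AA: "integral {0..x} (A Y) - integral {0..x} (A Y') = integral {0..x} (\<lambda>t. A Y t - A Y' t)"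
        and Ad: "(\<lambda>t. A Y t - A Y' t) integrable_on {0..x}"
        using absint_integrable_on_sub(1)[OF Ai, of 0 x] x
        by (auto intro!: Henstock_Kurzweil_Integration.integral_diff[symmetric] integrable_diff)
      have BB: "integral {0..x} (B Y) - integral {0..x} (B Y') = integral {0..x} (\<lambda>t. B Y t - B Y' t)"
        and Bd: "(\<lambda>t. B Y t - B Y' t) integrable_on {0..x}"
        using absint_integrable_on_sub(1)[OF Bi, of 0 x] x
        by (auto intro!: Henstock_Kurzweil_Integration.integral_diff[symmetric] integrable_diff)
      have k4: "(\<lambda>t. 4 * k t) absolutely_integrable_on {0..pi}" using k by (intro set_integrable_mult_right) auto
      have nA: "norm (A Y t - A Y' t) \<le> \<delta> / 4 * (exp (\<kappa> * t) * (4 * k t))" for t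
      proof -
        have "A Y t - A Y' t = exp (of_real (\<kappa> * t)) * (snd (Y t) - snd (Y' t))"
          by (simp add: A_def algebra_simps)
        then have "norm (A Y t - A Y' t) = exp (\<kappa> * t) * norm (snd (Y t) - snd (Y' t))"
          by (simp only: norm_mult norm_exp_eq_Re Re_complex_of_real)
        also have "\<dots> \<le> exp (\<kappa> * t) * (\<delta> * k t)"
          using fs(2)[of t] \<delta> mult_mono[OF fs(2)[of t], of 1 "k t"] by (intro mult_left_mono) (auto simp: k_def)
        finally show ?thesis by (simp add: mult_ac)
      qed
      have nB: "norm (B Y t - B Y' t) \<le> \<delta> / 4 * (exp (\<kappa> * t) * (4 * k t))" for t
      proof -
        have "B Y t - B Y' t = (of_real (q t) - z) * (exp (of_real (\<kappa> * t)) * (fst (Y t) - fst (Y' t)))"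
          by (simp add: B_def algebra_simps)
        then have "norm (B Y t - B Y' t) = norm (of_real (q t) - z) * (exp (\<kappa> * t) * norm (fst (Y t) - fst (Y' t)))"
          by (simp only: norm_mult norm_exp_eq_Re Re_complex_of_real)
        also have "\<dots> \<le> k t * (exp (\<kappa> * t) * \<delta>)"
          using fs(1)[of t] norm_triangle_ineq4[of "of_real (q t)" z]
          by (intro mult_mono) (auto simp: k_def)
        finally show ?thesis by (simp add: mult_ac)
      qed
      have half: "\<delta> / 4 * (exp (\<kappa> * x) * integral {0..x} (\<lambda>t. exp (- \<kappa> * (x - t)) * (4 * k t))) \<le> \<delta> / 4 * (exp (\<kappa> * x) * (1/2))"
        using \<delta> by (intro mult_left_mono \<kappa>(2)[OF x]) auto
      have e1: "norm (exp (- of_real (\<kappa> * x)) * w :: complex) \<le> \<delta> / 4" if "norm w \<le> \<delta> / 4 * (exp (\<kappa> * x) * (1/2))" for w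
      proof -
        have "norm (exp (- of_real (\<kappa> * x)) * w) = exp (- (\<kappa> * x)) * norm w"
          by (simp only: norm_mult norm_exp_eq_Re uminus_complex.sel Re_complex_of_real)
        also have "\<dots> \<le> exp (- (\<kappa> * x)) * (\<delta> / 4 * (exp (\<kappa> * x) * (1/2)))"
          by (intro mult_left_mono that) auto
        also have "\<dots> = \<delta> / 8" by (simp add: exp_minus)
        finally show ?thesis using \<delta> by simp
      qed
      have 1: "dist (fst (\<Phi> Y x')) (fst (\<Phi> Y' x')) \<le> \<delta> / 4"
        using e1[OF order_trans[OF norm_integral_Volterra_le[OF k4 x nA Ad] half]] AA
        by (simp add: \<Phi>_def dist_norm flip: x_def right_diff_distrib)
      have 2: "dist (snd (\<Phi> Y x')) (snd (\<Phi> Y' x')) \<le> \<delta> / 4"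
        using e1[OF order_trans[OF norm_integral_Volterra_le[OF k4 x nB Bd] half]] BB
        by (simp add: \<Phi>_def dist_norm flip: x_def right_diff_distrib)
      have "dist (\<Phi> Y x') (\<Phi> Y' x') \<le> dist (fst (\<Phi> Y x')) (fst (\<Phi> Y' x')) + dist (snd (\<Phi> Y x')) (snd (\<Phi> Y' x'))"
        unfolding dist_prod_def by (rule sqrt_sum_squares_le_sum) auto
      then show "dist (T Y x') (T Y' x') \<le> 1/2 * dist Y Y'"
        using 1 2 unfolding T \<delta>_def by linarith
    qed
  qed auto
  then obtain Y where Y: "T Y = Y" by blast
  define u where "u = (\<lambda>x. exp (of_real (\<kappa> * x)) * fst (Y x))"
  define v where "v = (\<lambda>x. exp (of_real (\<kappa> * x)) * snd (Y x))"
  have eq: "u x = c + integral {0..x} v" "v x = d + integral {0..x} (\<lambda>x. (of_real (q x) - z) * u x - f x)"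
    if "0 \<le> x" "x \<le> pi" for x
  proof -
    have "Y x = \<Phi> Y x" by (metis T Y)
    moreover have "A Y = v" "B Y = (\<lambda>x. (of_real (q x) - z) * u x - f x)"
      by (auto simp: A_def B_def u_def v_def)
    ultimately have "fst (Y x) = exp (- of_real (\<kappa> * x)) * (c + integral {0..x} v)"
      "snd (Y x) = exp (- of_real (\<kappa> * x)) * (d + integral {0..x} (\<lambda>x. (of_real (q x) - z) * u x - f x))"
      by (simp_all add: \<Phi>_def cl_id[OF that])
    then show "u x = c + integral {0..x} v" "v x = d + integral {0..x} (\<lambda>x. (of_real (q x) - z) * u x - f x)"
      by (simp_all add: u_def v_def exp_minus)
  qed
  have "v absolutely_integrable_on {0..pi}" "(\<lambda>x. (of_real (q x) - z) * u x - f x) absolutely_integrable_on {0..pi}"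
    using Ai[of Y] Bi[of Y] by (simp_all add: A_def B_def u_def v_def)
  then have "solves q z f u v" unfolding solves_def
    using eq by (blast intro: ac_derivI)
  moreover have "u 0 = c" "v 0 = d" using eq[of 0] by simp_all
  ultimately show thesis using that by blast
qed

lemma solves_lincomb:
  assumes "solves q z f u v" "solves q z f' u' v'"
  shows "solves q z (\<lambda>x. c * f x + c' * f' x) (\<lambda>x. c * u x + c' * u' x) (\<lambda>x. c * v x + c' * v' x)"
proof -
  have "ac_deriv (\<lambda>x. c * u x + c' * u' x) (\<lambda>x. c * v x + c' * v' x)"
    using assms by (intro ac_deriv_lincomb) (auto simp: solves_def)
  moreover have "ac_deriv (\<lambda>x. c * v x + c' * v' x)
      (\<lambda>x. c * ((of_real (q x) - z) * u x - f x) + c' * ((of_real (q x) - z) * u' x - f' x))"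
    using assms by (intro ac_deriv_lincomb) (auto simp: solves_def)
  ultimately show ?thesis unfolding solves_def
    by (auto elim!: ac_deriv_cong simp: algebra_simps)
qed

lemma solves_lincomb_homogeneous:
  assumes "solves q z (\<lambda>_. 0) u v" "solves q z (\<lambda>_. 0) u' v'"
  shows "solves q z (\<lambda>_. 0) (\<lambda>x. c * u x + c' * u' x) (\<lambda>x. c * v x + c' * v' x)"
  using solves_lincomb[OF assms, of c c'] by simp

lemma absint_zero: "(\<lambda>_::real. 0 :: complex) absolutely_integrable_on {0..pi}"
  by (rule absint_continuous) simp

lemma solves_unique:
  assumes q: "potential q" and s: "solves q z f u v" "solves q z f u' v'"
    and init: "u 0 = u' 0" "v 0 = v' 0" and x: "0 \<le> x" "x \<le> pi"
  shows "u x = u' x" "v x = v' x"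
proof -
  obtain C where C: "C > 0"
    "\<And>z' f u v x. norm z' \<le> norm z \<Longrightarrow> f absolutely_integrable_on {0..pi} \<Longrightarrow> solves q z' f u v \<Longrightarrow> 0 \<le> x \<Longrightarrow> x \<le> pi \<Longrightarrow>
      norm (u x) + norm (v x) \<le> C * (norm (u 0) + norm (v 0) + integral {0..pi} (\<lambda>t. norm (f t)))"
    by (rule solves_bound[OF q, of "norm z"]) blast
  have "solves q z (\<lambda>_. 0) (\<lambda>x. 1 * u x + (-1) * u' x) (\<lambda>x. 1 * v x + (-1) * v' x)"
    using solves_lincomb[OF s, of 1 "-1"] by simp
  from C(2)[OF order_refl absint_zero this x]
  have "norm (u x - u' x) + norm (v x - v' x) \<le> 0" using init by simp
  then have "norm (u x - u' x) \<le> 0" "norm (v x - v' x) \<le> 0"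
    using norm_ge_zero[of "u x - u' x"] norm_ge_zero[of "v x - v' x"] by linarith+
  then show "u x = u' x" "v x = v' x" by simp_all
qed

text \<open>Values at \<open>0\<close> are \<open>c\<close> for the solution and \<open>d\<close>
  for its derivative; the data \<open>1 0\<close> and \<open>0 1\<close> give
  \<open>\<theta>\<close> and \<open>\<phi>\<close> of the overview. The pair is determined on
  \<open>[0, pi]\<close> only.\<close>

definition sl_ivp :: "(real \<Rightarrow> real) \<Rightarrow> complex \<Rightarrow> complex \<Rightarrow> complex \<Rightarrow> (real \<Rightarrow> complex) \<times> (real \<Rightarrow> complex)" where
  "sl_ivp q c d z = (SOME uv. solves q z (\<lambda>_. 0) (fst uv) (snd uv) \<and> fst uv 0 = c \<and> snd uv 0 = d)"

abbreviation ivp_sol where "ivp_sol q c d z \<equiv> fst (sl_ivp q c d z)"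
abbreviation ivp_der where "ivp_der q c d z \<equiv> snd (sl_ivp q c d z)"

lemma sl_ivp:
  assumes "potential q"
  shows "solves q z (\<lambda>_. 0) (ivp_sol q c d z) (ivp_der q c d z)"
    "ivp_sol q c d z 0 = c" "ivp_der q c d z 0 = d"
proof -
  obtain u v where "solves q z (\<lambda>_. 0) u v" "u 0 = c" "v 0 = d"
    by (rule solves_exists[OF assms absint_zero])
  then have "\<exists>uv. solves q z (\<lambda>_. 0) (fst uv) (snd uv) \<and> fst uv 0 = c \<and> snd uv 0 = d"
    by (intro exI[of _ "(u, v)"]) simp
  from someI_ex[OF this] show "solves q z (\<lambda>_. 0) (ivp_sol q c d z) (ivp_der q c d z)"
    "ivp_sol q c d z 0 = c" "ivp_der q c d z 0 = d"
    by (auto simp: sl_ivp_def)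
qed

lemma solves_eq_ivp:
  assumes q: "potential q" and s: "solves q z (\<lambda>_. 0) u v" and x: "0 \<le> x" "x \<le> pi"
  shows "u x = ivp_sol q (u 0) (v 0) z x" "v x = ivp_der q (u 0) (v 0) z x"
  using solves_unique[OF q s sl_ivp(1)[OF q] _ _ x] sl_ivp(2,3)[OF q] by auto

lemma ivp_lincomb:
  assumes q: "potential q" and x: "0 \<le> x" "x \<le> pi"
  shows "ivp_sol q (s * c + t * c') (s * d + t * d') z x = s * ivp_sol q c d z x + t * ivp_sol q c' d' z x"
    "ivp_der q (s * c + t * c') (s * d + t * d') z x = s * ivp_der q c d z x + t * ivp_der q c' d' z x"
  using solves_eq_ivp[OF q solves_lincomb_homogeneous[OF sl_ivp(1)[OF q, where c = c and d = d and z = z]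
      sl_ivp(1)[OF q, where c = c' and d = d' and z = z], where c = s and c' = t] x]
  by (simp_all add: sl_ivp(2,3)[OF q])

section \<open>Holomorphic dependence on the spectral parameter\<close>

lemma has_field_derivative_of_quadratic_bound:
  fixes f :: "complex \<Rightarrow> complex"
  assumes "\<And>z. norm (z - w) \<le> 1 \<Longrightarrow> norm (f z - f w - (z - w) * D) \<le> M * (norm (z - w))\<^sup>2"
  shows "(f has_field_derivative D) (at w)"
  unfolding has_field_derivative_iff
proof (rule LIM_zero_cancel, rule Lim_null_comparison)
  have "((\<lambda>z. M * norm (z - w)) \<longlongrightarrow> M * norm (w - w)) (at w)" by (intro tendsto_intros)
  then show "((\<lambda>z. M * norm (z - w)) \<longlongrightarrow> 0) (at w)" by simp
  have "norm ((f z - f w) / (z - w) - D) \<le> M * norm (z - w)" if "z \<noteq> w" "norm (z - w) \<le> 1" for z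
  proof -
    have "(f z - f w) / (z - w) - D = (f z - f w - (z - w) * D) / (z - w)"
      using that by (simp add: field_simps)
    then have "norm ((f z - f w) / (z - w) - D) = norm (f z - f w - (z - w) * D) / norm (z - w)"
      by (simp add: norm_divide)
    also have "\<dots> \<le> M * (norm (z - w))\<^sup>2 / norm (z - w)"
      by (intro divide_right_mono assms that) auto
    finally show ?thesis using that by (simp add: power2_eq_square)
  qed
  then show "\<forall>\<^sub>F z in at w. norm ((f z - f w) / (z - w) - D) \<le> M * norm (z - w)"
    unfolding eventually_at by (intro exI[of _ 1]) (auto simp: dist_norm)
qed

text \<open>
  The derivative at \<open>w\<close> is the solution \<open>p\<close> of the inhomogeneous equation with right-hand side \<open>u\<^sub>w\<close>, since
  \<open>u\<^sub>z - u\<^sub>w - (z - w) p\<close> solves the equation with right-hand side \<open>(z - w)\<^sup>2 p\<close>.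
\<close>

lemma ivp_holomorphic:
  assumes q: "potential q" and x: "0 \<le> x" "x \<le> pi"
  shows "(\<lambda>z. ivp_sol q c d z x) holomorphic_on UNIV" "(\<lambda>z. ivp_der q c d z x) holomorphic_on UNIV"
proof -
  have "\<exists>D. ((\<lambda>z. ivp_sol q c d z x) has_field_derivative D) (at w)"
       "\<exists>D. ((\<lambda>z. ivp_der q c d z x) has_field_derivative D) (at w)" for w
  proof -
    define u where "u = (\<lambda>z. ivp_sol q c d z)"
    define v where "v = (\<lambda>z. ivp_der q c d z)"
    have s: "solves q z (\<lambda>_. 0) (u z) (v z)" for z unfolding u_def v_def by (rule sl_ivp[OF q])
    have uw: "u w absolutely_integrable_on {0..pi}"
      using s[of w] by (auto simp: solves_def intro: absint_continuous ac_deriv_continuous)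
    obtain p p' where p: "solves q w (u w) p p'" "p 0 = 0" "p' 0 = 0"
      by (rule solves_exists[OF q uw])
    have pa: "p absolutely_integrable_on {0..pi}"
      using p(1) by (auto simp: solves_def intro: absint_continuous ac_deriv_continuous)
    obtain C where C: "C > 0"
      "\<And>z' f u v x. norm z' \<le> norm w + 1 \<Longrightarrow> f absolutely_integrable_on {0..pi} \<Longrightarrow> solves q z' f u v \<Longrightarrow> 0 \<le> x \<Longrightarrow> x \<le> pi \<Longrightarrow>
        norm (u x) + norm (v x) \<le> C * (norm (u 0) + norm (v 0) + integral {0..pi} (\<lambda>t. norm (f t)))"
      by (rule solves_bound[OF q, of "norm w + 1"]) blast
    define M where "M = C * integral {0..pi} (\<lambda>t. norm (p t))"
    have bound: "norm (u z x - u w x - (z - w) * p x) + norm (v z x - v w x - (z - w) * p' x) \<le> M * (norm (z - w))\<^sup>2"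
      if z: "norm (z - w) \<le> 1" for z
    proof -
      have "solves q z (\<lambda>x. (z - w)\<^sup>2 * p x) (\<lambda>x. u z x - u w x - (z - w) * p x) (\<lambda>x. v z x - v w x - (z - w) * p' x)"
        unfolding solves_def
      proof
        have "ac_deriv (\<lambda>x. 1 * (1 * u z x + (-1) * u w x) + (- (z - w)) * p x) (\<lambda>x. 1 * (1 * v z x + (-1) * v w x) + (- (z - w)) * p' x)"
          using s p by (intro ac_deriv_lincomb) (auto simp: solves_def)
        then show "ac_deriv (\<lambda>x. u z x - u w x - (z - w) * p x) (\<lambda>x. v z x - v w x - (z - w) * p' x)"
          by (rule ac_deriv_cong) (auto simp: algebra_simps)
        have "ac_deriv (\<lambda>x. 1 * (1 * v z x + (-1) * v w x) + (- (z - w)) * p' x)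
          (\<lambda>x. 1 * (1 * ((of_real (q x) - z) * u z x - 0) + (-1) * ((of_real (q x) - w) * u w x - 0)) + (- (z - w)) * ((of_real (q x) - w) * p x - u w x))"
          using s[of z] s[of w] p by (intro ac_deriv_lincomb) (auto simp: solves_def)
        then show "ac_deriv (\<lambda>x. v z x - v w x - (z - w) * p' x)
          (\<lambda>x. (of_real (q x) - z) * (u z x - u w x - (z - w) * p x) - (z - w)\<^sup>2 * p x)"
          by (rule ac_deriv_cong) (auto simp: algebra_simps power2_eq_square)
      qed
      moreover have "(\<lambda>x. (z - w)\<^sup>2 * p x) absolutely_integrable_on {0..pi}"
        using pa by (intro set_integrable_mult_right) auto
      moreover have "norm z \<le> norm w + 1" using norm_triangle_sub[of z w] z by linarith
      ultimately have "norm (u z x - u w x - (z - w) * p x) + norm (v z x - v w x - (z - w) * p' x)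
        \<le> C * (norm (u z 0 - u w 0 - (z - w) * p 0) + norm (v z 0 - v w 0 - (z - w) * p' 0) + integral {0..pi} (\<lambda>t. norm ((z - w)\<^sup>2 * p t)))"
        using C(2) x by blast
      then show ?thesis
        by (simp add: u_def v_def sl_ivp(2,3)[OF q] p(2,3) M_def norm_mult norm_power mult_ac)
    qed
    have "((\<lambda>z. u z x) has_field_derivative p x) (at w)"
    proof (rule has_field_derivative_of_quadratic_bound)
      fix z assume "norm (z - w) \<le> 1"
      from bound[OF this] show "norm (u z x - u w x - (z - w) * p x) \<le> M * (norm (z - w))\<^sup>2"
        using norm_ge_zero[of "v z x - v w x - (z - w) * p' x"] by linarith
    qed
    then show "\<exists>D. ((\<lambda>z. ivp_sol q c d z x) has_field_derivative D) (at w)" by (auto simp: u_def)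
    have "((\<lambda>z. v z x) has_field_derivative p' x) (at w)"
    proof (rule has_field_derivative_of_quadratic_bound)
      fix z assume "norm (z - w) \<le> 1"
      from bound[OF this] show "norm (v z x - v w x - (z - w) * p' x) \<le> M * (norm (z - w))\<^sup>2"
        using norm_ge_zero[of "u z x - u w x - (z - w) * p x"] by linarith
    qed
    then show "\<exists>D. ((\<lambda>z. ivp_der q c d z x) has_field_derivative D) (at w)" by (auto simp: v_def)
  qed
  then show "(\<lambda>z. ivp_sol q c d z x) holomorphic_on UNIV" "(\<lambda>z. ivp_der q c d z x) holomorphic_on UNIV"
    by (simp_all add: holomorphic_on_def field_differentiable_def)
qed

section \<open>Reflection about the midpoint, which turns terminal values at \<open>pi\<close> into
  initial values at \<open>0\<close>\<close>

lemma has_integral_reflect_pi: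
  fixes g :: "real \<Rightarrow> 'a::euclidean_space"
  assumes "(g has_integral I) {a..b}"
  shows "((\<lambda>t. g (pi - t)) has_integral I) {pi - b..pi - a}"
proof -
  have img: "(\<lambda>x. (1 / (-1)) *\<^sub>R x + - ((1 / (-1)) *\<^sub>R pi)) ` cbox a b = {pi - b..pi - a}"
  proof -
    have "x \<in> (\<lambda>x. pi - x) ` {a..b}" if "x \<in> {pi - b..pi - a}" for x
      using that by (intro image_eqI[of _ _ "pi - x"]) auto
    then have "(\<lambda>x. pi - x) ` {a..b} = {pi - b..pi - a}" by auto
    then show ?thesis by simp
  qed
  have "((\<lambda>x. g ((-1) *\<^sub>R x + pi)) has_integral (1 / (\<bar>-1::real\<bar> ^ DIM(real))) *\<^sub>R I)
      ((\<lambda>x. (1 / (-1)) *\<^sub>R x + - ((1 / (-1)) *\<^sub>R pi)) ` cbox a b)"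
    by (rule has_integral_affinity) (use assms in auto)
  then show ?thesis unfolding img by simp
qed

lemma ac_deriv_reflect:
  assumes "ac_deriv f g"
  shows "ac_deriv (\<lambda>x. f (pi - x)) (\<lambda>x. - g (pi - x))"
proof (rule ac_derivI)
  have "g integrable_on {0..pi}" "(\<lambda>x. norm (g x)) integrable_on {0..pi}"
    using ac_deriv_absint[OF assms] by (auto simp: absolutely_integrable_on_def)
  then have "(\<lambda>t. g (pi - t)) integrable_on {0..pi}" "(\<lambda>t. norm (g (pi - t))) integrable_on {0..pi}"
    using has_integral_reflect_pi[of g _ 0 pi] has_integral_reflect_pi[of "\<lambda>x. norm (g x)" _ 0 pi]
    by (auto simp: integrable_on_def)
  then show "(\<lambda>t. - g (pi - t)) absolutely_integrable_on {0..pi}"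
    by (simp add: absolutely_integrable_on_def integrable_neg)
  fix x :: real assume x: "0 \<le> x" "x \<le> pi"
  have "(g has_integral (f pi - f (pi - x))) {pi - x..pi}"
    using ac_deriv_diff[OF assms, of "pi - x" pi] absint_integrable_on_sub(1)[OF ac_deriv_absint[OF assms], of "pi - x" pi] x
    by (simp add: has_integral_integral)
  from has_integral_reflect_pi[OF this]
  have "((\<lambda>t. g (pi - t)) has_integral (f pi - f (pi - x))) {0..x}" by simp
  from integral_unique[OF this] show "f (pi - x) = f pi + integral {0..x} (\<lambda>t. - g (pi - t))"
    by simp
qed

lemma solves_reflect:
  assumes "solves q z f u v"
  shows "solves (\<lambda>x. q (pi - x)) z (\<lambda>x. f (pi - x)) (\<lambda>x. u (pi - x)) (\<lambda>x. - v (pi - x))"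
proof -
  have "ac_deriv (\<lambda>x. (-1) * v (pi - x)) (\<lambda>x. (-1) * - ((of_real (q (pi - x)) - z) * u (pi - x) - f (pi - x)))"
    using assms by (intro ac_deriv_cmult ac_deriv_reflect) (simp add: solves_def)
  then show ?thesis
    using ac_deriv_reflect[of u v] assms by (simp add: solves_def)
qed

lemma potential_reflect:
  assumes "potential q" shows "potential (\<lambda>x. q (pi - x))"
proof -
  have "q integrable_on {0..pi}" "(\<lambda>x. norm (q x)) integrable_on {0..pi}"
    using assms by (auto simp: potential_iff absolutely_integrable_on_def)
  then have "(\<lambda>t. q (pi - t)) integrable_on {0..pi}" "(\<lambda>t. norm (q (pi - t))) integrable_on {0..pi}"
    using has_integral_reflect_pi[of q _ 0 pi] has_integral_reflect_pi[of "\<lambda>x. norm (q x)" _ 0 pi]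
    by (auto simp: integrable_on_def)
  then show ?thesis by (simp add: potential_iff absolutely_integrable_on_def)
qed

section \<open>Estimates for large spectral parameter\<close>

definition pot_norm :: "(real \<Rightarrow> real) \<Rightarrow> real" where
  "pot_norm q = integral {0..pi} (\<lambda>x. \<bar>q x\<bar>)"

lemma norm_integral_pot_le:
  fixes h :: "real \<Rightarrow> complex"
  assumes q: "potential q" and x: "0 \<le> x" "x \<le> pi" and C: "C \<ge> 0"
    and le: "\<And>t. 0 \<le> t \<Longrightarrow> t \<le> x \<Longrightarrow> norm (h t) \<le> C * \<bar>q t\<bar>" and h: "h integrable_on {0..x}"
  shows "norm (integral {0..x} h) \<le> C * pot_norm q"
proof -
  have i: "(\<lambda>t. \<bar>q t\<bar>) integrable_on {0..x}" "(\<lambda>t. \<bar>q t\<bar>) integrable_on {0..pi}"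
    using absint_integrable_on_sub(2)[OF potential_absint[OF q], of 0] x by auto
  have "norm (integral {0..x} h) \<le> C * integral {0..x} (\<lambda>t. norm (complex_of_real (q t)))"
    by (rule norm_integral_sub_le[OF potential_absint[OF q]]) (use x le h in auto)
  also have "integral {0..x} (\<lambda>t. norm (complex_of_real (q t))) \<le> pot_norm q"
    unfolding pot_norm_def using x i by (simp) (intro integral_subset_le, auto)
  finally show ?thesis using C by (simp add: mult_left_mono)
qed

lemma pot_norm_nonneg: "pot_norm q \<ge> 0"
  unfolding pot_norm_def by (cases "(\<lambda>x. \<bar>q x\<bar>) integrable_on {0..pi}") (auto simp: integral_nonneg not_integrable_integral)

lemma ac_deriv_exp: "ac_deriv (\<lambda>x. exp (c * of_real x)) (\<lambda>x. c * exp (c * of_real x))"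
proof (rule ac_derivI)
  fix x :: real assume "0 \<le> x"
  have "((\<lambda>x. c * exp (c * of_real x)) has_integral (exp (c * of_real x) - exp (c * of_real 0))) {0..x}"
    by (rule fundamental_theorem_of_calculus[OF \<open>0 \<le> x\<close>])
      (auto intro!: derivative_eq_intros has_vector_derivative_real_field)
  from integral_unique[OF this]
  show "exp (c * of_real x) = 1 + integral {0..x} (\<lambda>x. c * exp (c * of_real x))" by simp
qed (intro absint_continuous continuous_intros)

text \<open>
  With \<open>z = - \<kappa>\<^sup>2\<close> the functions \<open>p = u' + \<kappa> u\<close> and \<open>r = u' - \<kappa> u\<close> satisfy
  \<open>p' = \<kappa> p + q u\<close> and \<open>r' = - \<kappa> r + q u\<close>.
\<close>

lemma solution_estimate:
  assumes q: "potential q" and s: "solves q (- (\<kappa>\<^sup>2)) (\<lambda>_. 0) u v"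
    and \<kappa>: "Re \<kappa> \<ge> 0" "\<kappa> \<noteq> 0" "norm \<kappa> \<ge> 2 * pot_norm q" and x: "0 \<le> x" "x \<le> pi"
  defines "p0 \<equiv> v 0 + \<kappa> * u 0" and "r0 \<equiv> v 0 - \<kappa> * u 0"
  shows "norm \<kappa> * norm (u x) \<le> (norm p0 + norm r0) * exp (Re \<kappa> * x)"
    and "norm (exp (- \<kappa> * x) * (v x + \<kappa> * u x) - p0) \<le> pot_norm q * (norm p0 + norm r0) / norm \<kappa>"
    and "norm (exp (- \<kappa> * x) * (v x - \<kappa> * u x)) \<le>
      exp (- 2 * Re \<kappa> * x) * norm r0 + pot_norm q * (norm p0 + norm r0) / norm \<kappa>"
proof -
  have u: "ac_deriv u v" and v: "ac_deriv v (\<lambda>x. (of_real (q x) + \<kappa>\<^sup>2) * u x)"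
    using s by (auto simp: solves_def)
  note cu = ac_deriv_continuous[OF u]
  define A where "A = norm p0 + norm r0"
  have nk: "norm \<kappa> > 0" using \<kappa> by simp
  have comb: "ac_deriv (\<lambda>x. 1 * v x + c * u x) (\<lambda>x. 1 * ((of_real (q x) + \<kappa>\<^sup>2) * u x) + c * v x)" for c
    by (rule ac_deriv_lincomb[OF v u])
  \<comment> \<open>The choices \<open>c = \<kappa>\<close> and \<open>c = - \<kappa>\<close> cover
    both integrating factors, for \<open>p\<close> and for \<open>r\<close>.\<close>
  have prod: "ac_deriv (\<lambda>x. (v x + c * u x) * exp (- c * of_real x)) (\<lambda>x. of_real (q x) * u x * exp (- c * of_real x))"
    if "c\<^sup>2 = \<kappa>\<^sup>2" for c
  proof -
    have "ac_deriv (\<lambda>x. (1 * v x + c * u x) * exp (- c * of_real x))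
      (\<lambda>x. (1 * ((of_real (q x) + \<kappa>\<^sup>2) * u x) + c * v x) * exp (- c * of_real x) + (1 * v x + c * u x) * (- c * exp (- c * of_real x)))"
      by (rule ac_deriv_mult[OF comb ac_deriv_exp]) (intro continuous_intros)
    then show ?thesis
      by (rule ac_deriv_cong) (auto simp: algebra_simps power2_eq_square that[symmetric, unfolded power2_eq_square])
  qed
  note P = prod[of \<kappa>, OF refl] and R = prod[of "- \<kappa>", simplified]
  obtain x0 where x0: "0 \<le> x0" "x0 \<le> pi"
    and max: "\<And>x. 0 \<le> x \<Longrightarrow> x \<le> pi \<Longrightarrow> exp (- Re \<kappa> * x) * norm (u x) \<le> exp (- Re \<kappa> * x0) * norm (u x0)"
  proof -
    have "continuous_on {0..pi} (\<lambda>x. exp (- Re \<kappa> * x) * norm (u x))" by (intro continuous_intros cu)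
    then show ?thesis
      using that continuous_attains_sup[of "{0..pi}" "\<lambda>x. exp (- Re \<kappa> * x) * norm (u x)"] by auto
  qed
  define S where "S = exp (- Re \<kappa> * x0) * norm (u x0)"
  have S: "S \<ge> 0" by (simp add: S_def)
  have u_le: "norm (u t) \<le> S * exp (Re \<kappa> * t)" if "0 \<le> t" "t \<le> pi" for t
    using max[OF that] by (simp add: S_def exp_minus field_simps)
  have P_le: "norm (exp (- \<kappa> * x) * (v x + \<kappa> * u x) - p0) \<le> S * pot_norm q" if x: "0 \<le> x" "x \<le> pi" for x
  proof -
    have "exp (- \<kappa> * x) * (v x + \<kappa> * u x) - p0 = integral {0..x} (\<lambda>x. of_real (q x) * u x * exp (- \<kappa> * of_real x))"
      using ac_deriv_eq[OF P x] by (simp add: p0_def mult.commute)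
    also have "norm \<dots> \<le> S * pot_norm q"
    proof (rule norm_integral_pot_le[OF q x S])
      show "(\<lambda>x. of_real (q x) * u x * exp (- \<kappa> * of_real x)) integrable_on {0..x}"
        using absint_integrable_on_sub(1)[OF ac_deriv_absint[OF P]] x by simp
      fix t assume t: "0 \<le> t" "t \<le> x"
      have "norm (of_real (q t) * u t * exp (- \<kappa> * of_real t)) = \<bar>q t\<bar> * (norm (u t) * exp (- Re \<kappa> * t))"
        by (simp add: norm_mult)
      also have "\<dots> \<le> \<bar>q t\<bar> * (S * exp (Re \<kappa> * t) * exp (- Re \<kappa> * t))"
        using u_le[of t] t x by (intro mult_left_mono mult_right_mono) auto
      finally show "norm (of_real (q t) * u t * exp (- \<kappa> * of_real t)) \<le> S * \<bar>q t\<bar>"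
        by (simp add: exp_minus mult_ac)
    qed
    finally show ?thesis .
  qed
  have R_le: "norm (exp (- \<kappa> * x) * (v x - \<kappa> * u x)) \<le> exp (- 2 * Re \<kappa> * x) * norm r0 + S * pot_norm q" if x: "0 \<le> x" "x \<le> pi" for x
  proof -
    define I where "I = integral {0..x} (\<lambda>x. of_real (q x) * u x * exp (\<kappa> * of_real x))"
    have "norm I \<le> (S * exp (2 * Re \<kappa> * x)) * pot_norm q" unfolding I_def
    proof (rule norm_integral_pot_le[OF q x])
      show "(\<lambda>x. of_real (q x) * u x * exp (\<kappa> * of_real x)) integrable_on {0..x}"
        using absint_integrable_on_sub(1)[OF ac_deriv_absint[OF R]] x by simp
      fix t assume t: "0 \<le> t" "t \<le> x"
      have "norm (of_real (q t) * u t * exp (\<kappa> * of_real t)) = \<bar>q t\<bar> * (norm (u t) * exp (Re \<kappa> * t))"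
        by (simp add: norm_mult)
      also have "\<dots> \<le> \<bar>q t\<bar> * (S * exp (Re \<kappa> * t) * exp (Re \<kappa> * t))"
        using u_le[of t] t x by (intro mult_left_mono mult_right_mono) auto
      also have "\<dots> = \<bar>q t\<bar> * (S * exp (2 * Re \<kappa> * t))"
        by (simp add: mult.assoc flip: exp_add)
      also have "\<dots> \<le> \<bar>q t\<bar> * (S * exp (2 * Re \<kappa> * x))"
        using t \<kappa> S by (intro mult_left_mono) (auto intro!: mult_left_mono)
      finally show "norm (of_real (q t) * u t * exp (\<kappa> * of_real t)) \<le> S * exp (2 * Re \<kappa> * x) * \<bar>q t\<bar>"
        by (simp add: mult_ac)
    qed (use S in auto)
    have rI: "(v x - \<kappa> * u x) * exp (\<kappa> * of_real x) = r0 + I"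
      using ac_deriv_eq[OF R x] by (simp add: r0_def I_def)
    \<comment> \<open>The integrating factor natural for \<open>r\<close> is
      \<open>exp (\<kappa> * x)\<close>, but the estimate is wanted relative to the growing
      exponential. The quotient \<open>exp (- 2 * \<kappa> * x)\<close> damps the initial value
      \<open>r0\<close> and cancels the growth in the bound for \<open>I\<close>.\<close>
    have "exp (- \<kappa> * x) = exp (- 2 * \<kappa> * x) * exp (\<kappa> * of_real x)"
      by (simp flip: exp_add)
    then have "exp (- \<kappa> * x) * (v x - \<kappa> * u x) = exp (- 2 * \<kappa> * x) * ((v x - \<kappa> * u x) * exp (\<kappa> * of_real x))"
      by (simp only: mult_ac)
    then have "exp (- \<kappa> * x) * (v x - \<kappa> * u x) = exp (- 2 * \<kappa> * x) * (r0 + I)"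
      unfolding rI .
    then have "norm (exp (- \<kappa> * x) * (v x - \<kappa> * u x)) = exp (- 2 * Re \<kappa> * x) * norm (r0 + I)"
      by (simp add: norm_mult)
    also have "\<dots> \<le> exp (- 2 * Re \<kappa> * x) * (norm r0 + (S * exp (2 * Re \<kappa> * x)) * pot_norm q)"
      using \<open>norm I \<le> _\<close> norm_triangle_ineq[of r0 I] by (intro mult_left_mono) auto
    also have "\<dots> = exp (- 2 * Re \<kappa> * x) * norm r0 + S * pot_norm q"
      by (simp add: distrib_left exp_minus)
    finally show ?thesis .
  qed
  \<comment> \<open>At the maximum point \<open>x0\<close> the weighted \<open>p\<close> and
    \<open>r\<close> differ by \<open>2 \<kappa>\<close> times the weighted \<open>u\<close>. This
    gives \<open>2 * norm \<kappa> * S \<le> A + 2 * S * pot_norm q\<close>, and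
    \<open>norm \<kappa> \<ge> 2 * pot_norm q\<close> absorbs the last term.\<close>
  have SA: "norm \<kappa> * S \<le> A"
  proof -
    define a where "a = exp (- \<kappa> * x0) * (v x0 + \<kappa> * u x0)"
    define b where "b = exp (- \<kappa> * x0) * (v x0 - \<kappa> * u x0)"
    have "a - b = 2 * (\<kappa> * (exp (- \<kappa> * x0) * u x0))" by (simp add: a_def b_def algebra_simps)
    then have "norm (a - b) = 2 * (norm \<kappa> * S)" by (simp add: S_def norm_mult)
    moreover have "norm (a - b) \<le> norm (a - p0) + norm p0 + norm b"
      using norm_triangle_ineq4[of "(a - p0) + p0" b] norm_triangle_ineq[of "a - p0" p0] by simp
    moreover have "norm (a - p0) \<le> S * pot_norm q" using P_le[OF x0] by (simp only: a_def)
    moreover have "norm b \<le> norm r0 + S * pot_norm q"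
    proof -
      have "exp (- 2 * Re \<kappa> * x0) * norm r0 \<le> 1 * norm r0" using \<kappa> x0 by (intro mult_right_mono) auto
      then show ?thesis using R_le[OF x0] by (simp only: b_def)
    qed
    moreover have "S * (2 * pot_norm q) \<le> S * norm \<kappa>" by (rule mult_left_mono[OF \<kappa>(3) S])
    ultimately show ?thesis by (simp add: A_def algebra_simps)
  qed
  then have S_le: "S \<le> A / norm \<kappa>" using nk by (simp add: field_simps)
  have Spot: "S * pot_norm q \<le> pot_norm q * A / norm \<kappa>"
    using mult_right_mono[OF S_le pot_norm_nonneg[of q]] by (simp add: mult_ac)
  have "norm \<kappa> * norm (u x) \<le> norm \<kappa> * (S * exp (Re \<kappa> * x))"
    using u_le[OF x] by (intro mult_left_mono) auto
  also have "\<dots> \<le> A * exp (Re \<kappa> * x)" using SA by (simp add: mult.assoc[symmetric] mult_right_mono)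
  finally show "norm \<kappa> * norm (u x) \<le> (norm p0 + norm r0) * exp (Re \<kappa> * x)" by (simp add: A_def)
  show "norm (exp (- \<kappa> * x) * (v x + \<kappa> * u x) - p0) \<le> pot_norm q * (norm p0 + norm r0) / norm \<kappa>"
    using P_le[OF x] Spot by (simp add: A_def)
  show "norm (exp (- \<kappa> * x) * (v x - \<kappa> * u x)) \<le>
      exp (- 2 * Re \<kappa> * x) * norm r0 + pot_norm q * (norm p0 + norm r0) / norm \<kappa>"
    using R_le[OF x] Spot by (simp add: A_def)
qed

lemma solves_continuous:
  assumes "solves q z f u v"
  shows "continuous_on {0..pi} u" "continuous_on {0..pi} v"
  using assms by (auto simp: solves_def intro: ac_deriv_continuous)

lemma Wronskian_constant:
  assumes s: "solves q z (\<lambda>_. 0) u v" "solves q z (\<lambda>_. 0) u' v'" and x: "0 \<le> x" "x \<le> pi"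
  shows "u x * v' x - v x * u' x = u 0 * v' 0 - v 0 * u' 0"
proof -
  have "ac_deriv (\<lambda>x. v' x * u x) (\<lambda>x. ((of_real (q x) - z) * u' x - 0) * u x + v' x * v x)"
    using s by (intro ac_deriv_mult solves_continuous(2)[OF s(1)]) (auto simp: solves_def)
  moreover have "ac_deriv (\<lambda>x. v x * u' x) (\<lambda>x. ((of_real (q x) - z) * u x - 0) * u' x + v x * v' x)"
    using s by (intro ac_deriv_mult solves_continuous(2)[OF s(2)]) (auto simp: solves_def)
  ultimately have "ac_deriv (\<lambda>x. 1 * (v' x * u x) + (-1) * (v x * u' x))
    (\<lambda>x. 1 * (((of_real (q x) - z) * u' x - 0) * u x + v' x * v x) + (-1) * (((of_real (q x) - z) * u x - 0) * u' x + v x * v' x))"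
    by (rule ac_deriv_lincomb)
  then have "ac_deriv (\<lambda>x. u x * v' x - v x * u' x) (\<lambda>x. 0)"
    by (rule ac_deriv_cong) (auto simp: algebra_simps)
  from ac_deriv_eq[OF this x] show ?thesis by simp
qed

section \<open>Null sets, square integrability and the graph of the operator\<close>

lemma AE_interval_negligible:
  assumes "AE x in lebesgue_on {0<..<pi}. P x"
  shows "negligible {x \<in> {0..pi}. \<not> P x}"
proof -
  have "AE x in lebesgue. x \<in> {0<..<pi} \<longrightarrow> P x"
    using assms by (subst (asm) AE_restrict_space_iff) auto
  then obtain N where N: "negligible N" "{x. \<not> (x \<in> {0<..<pi} \<longrightarrow> P x)} \<subseteq> N"
    unfolding eventually_ae_filter_negligible by blast
  have "negligible (N \<union> {0, pi})" using N by (intro negligible_Un) auto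
  moreover have "{x \<in> {0..pi}. \<not> P x} \<subseteq> N \<union> {0, pi}"
  proof
    fix x assume x: "x \<in> {x \<in> {0..pi}. \<not> P x}"
    show "x \<in> N \<union> {0, pi}"
    proof (cases "x \<in> {0<..<pi}")
      case True
      then show ?thesis using N(2) x by blast
    next
      case False
      then show ?thesis using x by auto
    qed
  qed
  ultimately show ?thesis by (rule negligible_subset)
qed

lemma ac_deriv_spike:
  assumes f: "ac_deriv f g" and ae: "AE x in lebesgue_on {0<..<pi}. g' x = g x"
  shows "ac_deriv f g'"
proof (rule ac_derivI)
  note N = AE_interval_negligible[OF ae]
  show "g' absolutely_integrable_on {0..pi}"
    by (rule absolutely_integrable_spike[OF ac_deriv_absint[OF f] N]) auto
  fix x :: real assume x: "0 \<le> x" "x \<le> pi"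
  have "integral {0..x} g' = integral {0..x} g"
    by (rule integral_spike[OF N]) (use x in auto)
  then show "f x = f 0 + integral {0..x} g'" using ac_deriv_eq[OF f x] by simp
qed

text \<open>Indefinite integrals do not see null sets, so the existentially quantified
  \<open>w\<close> may be replaced by the expression it equals almost everywhere.\<close>

lemma sl_expr_iff:
  "sl_expr q u v f \<longleftrightarrow> ac_deriv u v \<and> ac_deriv v (\<lambda>x. of_real (q x) * u x - f x)"
proof
  assume "sl_expr q u v f"
  then obtain w where w: "ac_deriv u v" "ac_deriv v w"
    "AE x in lebesgue_on {0<..<pi}. - w x + of_real (q x) * u x = f x" by (auto simp: sl_expr_def)
  have "AE x in lebesgue_on {0<..<pi}. of_real (q x) * u x - f x = w x"
    using w(3) by eventually_elim (simp add: algebra_simps)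
  then show "ac_deriv u v \<and> ac_deriv v (\<lambda>x. of_real (q x) * u x - f x)"
    by (intro conjI w(1) ac_deriv_spike[OF w(2)])
next
  assume "ac_deriv u v \<and> ac_deriv v (\<lambda>x. of_real (q x) * u x - f x)"
  then show "sl_expr q u v f"
    by (auto simp: sl_expr_def intro!: exI[of _ "\<lambda>x. of_real (q x) * u x - f x"])
qed

lemma solves_iff_sl_expr: "solves q z f u v \<longleftrightarrow> sl_expr q u v (\<lambda>x. f x + z * u x)"
  unfolding sl_expr_iff solves_def by (simp add: algebra_simps)

lemma borel_measurable_interval_AE:
  fixes f g :: "real \<Rightarrow> complex"
  assumes f: "f \<in> borel_measurable (lebesgue_on {0<..<pi})" and ae: "AE x in lebesgue_on {0<..<pi}. f x = g x"
  shows "g \<in> borel_measurable (lebesgue_on {0<..<pi})"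
proof -
  have "AE x in lebesgue. x \<in> {0<..<pi} \<longrightarrow> f x = g x"
    using ae by (subst (asm) AE_restrict_space_iff) auto
  then have "AE x in lebesgue. (if x \<in> {0<..<pi} then f x else 0) = (if x \<in> {0<..<pi} then g x else 0)"
    by eventually_elim auto
  moreover have "(\<lambda>x. if x \<in> {0<..<pi} then f x else 0) \<in> borel_measurable lebesgue"
    using f by (subst borel_measurable_if) auto
  ultimately have "(\<lambda>x. if x \<in> {0<..<pi} then g x else 0) \<in> borel_measurable lebesgue"
    by (rule borel_measurable_AE[rotated])
  then show ?thesis by (subst (asm) borel_measurable_if) auto
qed

lemma in_L2_cong_AE:
  assumes f: "in_L2 f" and ae: "AE x in lebesgue_on {0<..<pi}. f x = g x"
  shows "in_L2 g"
proof -
  have m: "f \<in> borel_measurable (lebesgue_on {0<..<pi})" using f by (simp add: in_L2_def)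
  have g: "g \<in> borel_measurable (lebesgue_on {0<..<pi})"
    by (rule borel_measurable_interval_AE[OF m ae])
  have "integrable (lebesgue_on {0<..<pi}) (\<lambda>x. (cmod (g x))\<^sup>2)"
    by (rule integrable_cong_AE_imp[of _ "\<lambda>x. (cmod (f x))\<^sup>2"])
      (use f g ae in \<open>auto simp: in_L2_def elim!: eventually_mono\<close>)
  with g show ?thesis by (simp add: in_L2_def)
qed

lemma in_L2_lincomb:
  assumes f: "in_L2 f" and g: "in_L2 g"
  shows "in_L2 (\<lambda>x. f x + c * g x)"
  unfolding in_L2_def
proof
  have m[measurable]: "f \<in> borel_measurable (lebesgue_on {0<..<pi})" "g \<in> borel_measurable (lebesgue_on {0<..<pi})"
    using assms by (auto simp: in_L2_def)
  show m': "(\<lambda>x. f x + c * g x) \<in> borel_measurable (lebesgue_on {0<..<pi})" by measurable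
  have le: "(norm (f x + c * g x))\<^sup>2 \<le> 2 * (norm (f x))\<^sup>2 + 2 * (norm c)\<^sup>2 * (norm (g x))\<^sup>2" for x
  proof -
    have "(norm (f x + c * g x))\<^sup>2 \<le> (norm (f x) + norm (c * g x))\<^sup>2"
      by (intro power_mono norm_triangle_ineq) auto
    also have "\<dots> \<le> 2 * (norm (f x))\<^sup>2 + 2 * (norm (c * g x))\<^sup>2"
      using sum_squares_bound[of "norm (f x)" "norm (c * g x)"] by (simp add: power2_sum)
    finally show ?thesis by (simp add: norm_mult power_mult_distrib)
  qed
  show "integrable (lebesgue_on {0<..<pi}) (\<lambda>x. (norm (f x + c * g x))\<^sup>2)"
  proof (rule Bochner_Integration.integrable_bound)
    show "integrable (lebesgue_on {0<..<pi}) (\<lambda>x. 2 * (norm (f x))\<^sup>2 + 2 * (norm c)\<^sup>2 * (norm (g x))\<^sup>2)"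
      using assms by (auto simp: in_L2_def)
    show "(\<lambda>x. (norm (f x + c * g x))\<^sup>2) \<in> borel_measurable (lebesgue_on {0<..<pi})" by measurable
    show "AE x in lebesgue_on {0<..<pi}. norm ((norm (f x + c * g x))\<^sup>2) \<le> norm (2 * (norm (f x))\<^sup>2 + 2 * (norm c)\<^sup>2 * (norm (g x))\<^sup>2)"
      using le by (intro AE_I2) (smt (verit) real_norm_def zero_le_power2)
  qed
qed

lemma in_L2_bounded:
  assumes m: "u \<in> borel_measurable (lebesgue_on {0<..<pi})" and B: "\<And>x. 0 < x \<Longrightarrow> x < pi \<Longrightarrow> norm (u x) \<le> B" "B \<ge> 0"
  shows "in_L2 u" "norm_L2 u \<le> 2 * B"
proof -
  have le: "(norm (u x))\<^sup>2 \<le> B\<^sup>2" if "0 < x" "x < pi" for x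
    using B(1)[OF that] by (intro power_mono) auto
  have c: "integrable (lebesgue_on {0<..<pi}) (\<lambda>x. B\<^sup>2)"
    by (rule finite_measure.integrable_const) (simp add: finite_measure_lebesgue_on)
  have i: "integrable (lebesgue_on {0<..<pi}) (\<lambda>x. (norm (u x))\<^sup>2)"
    by (rule Bochner_Integration.integrable_bound[OF c]) (use m le in \<open>auto intro!: AE_I2\<close>)
  then show "in_L2 u" using m by (simp add: in_L2_def)
  have "integral\<^sup>L (lebesgue_on {0<..<pi}) (\<lambda>x. (norm (u x))\<^sup>2) \<le> integral\<^sup>L (lebesgue_on {0<..<pi}) (\<lambda>x. B\<^sup>2)"
    by (rule integral_mono[OF i c]) (use le in auto)
  also have "\<dots> = B\<^sup>2 * pi"
    by (simp add: measure_restrict_space)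
  also have "\<dots> \<le> B\<^sup>2 * 4" using pi_less_4 by (intro mult_left_mono) auto
  finally have "integral\<^sup>L (lebesgue_on {0<..<pi}) (\<lambda>x. (norm (u x))\<^sup>2) \<le> (2 * B)\<^sup>2"
    by (simp add: power_mult_distrib)
  then show "norm_L2 u \<le> 2 * B"
    unfolding norm_L2_def using B(2) by (intro real_le_lsqrt) auto
qed

lemma continuous_measurable_interval:
  assumes "continuous_on {0..pi} (u :: real \<Rightarrow> complex)"
  shows "u \<in> borel_measurable (lebesgue_on {0<..<pi})"
  by (intro continuous_imp_measurable_on_sets_lebesgue continuous_on_subset[OF assms]) auto

lemma continuous_in_L2:
  assumes "continuous_on {0..pi} u" shows "in_L2 u"
proof -
  obtain B where "B \<ge> 0" "\<And>x. x \<in> {0..pi} \<Longrightarrow> norm (u x) \<le> B"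
    by (rule norm_bounded_on_compact[OF compact_Icc assms]) blast
  then show ?thesis
    by (intro in_L2_bounded(1)[where B = B] continuous_measurable_interval assms) auto
qed

text \<open>Cauchy--Schwarz through
  \<open>norm (f x) \<le> t / 2 + (norm (f x))\<^sup>2 / (2 * t)\<close>, integrated and then taken
  at \<open>t = norm_L2 f\<close>. A vanishing norm is treated separately by letting
  \<open>t\<close> tend to \<open>0\<close>. The \<open>4\<close> is a round bound for
  \<open>pi / 2 + 1 / 2\<close>.\<close>

lemma in_L2_integral_le:
  assumes f: "in_L2 f"
  shows "f absolutely_integrable_on {0..pi}" "integral {0..pi} (\<lambda>x. norm (f x)) \<le> 4 * norm_L2 f"
proof -
  define I where "I = integral\<^sup>L (lebesgue_on {0<..<pi}) (\<lambda>x. (cmod (f x))\<^sup>2)"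
  have I: "I \<ge> 0" by (simp add: I_def)
  have m: "f \<in> borel_measurable (lebesgue_on {0<..<pi})"
    and i2: "integrable (lebesgue_on {0<..<pi}) (\<lambda>x. (cmod (f x))\<^sup>2)" using f by (auto simp: in_L2_def)
  have c: "integrable (lebesgue_on {0<..<pi}) (\<lambda>x. t)" for t :: real
    by (rule finite_measure.integrable_const) (simp add: finite_measure_lebesgue_on)
  have le: "norm (f x) \<le> t / 2 + (norm (f x))\<^sup>2 / (2 * t)" if "t > 0" for t x
    using sum_squares_bound[of t "norm (f x)"] that by (simp add: field_simps power2_eq_square)
  have it: "integrable (lebesgue_on {0<..<pi}) (\<lambda>x. t / 2 + (norm (f x))\<^sup>2 / (2 * t))" for t
    using c i2 by auto
  have i: "integrable (lebesgue_on {0<..<pi}) f"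
  proof (rule Bochner_Integration.integrable_bound[OF it[of 1] m])
    show "AE x in lebesgue_on {0<..<pi}. norm (f x) \<le> norm (1 / 2 + (norm (f x))\<^sup>2 / (2 * 1))"
      using le[of 1] by (intro AE_I2) (simp add: abs_of_nonneg)
  qed
  then have ai: "f absolutely_integrable_on {0<..<pi}"
    by (simp add: integrable_restrict_space set_integrable_def)
  have sp: "negligible {x \<in> {0<..<pi} - {0..pi}. P x}" "negligible {x \<in> {0..pi} - {0<..<pi}. P x}" for P
    by (rule negligible_subset[of "{}"]; auto) (rule negligible_subset[of "{0,pi}"]; auto)
  show fa: "f absolutely_integrable_on {0..pi}"
    by (rule absolutely_integrable_spike_set[OF ai]) (rule sp)+
  have "integral {0..pi} (\<lambda>x. norm (f x)) = integral {0<..<pi} (\<lambda>x. norm (f x))"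
    by (rule integral_spike_set) (rule sp)+
  also have "\<dots> = integral\<^sup>L (lebesgue_on {0<..<pi}) (\<lambda>x. norm (f x))"
    using i by (intro lebesgue_integral_eq_integral[symmetric]) auto
  finally have eq: "integral {0..pi} (\<lambda>x. norm (f x)) = integral\<^sup>L (lebesgue_on {0<..<pi}) (\<lambda>x. norm (f x))" .
  have bound: "integral {0..pi} (\<lambda>x. norm (f x)) \<le> t / 2 * pi + I / (2 * t)" if "t > 0" for t
  proof -
    have "integral {0..pi} (\<lambda>x. norm (f x)) \<le> integral\<^sup>L (lebesgue_on {0<..<pi}) (\<lambda>x. t / 2 + (norm (f x))\<^sup>2 / (2 * t))"
      unfolding eq by (rule integral_mono) (use i it le[OF that] in auto)
    also have "\<dots> = t / 2 * pi + I / (2 * t)"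
      using c i2 by (simp add: I_def measure_restrict_space)
    finally show ?thesis .
  qed
  show "integral {0..pi} (\<lambda>x. norm (f x)) \<le> 4 * norm_L2 f"
  proof (cases "I = 0")
    case True
    have "integral {0..pi} (\<lambda>x. norm (f x)) \<le> 0 + e" if "e > 0" for e
      using bound[of "2 * e / pi"] True that by simp
    then have "integral {0..pi} (\<lambda>x. norm (f x)) \<le> 0" by (rule field_le_epsilon)
    then show ?thesis using True by (simp add: norm_L2_def I_def)
  next
    case False
    define t where "t = norm_L2 f"
    have tI: "t > 0" "I = t * t" using False I by (auto simp: t_def norm_L2_def I_def[symmetric])
    have "integral {0..pi} (\<lambda>x. norm (f x)) \<le> t / 2 * pi + t / 2"
      using bound[OF tI(1)] tI by simp
    also have "\<dots> \<le> t / 2 * 4 + t / 2" using tI pi_less_4 by (intro add_mono mult_left_mono) auto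
    finally show ?thesis using tI by (simp add: t_def)
  qed
qed

text \<open>Translates the operator into boundary value problems. Solutions are continuous and so
  square integrable by themselves; only the condition on \<open>f\<close> survives.\<close>

lemma sl_op_minus_iff:
  "sl_op_minus q \<alpha> \<beta> z u f \<longleftrightarrow> in_L2 f \<and> (\<exists>v. solves q z f u v \<and>
      u 0 * of_real (cos \<alpha>) - v 0 * of_real (sin \<alpha>) = 0 \<and>
      u pi * of_real (cos \<beta>) + v pi * of_real (sin \<beta>) = 0)"
proof
  assume "sl_op_minus q \<alpha> \<beta> z u f"
  then obtain g v where g: "in_L2 u" "in_L2 g" "sl_expr q u v g"
    and bc: "u 0 * of_real (cos \<alpha>) - v 0 * of_real (sin \<alpha>) = 0" "u pi * of_real (cos \<beta>) + v pi * of_real (sin \<beta>) = 0"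
    and ae: "AE x in lebesgue_on {0<..<pi}. f x = g x - z * u x"
    by (auto simp: sl_op_minus_def sl_op_def)
  have "AE x in lebesgue_on {0<..<pi}. g x + (- z) * u x = f x"
    using ae by eventually_elim simp
  then have "in_L2 f" by (rule in_L2_cong_AE[OF in_L2_lincomb[OF g(2,1)]])
  moreover have "solves q z f u v"
  proof -
    have "ac_deriv u v" "ac_deriv v (\<lambda>x. of_real (q x) * u x - g x)" using g(3) by (auto simp: sl_expr_iff)
    note ac = this
    have "AE x in lebesgue_on {0<..<pi}. (of_real (q x) - z) * u x - f x = of_real (q x) * u x - g x"
      using ae by eventually_elim (simp add: algebra_simps)
    then show ?thesis unfolding solves_def by (intro conjI ac(1) ac_deriv_spike[OF ac(2)])
  qed
  ultimately show "in_L2 f \<and> (\<exists>v. solves q z f u v \<and>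
      u 0 * of_real (cos \<alpha>) - v 0 * of_real (sin \<alpha>) = 0 \<and>
      u pi * of_real (cos \<beta>) + v pi * of_real (sin \<beta>) = 0)" using bc by blast
next
  assume "in_L2 f \<and> (\<exists>v. solves q z f u v \<and>
      u 0 * of_real (cos \<alpha>) - v 0 * of_real (sin \<alpha>) = 0 \<and>
      u pi * of_real (cos \<beta>) + v pi * of_real (sin \<beta>) = 0)"
  then obtain v where f: "in_L2 f" and s: "solves q z f u v"
    and bc: "u 0 * of_real (cos \<alpha>) - v 0 * of_real (sin \<alpha>) = 0" "u pi * of_real (cos \<beta>) + v pi * of_real (sin \<beta>) = 0"
    by blast
  have u: "in_L2 u" by (rule continuous_in_L2[OF solves_continuous(1)[OF s]])
  have "sl_op q \<alpha> \<beta> u (\<lambda>x. f x + z * u x)"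
    unfolding sl_op_def using u f s bc in_L2_lincomb by (auto simp: solves_iff_sl_expr)
  then show "sl_op_minus q \<alpha> \<beta> z u f"
    unfolding sl_op_minus_def by (intro exI[of _ "\<lambda>x. f x + z * u x"]) simp
qed

subsection \<open>The characteristic function\<close>

text \<open>The solution satisfying the condition at \<open>0\<close> is inserted into the condition
  at \<open>pi\<close>: a zero says that this solution is an eigenfunction.
  \<open>char_fun_terminal\<close> identifies the value with \<open>\<Delta>\<close> of the
  overview.\<close>

definition char_fun :: "(real \<Rightarrow> real) \<Rightarrow> real \<Rightarrow> real \<Rightarrow> complex \<Rightarrow> complex" where
  "char_fun q \<alpha> \<beta> z =
     of_real (cos \<beta>) * ivp_sol q (of_real (sin \<alpha>)) (of_real (cos \<alpha>)) z pi +
     of_real (sin \<beta>) * ivp_der q (of_real (sin \<alpha>)) (of_real (cos \<alpha>)) z pi"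

lemma char_fun_holomorphic: "potential q \<Longrightarrow> char_fun q \<alpha> \<beta> holomorphic_on UNIV"
  unfolding char_fun_def by (intro holomorphic_intros ivp_holomorphic) auto

text \<open>Compare the Wronskian of the left solution and \<open>u\<close> at both ends: at
  \<open>pi\<close> and at \<open>0\<close> it is minus the corresponding side.\<close>

lemma char_fun_terminal:
  assumes q: "potential q" and s: "solves q z (\<lambda>_. 0) u v"
    and T: "u pi = of_real (sin \<beta>)" "v pi = - of_real (cos \<beta>)"
  shows "char_fun q \<alpha> \<beta> z = of_real (cos \<alpha>) * u 0 - of_real (sin \<alpha>) * v 0"
  using Wronskian_constant[OF sl_ivp(1)[OF q, of z "of_real (sin \<alpha>)" "of_real (cos \<alpha>)"] s, of pi] T
  by (simp add: char_fun_def sl_ivp(2,3)[OF q] algebra_simps)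

text \<open>Any \<open>u\<close> in question is \<open>U + t * y\<close> with the particular
  solution \<open>U\<close> vanishing to first order at \<open>0\<close> and the left solution
  \<open>y\<close>. The condition at \<open>pi\<close> determines \<open>t\<close> after division by
  the characteristic function.\<close>

lemma resolvent_estimate:
  assumes q: "potential q" and nz: "char_fun q \<alpha> \<beta> z \<noteq> 0"
  obtains C where "C \<ge> 0"
    "\<And>u f x. sl_op_minus q \<alpha> \<beta> z u f \<Longrightarrow> 0 \<le> x \<Longrightarrow> x \<le> pi \<Longrightarrow> norm (u x) \<le> C * norm_L2 f"
proof -
  define y where "y = ivp_sol q (of_real (sin \<alpha>)) (of_real (cos \<alpha>)) z"
  define y' where "y' = ivp_der q (of_real (sin \<alpha>)) (of_real (cos \<alpha>)) z"
  have y: "solves q z (\<lambda>_. 0) y y'" unfolding y_def y'_def by (rule sl_ivp(1)[OF q])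
  obtain Y where Y0: "Y \<ge> 0" and "\<And>x. x \<in> {0..pi} \<Longrightarrow> norm (y x) \<le> Y"
    by (rule norm_bounded_on_compact[OF compact_Icc solves_continuous(1)[OF y]]) blast
  then have Y: "\<And>x. 0 \<le> x \<Longrightarrow> x \<le> pi \<Longrightarrow> norm (y x) \<le> Y" by simp
  obtain C where C: "C > 0"
    "\<And>z' f u v x. norm z' \<le> norm z \<Longrightarrow> f absolutely_integrable_on {0..pi} \<Longrightarrow> solves q z' f u v \<Longrightarrow> 0 \<le> x \<Longrightarrow> x \<le> pi \<Longrightarrow>
      norm (u x) + norm (v x) \<le> C * (norm (u 0) + norm (v 0) + integral {0..pi} (\<lambda>t. norm (f t)))"
    by (rule solves_bound[OF q, of "norm z"]) blast
  define \<Delta> where "\<Delta> = char_fun q \<alpha> \<beta> z"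
  have "norm (u x) \<le> (4 * C * (1 + Y / norm \<Delta>)) * norm_L2 f"
    if op: "sl_op_minus q \<alpha> \<beta> z u f" and x: "0 \<le> x" "x \<le> pi" for u f x
  proof -
    from op obtain v where f: "in_L2 f" and s: "solves q z f u v"
      and bc: "u 0 * of_real (cos \<alpha>) - v 0 * of_real (sin \<alpha>) = 0" "u pi * of_real (cos \<beta>) + v pi * of_real (sin \<beta>) = 0"
      unfolding sl_op_minus_iff by blast
    define n where "n = 4 * C * norm_L2 f"
    obtain U V where U: "solves q z f U V" "U 0 = 0" "V 0 = 0"
      by (rule solves_exists[OF q in_L2_integral_le(1)[OF f]])
    have UV: "norm (U x) + norm (V x) \<le> n" if "0 \<le> x" "x \<le> pi" for x
    proof -
      have "norm (U x) + norm (V x) \<le> C * integral {0..pi} (\<lambda>t. norm (f t))"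
        using C(2)[OF order_refl in_L2_integral_le(1)[OF f] U(1) that] U(2,3) by simp
      also have "\<dots> \<le> C * (4 * norm_L2 f)"
        using in_L2_integral_le(2)[OF f] C(1) by (intro mult_left_mono) auto
      finally show ?thesis by (simp add: n_def)
    qed
    \<comment> \<open>The condition at \<open>0\<close> makes \<open>(u 0, v 0)\<close> a multiple
      of the unit vector \<open>(sin \<alpha>, cos \<alpha>)\<close>; \<open>t\<close> is that
      multiple.\<close>
    define t where "t = u 0 * of_real (sin \<alpha>) + v 0 * of_real (cos \<alpha>)"
    have sc: "of_real (sin \<alpha>) * of_real (sin \<alpha>) + of_real (cos \<alpha>) * of_real (cos \<alpha>) = (1::complex)"
      by (metis of_real_1 of_real_add of_real_mult power2_eq_square sin_cos_squared_add)
    have "u 0 = u 0 * (of_real (sin \<alpha>) * of_real (sin \<alpha>) + of_real (cos \<alpha>) * of_real (cos \<alpha>))"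
      "v 0 = v 0 * (of_real (sin \<alpha>) * of_real (sin \<alpha>) + of_real (cos \<alpha>) * of_real (cos \<alpha>))"
      by (simp_all only: sc mult_1_right)
    then have uv0: "u 0 = t * of_real (sin \<alpha>)" "v 0 = t * of_real (cos \<alpha>)"
      using bc(1) unfolding t_def by (algebra)+
    have w: "solves q z (\<lambda>_. 0) (\<lambda>x. 1 * u x + (-1) * U x) (\<lambda>x. 1 * v x + (-1) * V x)"
      using solves_lincomb[OF s U(1), of 1 "-1"] by simp
    have "solves q z (\<lambda>_. 0) (\<lambda>x. t * y x + 0 * y x) (\<lambda>x. t * y' x + 0 * y' x)"
      by (rule solves_lincomb_homogeneous[OF y y])
    then have ty: "solves q z (\<lambda>_. 0) (\<lambda>x. t * y x) (\<lambda>x. t * y' x)" by simp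
    have eq: "u x = U x + t * y x" "v x = V x + t * y' x" if "0 \<le> x" "x \<le> pi" for x
      using solves_unique[OF q w ty _ _ that] U(2,3) uv0
      by (simp_all add: y_def y'_def sl_ivp(2,3)[OF q] algebra_simps)
    have "t * \<Delta> = - (U pi * of_real (cos \<beta>) + V pi * of_real (sin \<beta>))"
      using bc(2) eq[of pi] by (simp add: \<Delta>_def char_fun_def flip: y_def y'_def) algebra
    then have "norm t * norm \<Delta> = norm (U pi * of_real (cos \<beta>) + V pi * of_real (sin \<beta>))"
      by (metis norm_minus_cancel norm_mult)
    also have "\<dots> \<le> norm (U pi) * 1 + norm (V pi) * 1"
      by (rule order_trans[OF norm_triangle_ineq]) (auto simp: norm_mult intro!: add_mono mult_left_le)
    also have "\<dots> \<le> n" using UV[of pi] by simp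
    finally have t: "norm t \<le> n / norm \<Delta>" using nz by (simp add: \<Delta>_def field_simps)
    have "norm (u x) \<le> norm (U x) + norm t * norm (y x)"
      unfolding eq(1)[OF x] by (rule order_trans[OF norm_triangle_ineq]) (simp add: norm_mult)
    also have "\<dots> \<le> n + n / norm \<Delta> * Y"
    proof (intro add_mono mult_mono t Y x)
      show "norm (U x) \<le> n" using UV[OF x] norm_ge_zero[of "V x"] by linarith
    qed (use order_trans[OF norm_ge_zero t] in auto)
    finally show ?thesis by (simp add: n_def algebra_simps)
  qed
  moreover have "4 * C * (1 + Y / norm \<Delta>) \<ge> 0" using C(1) Y0 by simp
  ultimately show thesis using that by blast
qed

text \<open>Injectivity in the resolvent set is stated up to null sets. If the solution vanished
  almost everywhere, so would \<open>v'\<close>, and the solution would be the affine function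
  \<open>c + d x\<close>, which has at most one zero.\<close>

lemma ivp_not_AE_zero:
  assumes q: "potential q" and cd: "c \<noteq> 0 \<or> d \<noteq> 0"
  shows "\<not> (AE x in lebesgue_on {0<..<pi}. ivp_sol q c d z x = 0)"
proof
  assume ae: "AE x in lebesgue_on {0<..<pi}. ivp_sol q c d z x = 0"
  have s: "ac_deriv (ivp_sol q c d z) (ivp_der q c d z)"
    "ac_deriv (ivp_der q c d z) (\<lambda>x. (of_real (q x) - z) * ivp_sol q c d z x - 0)"
    using sl_ivp(1)[OF q, of z c d] by (auto simp: solves_def)
  have "AE x in lebesgue_on {0<..<pi}. 0 = (of_real (q x) - z) * ivp_sol q c d z x - 0"
    using ae by eventually_elim simp
  from ac_deriv_spike[OF s(2) this] have d': "ac_deriv (ivp_der q c d z) (\<lambda>x. 0)" .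
  have d: "ivp_der q c d z x = d" if "0 \<le> x" "x \<le> pi" for x
    using ac_deriv_eq[OF d' that] by (simp add: sl_ivp(3)[OF q])
  have lin: "ivp_sol q c d z x = c + of_real x * d" if "0 \<le> x" "x \<le> pi" for x
  proof -
    have "integral {0..x} (ivp_der q c d z) = integral {0..x} (\<lambda>_. d)"
      by (rule integral_cong) (use d that in auto)
    then show ?thesis using ac_deriv_eq[OF s(1) that] that by (simp add: sl_ivp(2)[OF q] scaleR_conv_of_real)
  qed
  have N: "negligible {x \<in> {0..pi}. ivp_sol q c d z x \<noteq> 0}" by (rule AE_interval_negligible[OF ae])
  \<comment> \<open>The only candidate for a real zero of \<open>c + d x\<close>. For
    \<open>d = 0\<close> the quotient is \<open>0\<close> by convention, and then
    \<open>c \<noteq> 0\<close> excludes zeros.\<close>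
  define x0 where "x0 = Re (- c / d)"
  have "{0..pi} \<subseteq> {x \<in> {0..pi}. ivp_sol q c d z x \<noteq> 0} \<union> {x0}"
  proof
    fix x assume x: "x \<in> {0..pi}"
    have "x = x0" if "c + of_real x * d = 0"
    proof -
      have "d \<noteq> 0" using that cd by auto
      moreover have "of_real x * d = - c" using that by (simp add: eq_neg_iff_add_eq_0 add.commute)
      ultimately have "of_real x = - c / d" by (simp add: field_simps)
      then show ?thesis by (metis Re_complex_of_real x0_def)
    qed
    then show "x \<in> {x \<in> {0..pi}. ivp_sol q c d z x \<noteq> 0} \<union> {x0}" using x lin[of x] by auto
  qed
  moreover have "negligible ({x \<in> {0..pi}. ivp_sol q c d z x \<noteq> 0} \<union> {x0})"
    using N by (intro negligible_Un) auto
  ultimately have "negligible {0..pi}" by (rule negligible_subset[rotated])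
  then have "negligible (cbox 0 pi)" by simp
  then show False unfolding negligible_interval(1) using pi_gt_zero by auto
qed

text \<open>At a zero the left solution is an eigenfunction. Elsewhere a multiple of it corrects a
  particular solution to satisfy the condition at \<open>pi\<close>, and
  \<open>resolvent_estimate\<close> yields injectivity and the bounded inverse.\<close>

theorem sl_spectrum_eq:
  assumes q: "potential q"
  shows "sl_spectrum q \<alpha> \<beta> = {z. char_fun q \<alpha> \<beta> z = 0}"
proof -
  define y where "y = (\<lambda>z. ivp_sol q (of_real (sin \<alpha>)) (of_real (cos \<alpha>)) z)"
  define y' where "y' = (\<lambda>z. ivp_der q (of_real (sin \<alpha>)) (of_real (cos \<alpha>)) z)"
  have y: "solves q z (\<lambda>_. 0) (y z) (y' z)" for z unfolding y_def y'_def by (rule sl_ivp(1)[OF q])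
  have y0: "y z 0 = of_real (sin \<alpha>)" "y' z 0 = of_real (cos \<alpha>)" for z
    unfolding y_def y'_def by (rule sl_ivp(2,3)[OF q])+
  have \<Delta>: "char_fun q \<alpha> \<beta> z = of_real (cos \<beta>) * y z pi + of_real (sin \<beta>) * y' z pi" for z
    by (simp add: char_fun_def y_def y'_def)
  have "z \<notin> sl_resolvent_set q \<alpha> \<beta>" if "char_fun q \<alpha> \<beta> z = 0" for z
  proof
    assume "z \<in> sl_resolvent_set q \<alpha> \<beta>"
    moreover have "in_L2 (\<lambda>_. 0)" by (rule continuous_in_L2) simp
    then have "sl_op_minus q \<alpha> \<beta> z (y z) (\<lambda>_. 0)"
      unfolding sl_op_minus_iff using y[of z] y0[of z] that by (auto simp: \<Delta> mult.commute intro!: exI[of _ "y' z"])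
    ultimately have "AE x in lebesgue_on {0<..<pi}. y z x = 0" by (auto simp: sl_resolvent_set_def)
    moreover have "complex_of_real (sin \<alpha>) \<noteq> 0 \<or> complex_of_real (cos \<alpha>) \<noteq> 0"
      using sin_cos_squared_add[of \<alpha>] by (metis add_0 of_real_eq_0_iff power_zero_numeral zero_neq_one)
    ultimately show False using ivp_not_AE_zero[OF q] by (auto simp: y_def)
  qed
  moreover have "z \<in> sl_resolvent_set q \<alpha> \<beta>" if nz: "char_fun q \<alpha> \<beta> z \<noteq> 0" for z
  proof -
    obtain C where C: "C \<ge> 0"
      "\<And>u f x. sl_op_minus q \<alpha> \<beta> z u f \<Longrightarrow> 0 \<le> x \<Longrightarrow> x \<le> pi \<Longrightarrow> norm (u x) \<le> C * norm_L2 f"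
      by (rule resolvent_estimate[OF q nz]) blast
    have "\<exists>u. sl_op_minus q \<alpha> \<beta> z u f" if f: "in_L2 f" for f
    proof -
      obtain U V where U: "solves q z f U V" "U 0 = 0" "V 0 = 0"
        by (rule solves_exists[OF q in_L2_integral_le(1)[OF f]])
      define t where "t = - (of_real (cos \<beta>) * U pi + of_real (sin \<beta>) * V pi) / char_fun q \<alpha> \<beta> z"
      have t: "t * char_fun q \<alpha> \<beta> z = - (of_real (cos \<beta>) * U pi + of_real (sin \<beta>) * V pi)"
        using nz by (simp add: t_def)
      have "solves q z f (\<lambda>x. 1 * U x + t * y z x) (\<lambda>x. 1 * V x + t * y' z x)"
        using solves_lincomb[OF U(1) y, of 1 t] by simp
      moreover have "(1 * U 0 + t * y z 0) * of_real (cos \<alpha>) - (1 * V 0 + t * y' z 0) * of_real (sin \<alpha>) = 0"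
        by (simp add: U y0)
      moreover have "(1 * U pi + t * y z pi) * of_real (cos \<beta>) + (1 * V pi + t * y' z pi) * of_real (sin \<beta>) = 0"
        using t unfolding \<Delta> by (simp add: algebra_simps)
      ultimately show ?thesis unfolding sl_op_minus_iff using f by blast
    qed
    moreover have "AE x in lebesgue_on {0<..<pi}. u x = 0" if "sl_op_minus q \<alpha> \<beta> z u (\<lambda>_. 0)" for u
    proof -
      have "u x = 0" if "0 \<le> x" "x \<le> pi" for x
        using C(2)[OF \<open>sl_op_minus q \<alpha> \<beta> z u (\<lambda>_. 0)\<close> that] by (simp add: norm_L2_def)
      then show ?thesis by (intro AE_I2) auto
    qed
    moreover have "norm_L2 u \<le> 2 * C * norm_L2 f" if op: "sl_op_minus q \<alpha> \<beta> z u f" for u f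
    proof -
      obtain v where "solves q z f u v" using op by (auto simp: sl_op_minus_iff)
      then have "u \<in> borel_measurable (lebesgue_on {0<..<pi})"
        using continuous_measurable_interval solves_continuous(1) by blast
      moreover have "C * norm_L2 f \<ge> 0" using C(2)[OF op, of 0] order_trans[OF norm_ge_zero] by simp
      ultimately have "norm_L2 u \<le> 2 * (C * norm_L2 f)"
        using C(2)[OF op] by (intro in_L2_bounded(2)) auto
      then show ?thesis by simp
    qed
    ultimately show ?thesis unfolding sl_resolvent_set_def by blast
  qed
  ultimately show ?thesis by (auto simp: sl_spectrum_def)
qed

section \<open>Terminal solutions and the quotient form of the \<open>m\<close>-function\<close>

lemma terminal_solution:
  fixes z :: complex and \<beta> :: real
  assumes q: "potential q"
  defines "U \<equiv> ivp_sol (\<lambda>x. q (pi - x)) (of_real (sin \<beta>)) (of_real (cos \<beta>)) z"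
    and "V \<equiv> ivp_der (\<lambda>x. q (pi - x)) (of_real (sin \<beta>)) (of_real (cos \<beta>)) z"
  shows "solves q z (\<lambda>_. 0) (\<lambda>x. U (pi - x)) (\<lambda>x. - V (pi - x))"
    "U (pi - pi) = of_real (sin \<beta>)" "- V (pi - pi) = - of_real (cos \<beta>)"
  using solves_reflect[OF sl_ivp(1)[OF potential_reflect[OF q], of z "of_real (sin \<beta>)" "of_real (cos \<beta>)"]]
    sl_ivp(2,3)[OF potential_reflect[OF q], of "of_real (sin \<beta>)" "of_real (cos \<beta>)" z]
  by (simp_all add: U_def V_def)

lemma sl_sol:
  assumes q: "potential q"
  obtains u v where "sl_sol q \<beta> z = (u, v)" "solves q z (\<lambda>_. 0) u v"
    "u pi = of_real (sin \<beta>)" "v pi = - of_real (cos \<beta>)"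
proof -
  define P where "P = (\<lambda>(u, v). sl_expr q u v (\<lambda>x. z * u x) \<and> u pi = complex_of_real (sin \<beta>) \<and> v pi = - complex_of_real (cos \<beta>))"
  have "\<exists>p. P p"
    using terminal_solution[OF q, where \<beta> = \<beta> and z = z] unfolding P_def solves_iff_sl_expr by fastforce
  then have "P (sl_sol q \<beta> z)" unfolding sl_sol_def P_def[symmetric] by (rule someI_ex)
  then show thesis using that by (cases "sl_sol q \<beta> z") (auto simp: P_def solves_iff_sl_expr)
qed

text \<open>\<open>char_fun_terminal\<close> holds for every pair with these terminal values, hence
  for the one that the choice in \<open>sl_sol\<close> returns.\<close>

lemma m_fun_eq:
  assumes q: "potential q"
  shows "m_fun q \<alpha>1 \<alpha>2 \<beta> z = char_fun q \<alpha>1 \<beta> z / char_fun q \<alpha>2 \<beta> z / of_real (sin (\<alpha>2 - \<alpha>1))"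
proof -
  obtain u v where uv: "sl_sol q \<beta> z = (u, v)" "solves q z (\<lambda>_. 0) u v"
    "u pi = of_real (sin \<beta>)" "v pi = - of_real (cos \<beta>)" by (rule sl_sol[OF q])
  show ?thesis
    unfolding m_fun_def uv(1) char_fun_terminal[OF q uv(2-4)] by (simp add: mult.commute)
qed

text \<open>With \<open>\<kappa> = csqrt (- z)\<close> the exponential growth in
  \<open>\<kappa>\<close> is growth of order \<open>1/2\<close> in \<open>z\<close>. In the exponent
  \<open>5 = 4 + 1\<close>: the \<open>4\<close> bounds \<open>pi\<close>, the \<open>1\<close> pays
  for a factor \<open>norm \<kappa>\<close>.\<close>

lemma solves_growth:
  assumes q: "potential q" and s: "solves q z (\<lambda>_. 0) u v"
    and z: "norm z \<ge> max 1 ((2 * pot_norm q)\<^sup>2)" and x: "0 \<le> x" "x \<le> pi"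
  shows "norm (u x) + norm (v x) \<le> 7 * (norm (u 0) + norm (v 0)) * exp (5 * sqrt (norm z))"
proof -
  define \<kappa> where "\<kappa> = csqrt (- z)"
  have \<kappa>2: "- (\<kappa>\<^sup>2) = z" by (simp add: \<kappa>_def)
  have nk: "norm \<kappa> = sqrt (norm z)" using \<kappa>2 by (metis norm_minus_cancel norm_power norm_ge_zero real_sqrt_unique)
  have k1: "norm \<kappa> \<ge> 1" using z by (simp add: nk)
  have k2: "norm \<kappa> \<ge> 2 * pot_norm q" unfolding nk by (rule real_le_rsqrt) (use z in simp)
  have Re: "Re \<kappa> \<ge> 0" by (simp add: \<kappa>_def Re_csqrt complex_Re_le_cmod)
  define p0 where "p0 = v 0 + \<kappa> * u 0"
  define r0 where "r0 = v 0 - \<kappa> * u 0"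
  define A where "A = norm p0 + norm r0"
  define N where "N = norm (u 0) + norm (v 0)"
  define E where "E = exp (Re \<kappa> * x)"
  have \<kappa>0: "\<kappa> \<noteq> 0" using k1 by auto
  note est = solution_estimate[OF q, of \<kappa>, unfolded \<kappa>2, OF s Re \<kappa>0 k2 x, folded p0_def r0_def, folded A_def]
  have A: "A \<ge> 0" by (simp add: A_def)
  have "A \<le> 2 * (norm (v 0) + norm \<kappa> * norm (u 0))"
    using norm_triangle_ineq[of "v 0" "\<kappa> * u 0"] norm_triangle_ineq4[of "v 0" "\<kappa> * u 0"]
    by (simp add: A_def p0_def r0_def norm_mult)
  also have "\<dots> \<le> 2 * (norm \<kappa> * norm (v 0) + norm \<kappa> * norm (u 0))"
    using mult_right_mono[OF k1, of "norm (v 0)"] by simp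
  finally have A_le: "A \<le> 2 * norm \<kappa> * N" by (simp add: N_def algebra_simps)
  have ku: "norm \<kappa> * norm (u x) \<le> A * E" using est(1) by (simp add: E_def)
  have u: "norm (u x) \<le> A * E"
    using ku mult_right_mono[OF k1, of "norm (u x)"] by simp
  have "pot_norm q * A / norm \<kappa> \<le> A / 2"
  proof -
    have "pot_norm q * A / norm \<kappa> \<le> (norm \<kappa> * (A / 2)) / norm \<kappa>"
      using mult_right_mono[OF k2 A] by (intro divide_right_mono) auto
    then show ?thesis using \<kappa>0 by simp
  qed
  then have "norm (exp (- \<kappa> * x) * (v x + \<kappa> * u x) - p0) \<le> A / 2" by (rule order_trans[OF est(2)])
  then have "norm (exp (- \<kappa> * x) * (v x + \<kappa> * u x)) \<le> A / 2 + norm p0"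
    using norm_triangle_ineq2[of "exp (- \<kappa> * x) * (v x + \<kappa> * u x)" p0] by simp
  then have "norm (exp (- \<kappa> * x) * (v x + \<kappa> * u x)) \<le> 3/2 * A"
  proof (rule order_trans)
    have "norm p0 \<le> A" by (simp add: A_def)
    then show "A / 2 + norm p0 \<le> 3/2 * A" by simp
  qed
  moreover have "norm (exp (- \<kappa> * x) * (v x + \<kappa> * u x)) = norm (v x + \<kappa> * u x) / E"
    unfolding norm_mult norm_exp_eq_Re by (simp add: E_def exp_minus divide_inverse mult.commute)
  moreover have "E > 0" by (simp add: E_def)
  ultimately have "norm (v x + \<kappa> * u x) \<le> 3/2 * A * E"
    by (simp add: pos_divide_le_eq)
  then have "norm (v x) \<le> 3/2 * A * E + A * E"
    using norm_triangle_ineq4[of "v x + \<kappa> * u x" "\<kappa> * u x"] ku by (simp add: norm_mult)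
  then have "norm (u x) + norm (v x) \<le> 7/2 * A * E" using u by simp
  also have "\<dots> \<le> 7/2 * (2 * norm \<kappa> * N) * E"
    using A_le by (intro mult_right_mono mult_left_mono) (auto simp: E_def)
  also have "\<dots> = 7 * N * (norm \<kappa> * E)" by simp
  also have "\<dots> \<le> 7 * N * (exp (norm \<kappa>) * exp (4 * norm \<kappa>))"
  proof (intro mult_left_mono mult_mono)
    show "norm \<kappa> \<le> exp (norm \<kappa>)" using exp_ge_add_one_self[of "norm \<kappa>"] by linarith
    have "Re \<kappa> * x \<le> norm \<kappa> * 4"
      using complex_Re_le_cmod[of \<kappa>] x Re pi_less_4 by (intro mult_mono) auto
    then show "E \<le> exp (4 * norm \<kappa>)" by (simp add: E_def mult.commute)
  qed (auto simp: N_def E_def)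
  also have "\<dots> = 7 * N * exp (5 * norm \<kappa>)" by (simp flip: exp_add)
  finally show ?thesis by (simp add: N_def nk)
qed


text \<open>Cramer's rule: \<open>sin (\<alpha>2 - \<alpha>1)\<close> is the determinant of the two
  boundary forms.\<close>

lemma initial_values_of_char_fun:
  fixes \<alpha>1 \<alpha>2 :: real and x y :: complex
  assumes "sin (\<alpha>2 - \<alpha>1) \<noteq> 0"
    and "of_real (cos \<alpha>1) * x - of_real (sin \<alpha>1) * y = 0" "of_real (cos \<alpha>2) * x - of_real (sin \<alpha>2) * y = 0"
  shows "x = 0" "y = 0"
proof -
  have s: "complex_of_real (sin (\<alpha>2 - \<alpha>1)) \<noteq> 0" using assms(1) by (simp only: of_real_eq_0_iff not_False_eq_True)
  have d: "complex_of_real (sin (\<alpha>2 - \<alpha>1)) = of_real (sin \<alpha>2) * of_real (cos \<alpha>1) - of_real (cos \<alpha>2) * of_real (sin \<alpha>1)"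
    by (simp add: sin_diff)
  have "of_real (sin (\<alpha>2 - \<alpha>1)) * x = 0" "of_real (sin (\<alpha>2 - \<alpha>1)) * y = 0"
    unfolding d using assms(2,3) by algebra+
  then show "x = 0" "y = 0" using s by auto
qed

lemma terminal_solution_initial_nonzero:
  assumes q: "potential q" and s: "solves q z (\<lambda>_. 0) u v"
    and T: "u pi = of_real (sin \<beta>)" "v pi = - of_real (cos \<beta>)"
  shows "u 0 \<noteq> 0 \<or> v 0 \<noteq> 0"
proof (rule ccontr)
  assume "\<not> (u 0 \<noteq> 0 \<or> v 0 \<noteq> 0)"
  then have uv: "u 0 = 0" "v 0 = 0" by auto
  have z: "solves q z (\<lambda>_. 0) (\<lambda>_. 0) (\<lambda>_. 0)"
    using solves_lincomb_homogeneous[OF s s, of 0 0] by simp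
  have "u pi = 0" "v pi = 0" using solves_unique[OF q s z uv, of pi] by auto
  then show False using T sin_cos_squared_add[of \<beta>] by (metis add_0 neg_equal_0_iff_equal of_real_eq_0_iff power_zero_numeral zero_neq_one)
qed

text \<open>At a common zero the terminal solution would have zero initial values and be trivial,
  against its values at \<open>pi\<close>.\<close>

lemma char_fun_no_common_zero:
  assumes q: "potential q" and sin: "sin (\<alpha>2 - \<alpha>1) \<noteq> 0"
    and z: "char_fun q \<alpha>1 \<beta> z = 0"
  shows "char_fun q \<alpha>2 \<beta> z \<noteq> 0"
proof
  assume "char_fun q \<alpha>2 \<beta> z = 0"
  obtain u v where uv: "solves q z (\<lambda>_. 0) u v" "u pi = of_real (sin \<beta>)" "v pi = - of_real (cos \<beta>)"
    by (rule sl_sol[OF q])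
  have e1: "of_real (cos \<alpha>1) * u 0 - of_real (sin \<alpha>1) * v 0 = 0"
    using z unfolding char_fun_terminal[OF q uv] .
  have e2: "of_real (cos \<alpha>2) * u 0 - of_real (sin \<alpha>2) * v 0 = 0"
    using \<open>char_fun q \<alpha>2 \<beta> z = 0\<close> unfolding char_fun_terminal[OF q uv] .
  have "u 0 = 0" "v 0 = 0"
    by (rule initial_values_of_char_fun[OF sin e1 e2])+
  then show False using terminal_solution_initial_nonzero[OF q uv] by simp
qed

subsection \<open>Herglotz integrals\<close>

text \<open>The kernel is \<open>(1 + t z) / ((t - z) (1 + t\<^sup>2))\<close>. Writing
  \<open>t = w + z\<close> splits \<open>(1 + t z) / w\<close> into
  \<open>(1 + z\<^sup>2) / w + z\<close>, which is bounded uniformly in \<open>t\<close>.\<close>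

lemma Herglotz_kernel_bound:
  fixes z :: complex and t :: real
  assumes "Im z \<noteq> 0"
  shows "norm (1 / (of_real t - z) - of_real (t / (1 + t\<^sup>2))) \<le> 2 * (1 + (norm z)\<^sup>2) / \<bar>Im z\<bar> * (1 / (1 + t\<^sup>2))"
proof -
  have nz: "of_real t - z \<noteq> 0" using assms by (auto simp: complex_eq_iff)
  have pos: "1 + t\<^sup>2 > 0" by (simp add: add_pos_nonneg)
  then have pos': "complex_of_real (1 + t\<^sup>2) \<noteq> 0" using of_real_eq_0_iff by (metis less_irrefl)
  define w where "w = of_real t - z"
  have w: "w \<noteq> 0" "\<bar>Im z\<bar> \<le> norm w" using nz abs_Im_le_cmod[of w] by (auto simp: w_def)
  have t: "of_real t = w + z" by (simp add: w_def)
  have "1 / w - of_real (t / (1 + t\<^sup>2)) = (of_real (1 + t\<^sup>2) - of_real t * w) / (w * of_real (1 + t\<^sup>2))"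
    using w pos' by (simp add: field_simps)
  also have "of_real (1 + t\<^sup>2) - of_real t * w = (1 + z\<^sup>2) + z * w"
    unfolding of_real_add of_real_power t by (simp add: power2_eq_square algebra_simps)
  finally have "norm (1 / w - of_real (t / (1 + t\<^sup>2))) = norm ((1 + z\<^sup>2) + z * w) / norm w / (1 + t\<^sup>2)"
    using pos by (simp add: norm_divide norm_mult del: of_real_add of_real_power)
  also have "norm ((1 + z\<^sup>2) + z * w) / norm w \<le> 2 * (1 + (norm z)\<^sup>2) / \<bar>Im z\<bar>"
  proof -
    have "norm ((1 + z\<^sup>2) + z * w) \<le> (1 + (norm z)\<^sup>2) + norm z * norm w"
      by (rule order_trans[OF norm_triangle_ineq])
        (use norm_triangle_ineq[of 1 "z\<^sup>2"] in \<open>simp add: norm_mult norm_power\<close>)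
    then have "norm ((1 + z\<^sup>2) + z * w) / norm w \<le> ((1 + (norm z)\<^sup>2) + norm z * norm w) / norm w"
      by (rule divide_right_mono) simp
    also have "\<dots> = (1 + (norm z)\<^sup>2) / norm w + norm z" using w by (simp add: add_divide_distrib)
    also have "\<dots> \<le> (1 + (norm z)\<^sup>2) / \<bar>Im z\<bar> + (1 + (norm z)\<^sup>2) / \<bar>Im z\<bar>"
    proof (rule add_mono)
      show "(1 + (norm z)\<^sup>2) / norm w \<le> (1 + (norm z)\<^sup>2) / \<bar>Im z\<bar>"
        using w assms by (intro divide_left_mono) auto
      have "norm z * \<bar>Im z\<bar> \<le> norm z * norm z" using abs_Im_le_cmod by (intro mult_left_mono) auto
      then show "norm z \<le> (1 + (norm z)\<^sup>2) / \<bar>Im z\<bar>"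
        using assms by (simp add: pos_le_divide_eq power2_eq_square)
    qed
    finally show ?thesis by simp
  qed
  finally show ?thesis using pos by (simp add: w_def divide_right_mono)
qed

lemma Herglotz_kernel_Im:
  fixes z :: complex and t :: real
  shows "Im (1 / (of_real t - z) - of_real (t / (1 + t\<^sup>2))) = Im z / (norm (of_real t - z))\<^sup>2"
  unfolding cmod_power2 by (simp add: Im_divide)

text \<open>The counterpart from below, with the same weight \<open>1 / (1 + t\<^sup>2)\<close>; it
  is the source of the bound for the inverse of the \<open>m\<close>-function.\<close>

lemma Herglotz_kernel_Im_bound:
  fixes z :: complex and t :: real
  assumes "Im z \<noteq> 0"
  shows "1 / (2 * (1 + (norm z)\<^sup>2)) * (1 / (1 + t\<^sup>2)) \<le> 1 / (norm (of_real t - z))\<^sup>2"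
proof -
  have nz: "of_real t - z \<noteq> 0" using assms by (auto simp: complex_eq_iff)
  have "(norm (of_real t - z))\<^sup>2 \<le> (\<bar>t\<bar> + norm z)\<^sup>2"
    using norm_triangle_ineq4[of "of_real t" z] by (intro power_mono) auto
  also have "\<dots> \<le> 2 * t\<^sup>2 + 2 * (norm z)\<^sup>2"
    using sum_squares_bound[of "\<bar>t\<bar>" "norm z"] by (simp add: power2_sum)
  also have "\<dots> \<le> 2 * (1 + (norm z)\<^sup>2) * (1 + t\<^sup>2)"
    by (simp add: algebra_simps)
  finally have "(norm (of_real t - z))\<^sup>2 \<le> 2 * (1 + (norm z)\<^sup>2) * (1 + t\<^sup>2)" .
  then have "1 / (2 * (1 + (norm z)\<^sup>2) * (1 + t\<^sup>2)) \<le> 1 / (norm (of_real t - z))\<^sup>2"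
    using nz by (intro divide_left_mono) (auto intro!: mult_pos_pos add_pos_nonneg)
  then show ?thesis by simp
qed

definition Herglotz_integral :: "real measure \<Rightarrow> complex \<Rightarrow> complex" where
  "Herglotz_integral \<mu> z = integral\<^sup>L \<mu> (\<lambda>t. 1 / (of_real t - z) - of_real (t / (1 + t\<^sup>2)))"

context
  fixes \<mu> :: "real measure"
  assumes sets: "sets \<mu> = sets borel" and int: "integrable \<mu> (\<lambda>t. 1 / (1 + t\<^sup>2))"
begin

lemma Herglotz_kernel_measurable:
  "(\<lambda>t. 1 / (complex_of_real t - z) - of_real (t / (1 + t\<^sup>2))) \<in> borel_measurable \<mu>"
proof -
  have "(\<lambda>t. 1 / (complex_of_real t - z) - of_real (t / (1 + t\<^sup>2))) \<in> borel_measurable borel"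
    by measurable
  then show ?thesis using measurable_cong_sets[OF sets refl] by blast
qed

lemma Herglotz_kernel_integrable:
  assumes "Im z \<noteq> 0"
  shows "integrable \<mu> (\<lambda>t. 1 / (complex_of_real t - z) - of_real (t / (1 + t\<^sup>2)))"
proof (rule Bochner_Integration.integrable_bound)
  show "integrable \<mu> (\<lambda>t. 2 * (1 + (norm z)\<^sup>2) / \<bar>Im z\<bar> * (1 / (1 + t\<^sup>2)))"
    by (rule integrable_mult_right[OF int])
  show "AE t in \<mu>. norm (1 / (complex_of_real t - z) - of_real (t / (1 + t\<^sup>2))) \<le> norm (2 * (1 + (norm z)\<^sup>2) / \<bar>Im z\<bar> * (1 / (1 + t\<^sup>2)))"
    by (intro AE_I2 order_trans[OF Herglotz_kernel_bound[OF assms]]) simp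
qed (rule Herglotz_kernel_measurable)

lemma Herglotz_integral_bound:
  assumes "Im z \<noteq> 0"
  shows "norm (Herglotz_integral \<mu> z) \<le> 2 * (1 + (norm z)\<^sup>2) / \<bar>Im z\<bar> * integral\<^sup>L \<mu> (\<lambda>t. 1 / (1 + t\<^sup>2))"
proof -
  have "norm (Herglotz_integral \<mu> z) \<le> integral\<^sup>L \<mu> (\<lambda>t. 2 * (1 + (norm z)\<^sup>2) / \<bar>Im z\<bar> * (1 / (1 + t\<^sup>2)))"
    unfolding Herglotz_integral_def
    by (rule Bochner_Integration.integral_norm_bound_integral[OF Herglotz_kernel_integrable[OF assms]
      integrable_mult_right[OF int] Herglotz_kernel_bound[OF assms]])
  also have "\<dots> = 2 * (1 + (norm z)\<^sup>2) / \<bar>Im z\<bar> * integral\<^sup>L \<mu> (\<lambda>t. 1 / (1 + t\<^sup>2))"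
    by (rule integral_mult_right_zero)
  finally show ?thesis .
qed

text \<open>The integrand has an imaginary part of constant sign, so nothing cancels and the
  pointwise lower bound integrates.\<close>

lemma Herglotz_integral_Im:
  assumes "Im z \<noteq> 0"
  shows "\<bar>Im (Herglotz_integral \<mu> z)\<bar> \<ge> \<bar>Im z\<bar> / (2 * (1 + (norm z)\<^sup>2)) * integral\<^sup>L \<mu> (\<lambda>t. 1 / (1 + t\<^sup>2))"
proof -
  have i: "integrable \<mu> (\<lambda>t. Im z * (1 / (norm (of_real t - z))\<^sup>2))"
    using integrable_Im[OF Herglotz_kernel_integrable[OF assms]] unfolding Herglotz_kernel_Im by simp
  have i': "integrable \<mu> (\<lambda>t. 1 / (norm (of_real t - z))\<^sup>2)"
    using integrable_mult_right[OF i, of "1 / Im z"] assms by simp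
  have "Im (Herglotz_integral \<mu> z) = integral\<^sup>L \<mu> (\<lambda>t. Im z * (1 / (norm (of_real t - z))\<^sup>2))"
    unfolding Herglotz_integral_def using integral_Im[OF Herglotz_kernel_integrable[OF assms]] unfolding Herglotz_kernel_Im by simp
  also have "\<dots> = Im z * integral\<^sup>L \<mu> (\<lambda>t. 1 / (norm (of_real t - z))\<^sup>2)" by (rule integral_mult_right_zero)
  finally have eq: "\<bar>Im (Herglotz_integral \<mu> z)\<bar> = \<bar>Im z\<bar> * integral\<^sup>L \<mu> (\<lambda>t. 1 / (norm (of_real t - z))\<^sup>2)"
    by (simp add: abs_mult integral_nonneg_AE)
  have "1 / (2 * (1 + (norm z)\<^sup>2)) * integral\<^sup>L \<mu> (\<lambda>t. 1 / (1 + t\<^sup>2)) = integral\<^sup>L \<mu> (\<lambda>t. 1 / (2 * (1 + (norm z)\<^sup>2)) * (1 / (1 + t\<^sup>2)))"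
    by (rule integral_mult_right_zero[symmetric])
  also have "\<dots> \<le> integral\<^sup>L \<mu> (\<lambda>t. 1 / (norm (of_real t - z))\<^sup>2)"
    by (rule integral_mono[OF integrable_mult_right[OF int] i' Herglotz_kernel_Im_bound[OF assms]])
  finally show ?thesis unfolding eq using mult_left_mono[of _ _ "\<bar>Im z\<bar>"] by fastforce
qed

text \<open>Along the imaginary axis only the linear term of a Herglotz representation survives
  division by \<open>z\<close>; this isolates its coefficient.\<close>

lemma Herglotz_integral_sublinear:
  "((\<lambda>y. Herglotz_integral \<mu> (\<i> * of_real y) / (\<i> * of_real y)) \<longlongrightarrow> 0) at_top"
proof -
  define k where "k = (\<lambda>y t. (1 / (complex_of_real t - \<i> * of_real y) - of_real (t / (1 + t\<^sup>2))) / (\<i> * of_real y))"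
  have "((\<lambda>y. integral\<^sup>L \<mu> (k y)) \<longlongrightarrow> integral\<^sup>L \<mu> (\<lambda>_. 0)) at_top"
  proof (rule integral_dominated_convergence_at_top)
    show "(\<lambda>_. 0) \<in> borel_measurable \<mu>" by simp
    show "k y \<in> borel_measurable \<mu>" for y
      unfolding k_def using Herglotz_kernel_measurable by measurable
    show "integrable \<mu> (\<lambda>t. 4 * (1 / (1 + t\<^sup>2)))" by (rule integrable_mult_right[OF int])
    show "AE t in \<mu>. ((\<lambda>y. k y t) \<longlongrightarrow> 0) at_top"
    proof (rule AE_I2)
      fix t :: real
      have inf: "filterlim (\<lambda>y. \<i> * complex_of_real y) at_infinity at_top"
        by (rule filterlim_norm_at_top_imp_at_infinity) (simp add: norm_mult filterlim_abs_real)
      have inf2: "filterlim (\<lambda>y. complex_of_real t - \<i> * complex_of_real y) at_infinity at_top"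
      proof -
        have "filterlim (\<lambda>y. - (\<i> * complex_of_real y)) at_infinity at_top"
          by (rule filterlim_norm_at_top_imp_at_infinity) (simp add: norm_mult filterlim_abs_real)
        from tendsto_add_filterlim_at_infinity[OF tendsto_const[of "complex_of_real t"] this]
        show ?thesis by simp
      qed
      show "((\<lambda>y. k y t) \<longlongrightarrow> 0) at_top"
        unfolding k_def
        using tendsto_divide_0[OF tendsto_diff[OF tendsto_divide_0[OF tendsto_const[of 1] inf2] tendsto_const] inf] by simp
    qed
    show "\<forall>\<^sub>F y in at_top. AE t in \<mu>. norm (k y t) \<le> 4 * (1 / (1 + t\<^sup>2))"
      using eventually_ge_at_top[of 1]
    proof eventually_elim
      case (elim y)
      have "norm (k y t) \<le> 4 * (1 / (1 + t\<^sup>2))" for t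
      proof -
        have "norm (k y t) = norm (1 / (complex_of_real t - \<i> * of_real y) - of_real (t / (1 + t\<^sup>2))) / y"
          unfolding k_def norm_divide[of _ "\<i> * of_real y"] using elim by (simp add: norm_mult)
        also have "\<dots> \<le> 2 * (1 + y\<^sup>2) / y * (1 / (1 + t\<^sup>2)) / y"
        proof (rule divide_right_mono)
          show "norm (1 / (complex_of_real t - \<i> * of_real y) - of_real (t / (1 + t\<^sup>2))) \<le> 2 * (1 + y\<^sup>2) / y * (1 / (1 + t\<^sup>2))"
            using Herglotz_kernel_bound[of "\<i> * of_real y" t] elim by (simp add: norm_mult)
        qed (use elim in simp)
        also have "\<dots> = 2 * ((1 + y\<^sup>2) / y\<^sup>2) * (1 / (1 + t\<^sup>2))" by (simp add: power2_eq_square)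
        also have "\<dots> \<le> 2 * 2 * (1 / (1 + t\<^sup>2))"
          using elim one_le_power[OF elim, of 2] by (intro mult_right_mono mult_left_mono) (auto simp: field_simps)
        finally show ?thesis by simp
      qed
      then show ?case by simp
    qed
  qed
  then show ?thesis by (simp add: Herglotz_integral_def k_def)
qed

text \<open>The residue of the representation: minus the displacement times the kernel tends to the
  indicator of \<open>c\<close> and is dominated by a multiple of
  \<open>1 / (1 + t\<^sup>2)\<close>.\<close>

lemma Herglotz_integral_point_mass:
  "((\<lambda>n. - (\<i> * of_real (1 / of_nat (Suc n))) * Herglotz_integral \<mu> (of_real c + \<i> * of_real (1 / of_nat (Suc n)))) \<longlongrightarrow>
     of_real (measure \<mu> {c})) sequentially"
proof -
  define e where "e = (\<lambda>n. 1 / real (Suc n))"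
  have e: "e n > 0" "e n \<le> 1" for n by (auto simp: e_def)
  have e0: "e \<longlonglongrightarrow> 0" unfolding e_def by (rule LIMSEQ_Suc[OF lim_1_over_n])
  define k where "k = (\<lambda>n t. - (\<i> * of_real (e n)) * (1 / (complex_of_real t - (of_real c + \<i> * of_real (e n))) - of_real (t / (1 + t\<^sup>2))))"
  have "(\<lambda>n. integral\<^sup>L \<mu> (k n)) \<longlonglongrightarrow> integral\<^sup>L \<mu> (\<lambda>t. of_real (indicator {c} t))"
  proof (rule integral_dominated_convergence)
    show "(\<lambda>t. complex_of_real (indicator {c} t)) \<in> borel_measurable \<mu>"
    proof -
      have "(\<lambda>t. complex_of_real (indicator {c} t)) \<in> borel_measurable borel" by measurable
      then show ?thesis using measurable_cong_sets[OF sets refl] by blast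
    qed
    show "k n \<in> borel_measurable \<mu>" for n
      unfolding k_def using Herglotz_kernel_measurable by measurable
    show "integrable \<mu> (\<lambda>t. 2 * (1 + (\<bar>c\<bar> + 1)\<^sup>2) * (1 / (1 + t\<^sup>2)))" by (rule integrable_mult_right[OF int])
    show "AE t in \<mu>. (\<lambda>n. k n t) \<longlonglongrightarrow> of_real (indicator {c} t)"
    proof (rule AE_I2)
      fix t :: real
      have lim: "(\<lambda>n. complex_of_real (e n)) \<longlonglongrightarrow> complex_of_real 0"
        by (rule tendsto_of_real[OF e0])
      show "(\<lambda>n. k n t) \<longlonglongrightarrow> of_real (indicator {c} t)"
      proof (cases "t = c")
        case True
        have "k n t = 1 + \<i> * of_real (e n) * of_real (t / (1 + t\<^sup>2))" for n
          using e(1)[of n] True by (simp add: k_def field_simps)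
        moreover have "(\<lambda>n. 1 + \<i> * of_real (e n) * of_real (t / (1 + t\<^sup>2))) \<longlonglongrightarrow> 1 + \<i> * of_real 0 * of_real (t / (1 + t\<^sup>2))"
          by (intro tendsto_intros lim)
        ultimately show ?thesis using True by simp
      next
        case False
        have "(\<lambda>n. k n t) \<longlonglongrightarrow> - (\<i> * of_real 0) * (1 / (complex_of_real t - (of_real c + \<i> * of_real 0)) - of_real (t / (1 + t\<^sup>2)))"
          unfolding k_def by (intro tendsto_intros lim) (use False in auto)
        then show ?thesis using False by simp
      qed
    qed
    show "AE t in \<mu>. norm (k n t) \<le> 2 * (1 + (\<bar>c\<bar> + 1)\<^sup>2) * (1 / (1 + t\<^sup>2))" for n
    proof (rule AE_I2)
      fix t :: real
      define z where "z = of_real c + \<i> * complex_of_real (e n)"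
      have Im: "Im z = e n" by (simp add: z_def)
      have "norm z \<le> \<bar>c\<bar> + 1"
        using norm_triangle_ineq[of "of_real c" "\<i> * complex_of_real (e n)"] e[of n] by (simp add: z_def norm_mult)
      then have zz: "(norm z)\<^sup>2 \<le> (\<bar>c\<bar> + 1)\<^sup>2" by (intro power_mono) auto
      have "norm (k n t) = e n * norm (1 / (of_real t - z) - of_real (t / (1 + t\<^sup>2)))"
        using e[of n] by (simp add: k_def z_def norm_mult)
      also have "\<dots> \<le> e n * (2 * (1 + (norm z)\<^sup>2) / \<bar>Im z\<bar> * (1 / (1 + t\<^sup>2)))"
        using e[of n] Im by (intro mult_left_mono Herglotz_kernel_bound) auto
      also have "\<dots> = 2 * (1 + (norm z)\<^sup>2) * (1 / (1 + t\<^sup>2))" using e[of n] Im by simp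
      also have "\<dots> \<le> 2 * (1 + (\<bar>c\<bar> + 1)\<^sup>2) * (1 / (1 + t\<^sup>2))"
        using zz by (intro mult_right_mono mult_left_mono) auto
      finally show "norm (k n t) \<le> 2 * (1 + (\<bar>c\<bar> + 1)\<^sup>2) * (1 / (1 + t\<^sup>2))" .
    qed
  qed
  moreover have "integral\<^sup>L \<mu> (\<lambda>t. complex_of_real (indicator {c} t)) = of_real (measure \<mu> {c})"
    using sets_eq_imp_space_eq[OF sets] by (simp add: integral_complex_of_real)
  ultimately show ?thesis by (simp add: Herglotz_integral_def k_def e_def)
qed

end

subsection \<open>Asymptotics along the imaginary axis\<close>

lemma filterlim_norm_csqrt: "filterlim (\<lambda>z. norm (csqrt (- z))) at_top imag_infinity"
  unfolding filterlim_at_top eventually_imag_infinity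
proof (intro allI exI impI)
  fix Z :: real and z :: complex
  assume "norm z \<ge> Z\<^sup>2"
  then have "sqrt (Z\<^sup>2) \<le> sqrt (norm z)" by (rule real_sqrt_le_mono)
  moreover have "norm (csqrt (- z)) = sqrt (norm z)"
    by (rule real_sqrt_unique[symmetric]) (simp_all flip: norm_power)
  ultimately show "Z \<le> norm (csqrt (- z))" by simp
qed

lemma eventually_norm_csqrt_ge: "\<forall>\<^sub>F z in imag_infinity. norm (csqrt (- z)) \<ge> K"
  using filterlim_norm_csqrt unfolding filterlim_at_top by blast

text \<open>The square of \<open>csqrt (- z)\<close> is purely imaginary, so its real and imaginary
  parts have equal modulus. Thus on the axis the growing exponential truly dominates the decaying
  one.\<close>

lemma Re_csqrt_imag_axis:
  assumes "Re z = 0" shows "Re (csqrt (- z)) \<ge> norm (csqrt (- z)) / 2"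
proof -
  define k where "k = csqrt (- z)"
  have Re: "Re k \<ge> 0" by (simp add: k_def Re_csqrt complex_Re_le_cmod)
  have "Re (k\<^sup>2) = 0" using assms by (simp add: k_def)
  then have "(Im k)\<^sup>2 = (Re k)\<^sup>2" by (simp add: power2_eq_square)
  then have "(norm k)\<^sup>2 = 2 * (Re k)\<^sup>2" unfolding cmod_power2 by simp
  also have "\<dots> \<le> (2 * Re k)\<^sup>2" by (simp add: power_mult_distrib)
  finally have "norm k \<le> 2 * Re k" by (rule power2_le_imp_le) (use Re in simp)
  then show ?thesis by (simp add: k_def)
qed

text \<open>If \<open>sin \<theta> \<noteq> 0\<close>, a large \<open>\<kappa>\<close> makes the
  second term at least twice the first, whence the factor \<open>3\<close>; otherwise both
  expressions agree. The bound \<open>1/4\<close> follows from it and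
  \<open>\<bar>cos \<theta>\<bar> + \<bar>sin \<theta>\<bar> \<ge> 1\<close>.\<close>

lemma boundary_factor_bound:
  fixes \<theta> :: real
  obtains K where "K \<ge> 1"
    "\<And>\<kappa>::complex. norm \<kappa> \<ge> K \<Longrightarrow> norm (of_real (cos \<theta>) - \<kappa> * of_real (sin \<theta>)) \<le> 3 * norm (of_real (cos \<theta>) + \<kappa> * of_real (sin \<theta>))"
    "\<And>\<kappa>::complex. norm \<kappa> \<ge> K \<Longrightarrow> norm (of_real (cos \<theta>) + \<kappa> * of_real (sin \<theta>)) \<ge> 1 / 4"
proof -
  define c where "c = complex_of_real (cos \<theta>)"
  define s where "s = complex_of_real (sin \<theta>)"
  have cs: "norm c + norm s \<ge> 1"
  proof -
    have "1 = \<bar>cos \<theta>\<bar>\<^sup>2 + \<bar>sin \<theta>\<bar>\<^sup>2" by simp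
    also have "\<dots> \<le> \<bar>cos \<theta>\<bar> * 1 + \<bar>sin \<theta>\<bar> * 1"
      unfolding power2_eq_square by (intro add_mono mult_left_mono) auto
    finally show ?thesis by (simp add: c_def s_def)
  qed
  define K where "K = (if s = 0 then 1 else max 1 (2 * norm c / norm s))"
  have ratio: "norm (c - \<kappa> * s) \<le> 3 * norm (c + \<kappa> * s)" if "norm \<kappa> \<ge> K" for \<kappa>
  proof (cases "s = 0")
    case False
    then have "norm \<kappa> * norm s \<ge> 2 * norm c" using that by (simp add: K_def field_simps)
    then show ?thesis
      using norm_triangle_ineq4[of c "\<kappa> * s"] norm_triangle_ineq2[of "\<kappa> * s" "- c"]
      by (simp add: norm_mult add.commute)
  qed simp
  moreover have "norm (c + \<kappa> * s) \<ge> 1 / 4" if "norm \<kappa> \<ge> K" for \<kappa>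
  proof -
    have "norm \<kappa> \<ge> 1" using that by (auto simp: K_def split: if_splits)
    then have "norm s \<le> norm \<kappa> * norm s" using mult_right_mono[of 1 "norm \<kappa>" "norm s"] by simp
    moreover have "norm (c + \<kappa> * s + (c - \<kappa> * s)) \<le> 4 * norm (c + \<kappa> * s)"
      "norm (c + \<kappa> * s - (c - \<kappa> * s)) \<le> 4 * norm (c + \<kappa> * s)"
      using ratio[OF that] norm_triangle_ineq[of "c + \<kappa> * s" "c - \<kappa> * s"] norm_triangle_ineq4[of "c + \<kappa> * s" "c - \<kappa> * s"]
      by linarith+
    then have "2 * norm c \<le> 4 * norm (c + \<kappa> * s)" "2 * (norm \<kappa> * norm s) \<le> 4 * norm (c + \<kappa> * s)"
      by (simp_all add: norm_mult flip: mult_2)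
    ultimately show ?thesis using cs by linarith
  qed
  moreover have "K \<ge> 1" by (simp add: K_def)
  ultimately show thesis using that unfolding c_def s_def by blast
qed

definition bfactor :: "real \<Rightarrow> complex \<Rightarrow> complex" where
  "bfactor \<theta> \<kappa> = of_real (cos \<theta>) + \<kappa> * of_real (sin \<theta>)"

text \<open>The growing part of the characteristic function of the zero potential. It does not
  depend on the potential, so it drops out of quotients for two potentials.\<close>

definition char_lead :: "real \<Rightarrow> real \<Rightarrow> complex \<Rightarrow> complex" where
  "char_lead \<alpha> \<beta> z = (let \<kappa> = csqrt (- z) in
     exp (\<kappa> * of_real pi) * bfactor \<alpha> \<kappa> * bfactor \<beta> \<kappa> / (2 * \<kappa>))"

lemma char_lead_nonzero: "\<forall>\<^sub>F z in imag_infinity. char_lead \<alpha> \<beta> z \<noteq> 0"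
proof -
  obtain K1 where K1: "K1 \<ge> 1" "\<And>\<kappa>. norm \<kappa> \<ge> K1 \<Longrightarrow> norm (bfactor \<alpha> \<kappa>) \<ge> 1/4"
    by (rule boundary_factor_bound[of \<alpha>]) (auto simp: bfactor_def)
  obtain K2 where K2: "K2 \<ge> 1" "\<And>\<kappa>. norm \<kappa> \<ge> K2 \<Longrightarrow> norm (bfactor \<beta> \<kappa>) \<ge> 1/4"
    by (rule boundary_factor_bound[of \<beta>]) (auto simp: bfactor_def)
  have "\<forall>\<^sub>F z in imag_infinity. norm (csqrt (- z)) \<ge> max K1 K2"
    by (rule eventually_norm_csqrt_ge)
  then show ?thesis
  proof eventually_elim
    case (elim z)
    then have "norm (csqrt (- z)) \<ge> K1" "norm (csqrt (- z)) \<ge> K2" "norm (csqrt (- z)) \<ge> 1"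
      using K1(1) unfolding max.bounded_iff by linarith+
    then have "norm (bfactor \<alpha> (csqrt (- z))) \<ge> 1/4" "norm (bfactor \<beta> (csqrt (- z))) \<ge> 1/4" "norm (csqrt (- z)) \<ge> 1"
      by (blast intro: K1(2) K2(2))+
    then have "bfactor \<alpha> (csqrt (- z)) \<noteq> 0" "bfactor \<beta> (csqrt (- z)) \<noteq> 0" "csqrt (- z) \<noteq> 0" by auto
    then show ?case by (simp add: char_lead_def Let_def)
  qed
qed

text \<open>The quotient is \<open>P - R * (b' / b)\<close>, where \<open>P\<close> and
  \<open>R\<close> are the rescaled \<open>y' + \<kappa> y\<close> and
  \<open>y' - \<kappa> y\<close> at \<open>pi\<close>. By \<open>solution_estimate\<close>,
  \<open>P\<close> tends to \<open>1\<close> and \<open>R\<close> to \<open>0\<close>, while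
  \<open>b' / b\<close> stays bounded by \<open>3\<close>.\<close>

lemma char_fun_asymptotic:
  assumes q: "potential q"
  shows "((\<lambda>z. char_fun q \<alpha> \<beta> z / char_lead \<alpha> \<beta> z) \<longlongrightarrow> 1) imag_infinity"
proof -
  obtain K1 where K1: "K1 \<ge> 1" "\<And>\<kappa>. norm \<kappa> \<ge> K1 \<Longrightarrow> norm (of_real (cos \<alpha>) - \<kappa> * of_real (sin \<alpha>)) \<le> 3 * norm (bfactor \<alpha> \<kappa>)" "\<And>\<kappa>. norm \<kappa> \<ge> K1 \<Longrightarrow> norm (bfactor \<alpha> \<kappa>) \<ge> 1/4"
    by (rule boundary_factor_bound[of \<alpha>]) (auto simp: bfactor_def)
  obtain K2 where K2: "K2 \<ge> 1" "\<And>\<kappa>. norm \<kappa> \<ge> K2 \<Longrightarrow> norm (of_real (cos \<beta>) - \<kappa> * of_real (sin \<beta>)) \<le> 3 * norm (bfactor \<beta> \<kappa>)" "\<And>\<kappa>. norm \<kappa> \<ge> K2 \<Longrightarrow> norm (bfactor \<beta> \<kappa>) \<ge> 1/4"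
    by (rule boundary_factor_bound[of \<beta>]) (auto simp: bfactor_def)
  define Q where "Q = pot_norm q"
  have Q: "Q \<ge> 0" by (simp add: Q_def pot_norm_nonneg)
  \<comment> \<open>The first term bounds \<open>P - 1\<close>, the bracket bounds \<open>R\<close>;
    \<open>4\<close> and \<open>3\<close> come from
    \<open>norm r0 \<le> 3 * norm p0\<close>.\<close>
  define e where "e = (\<lambda>k. Q * 4 / k + 3 * (exp (- pi * k) * 3 + Q * 4 / k))"
  have "(e \<longlongrightarrow> 0) at_top" unfolding e_def by real_asymp
  then have lim: "((\<lambda>z. e (norm (csqrt (- z)))) \<longlongrightarrow> 0) imag_infinity"
    by (rule filterlim_compose[OF _ filterlim_norm_csqrt])
  have "\<forall>\<^sub>F z in imag_infinity. norm (csqrt (- z)) \<ge> max (max K1 K2) (2 * Q)"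
    by (rule eventually_norm_csqrt_ge)
  moreover have "\<forall>\<^sub>F z in imag_infinity. Re z = 0"
    by (auto simp: eventually_imag_infinity)
  ultimately have "\<forall>\<^sub>F z in imag_infinity. norm (char_fun q \<alpha> \<beta> z / char_lead \<alpha> \<beta> z - 1) \<le> e (norm (csqrt (- z)))"
  proof eventually_elim
    case (elim z)
    define \<kappa> where "\<kappa> = csqrt (- z)"
    have \<kappa>2: "- (\<kappa>\<^sup>2) = z" by (simp add: \<kappa>_def)
    have k: "norm \<kappa> \<ge> K1" "norm \<kappa> \<ge> K2" "norm \<kappa> \<ge> 2 * Q" "norm \<kappa> \<ge> 1"
      using elim(1) K1(1) unfolding \<kappa>_def max.bounded_iff by linarith+
    have Re: "Re \<kappa> \<ge> norm \<kappa> / 2" unfolding \<kappa>_def by (rule Re_csqrt_imag_axis[OF elim(2)])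
    have Re0: "Re \<kappa> \<ge> 0" using Re order_trans[OF _ Re, of 0] by simp
    have \<kappa>0: "\<kappa> \<noteq> 0" using k(4) by auto
    define y where "y = ivp_sol q (of_real (sin \<alpha>)) (of_real (cos \<alpha>)) z pi"
    define y' where "y' = ivp_der q (of_real (sin \<alpha>)) (of_real (cos \<alpha>)) z pi"
    define p0 where "p0 = bfactor \<alpha> \<kappa>"
    define r0 where "r0 = of_real (cos \<alpha>) - \<kappa> * of_real (sin \<alpha>)"
    define b where "b = bfactor \<beta> \<kappa>"
    define b' where "b' = of_real (cos \<beta>) - \<kappa> * of_real (sin \<beta>)"
    have r0: "norm r0 \<le> 3 * norm p0" using K1(2)[OF k(1)] by (simp add: r0_def p0_def)
    have b': "norm b' \<le> 3 * norm b" using K2(2)[OF k(2)] by (simp add: b'_def b_def)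
    have nz: "p0 \<noteq> 0" "b \<noteq> 0" using K1(3)[OF k(1)] K2(3)[OF k(2)] by (auto simp: p0_def b_def)
    define A where "A = norm p0 + norm r0"
    have A: "A \<le> 4 * norm p0" using r0 by (simp add: A_def)
    define E where "E = exp (- \<kappa> * of_real pi)"
    define P where "P = E * (y' + \<kappa> * y) / p0"
    define R where "R = E * (y' - \<kappa> * y) / p0"
    note s = sl_ivp(1)[OF q, of z "of_real (sin \<alpha>)" "of_real (cos \<alpha>)"]
    note est = solution_estimate[OF q, of \<kappa>, unfolded \<kappa>2, OF s Re0 \<kappa>0 k(3)[unfolded Q_def] pi_ge_zero order_refl,
        folded y_def y'_def, unfolded sl_ivp(2,3)[OF q], folded bfactor_def r0_def, folded p0_def, folded A_def Q_def E_def]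
    have QA: "Q * A / norm \<kappa> \<le> Q * 4 / norm \<kappa> * norm p0"
      using mult_left_mono[OF A Q] k(4) by (simp add: divide_right_mono)
    have P: "norm (P - 1) \<le> Q * 4 / norm \<kappa>"
    proof -
      have "norm (P - 1) * norm p0 = norm (E * (y' + \<kappa> * y) - p0)"
        using nz by (simp add: P_def left_diff_distrib flip: norm_mult)
      also have "\<dots> \<le> Q * 4 / norm \<kappa> * norm p0" by (rule order_trans[OF est(2) QA])
      finally show ?thesis by (rule mult_right_le_imp_le) (use nz in simp)
    qed
    have R: "norm R \<le> exp (- pi * norm \<kappa>) * 3 + Q * 4 / norm \<kappa>"
    proof -
      have "norm R * norm p0 = norm (E * (y' - \<kappa> * y))"
        using nz by (simp add: R_def flip: norm_mult)
      also have "\<dots> \<le> exp (- 2 * Re \<kappa> * pi) * norm r0 + Q * A / norm \<kappa>" by (rule est(3))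
      also have "\<dots> \<le> exp (- pi * norm \<kappa>) * (3 * norm p0) + Q * 4 / norm \<kappa> * norm p0"
        using Re r0 QA by (intro add_mono mult_mono) auto
      finally have "norm R * norm p0 \<le> (exp (- pi * norm \<kappa>) * 3 + Q * 4 / norm \<kappa>) * norm p0"
        by (simp add: algebra_simps)
      then show ?thesis by (rule mult_right_le_imp_le) (use nz in simp)
    qed
    have lead: "char_lead \<alpha> \<beta> z = p0 * b / (2 * \<kappa> * E)"
      using \<kappa>0 by (simp add: char_lead_def Let_def p0_def b_def E_def exp_minus field_simps flip: \<kappa>_def)
    have E0: "E \<noteq> 0" by (simp add: E_def)
    have "char_fun q \<alpha> \<beta> z / char_lead \<alpha> \<beta> z = P - R * (b' / b)"
    proof -
      have "char_fun q \<alpha> \<beta> z / char_lead \<alpha> \<beta> z = (of_real (cos \<beta>) * y + of_real (sin \<beta>) * y') * (2 * \<kappa> * E) / (p0 * b)"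
        by (simp add: lead char_fun_def flip: y_def y'_def)
      also have "\<dots> = (E * (y' + \<kappa> * y) * b - E * (y' - \<kappa> * y) * b') / (p0 * b)"
        by (simp add: b_def b'_def bfactor_def algebra_simps)
      also have "\<dots> = P - R * (b' / b)"
        using nz by (simp add: P_def R_def field_simps)
      finally show ?thesis .
    qed
    then have e: "char_fun q \<alpha> \<beta> z / char_lead \<alpha> \<beta> z - 1 = (P - 1) - R * (b' / b)" by simp
    have "norm (char_fun q \<alpha> \<beta> z / char_lead \<alpha> \<beta> z - 1) \<le> norm (P - 1) + norm R * (norm b' / norm b)"
      unfolding e by (rule order_trans[OF norm_triangle_ineq4]) (simp add: norm_mult norm_divide)
    also have "norm R * (norm b' / norm b) \<le> norm R * 3"
      using b' nz by (intro mult_left_mono) (auto simp: divide_le_eq)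
    finally show ?case using P R by (simp add: e_def flip: \<kappa>_def)
  qed
  then have "((\<lambda>z. char_fun q \<alpha> \<beta> z / char_lead \<alpha> \<beta> z - 1) \<longlongrightarrow> 0) imag_infinity"
    by (rule Lim_null_comparison[OF _ lim])
  then show ?thesis by (rule LIM_zero_cancel)
qed

lemma char_fun_ratio:
  assumes q: "potential q" and q': "potential q'"
  shows "((\<lambda>z. char_fun q \<alpha> \<beta> z / char_fun q' \<alpha> \<beta> z) \<longlongrightarrow> 1) imag_infinity"
proof -
  have "((\<lambda>z. (char_fun q \<alpha> \<beta> z / char_lead \<alpha> \<beta> z) / (char_fun q' \<alpha> \<beta> z / char_lead \<alpha> \<beta> z)) \<longlongrightarrow> 1 / 1) imag_infinity"
    by (intro tendsto_divide char_fun_asymptotic q q') simp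
  then have "((\<lambda>z. (char_fun q \<alpha> \<beta> z / char_lead \<alpha> \<beta> z) / (char_fun q' \<alpha> \<beta> z / char_lead \<alpha> \<beta> z)) \<longlongrightarrow> 1) imag_infinity"
    by simp
  then show ?thesis
    by (rule Lim_transform_eventually) (use char_lead_nonzero[of \<alpha> \<beta>] in \<open>auto elim!: eventually_mono\<close>)
qed

text \<open>The leading terms differ only in the boundary factors at \<open>0\<close>. Their
  quotient is of order \<open>norm \<kappa>\<close> at most, whereas
  \<open>z = - \<kappa>\<^sup>2\<close>.\<close>

lemma char_fun_ratio_sublinear:
  assumes q: "potential q"
  shows "((\<lambda>z. char_fun q \<alpha>1 \<beta> z / char_fun q \<alpha>2 \<beta> z / z) \<longlongrightarrow> 0) imag_infinity"
proof -
  obtain K where K: "K \<ge> 1" "\<And>\<kappa>. norm \<kappa> \<ge> K \<Longrightarrow> norm (bfactor \<alpha>2 \<kappa>) \<ge> 1/4"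
    by (rule boundary_factor_bound[of \<alpha>2]) (auto simp: bfactor_def)
  have inv: "((\<lambda>z. 8 / norm (csqrt (- z))) \<longlongrightarrow> 0) imag_infinity"
  proof -
    have "((\<lambda>k. 8 / k) \<longlongrightarrow> (0::real)) at_top" by real_asymp
    then show ?thesis by (rule filterlim_compose[OF _ filterlim_norm_csqrt])
  qed
  have lead: "((\<lambda>z. char_lead \<alpha>1 \<beta> z / char_lead \<alpha>2 \<beta> z / z) \<longlongrightarrow> 0) imag_infinity"
  proof (rule Lim_null_comparison[OF _ inv])
    have "\<forall>\<^sub>F z in imag_infinity. norm (csqrt (- z)) \<ge> K"
      by (rule eventually_norm_csqrt_ge)
    then show "\<forall>\<^sub>F z in imag_infinity. norm (char_lead \<alpha>1 \<beta> z / char_lead \<alpha>2 \<beta> z / z) \<le> 8 / norm (csqrt (- z))"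
      using char_lead_nonzero[of \<alpha>2 \<beta>]
    proof eventually_elim
      case (elim z)
      define \<kappa> where "\<kappa> = csqrt (- z)"
      have z: "z = - (\<kappa>\<^sup>2)" by (simp add: \<kappa>_def)
      have k: "norm \<kappa> \<ge> K" "norm \<kappa> \<ge> 1" using elim(1) K(1) unfolding \<kappa>_def by linarith+
      have \<kappa>0: "\<kappa> \<noteq> 0" using k(2) by auto
      have b2: "norm (bfactor \<alpha>2 \<kappa>) \<ge> 1/4" by (rule K(2)[OF k(1)])
      have "bfactor \<beta> \<kappa> \<noteq> 0" using elim(2) by (auto simp: char_lead_def Let_def \<kappa>_def)
      then have "char_lead \<alpha>1 \<beta> z / char_lead \<alpha>2 \<beta> z = bfactor \<alpha>1 \<kappa> / bfactor \<alpha>2 \<kappa>"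
        using \<kappa>0 by (simp add: char_lead_def Let_def flip: \<kappa>_def)
      then have "norm (char_lead \<alpha>1 \<beta> z / char_lead \<alpha>2 \<beta> z / z) = norm (bfactor \<alpha>1 \<kappa>) / norm (bfactor \<alpha>2 \<kappa>) / (norm \<kappa>)\<^sup>2"
        by (simp add: z norm_divide norm_mult norm_power)
      also have "\<dots> \<le> (2 * norm \<kappa>) / (1/4) / (norm \<kappa>)\<^sup>2"
      proof (intro divide_right_mono frac_le)
        have "norm (bfactor \<alpha>1 \<kappa>) \<le> norm (complex_of_real (cos \<alpha>1)) + norm (\<kappa> * of_real (sin \<alpha>1))"
          unfolding bfactor_def by (rule norm_triangle_ineq)
        also have "\<dots> \<le> 1 + norm \<kappa> * 1" unfolding norm_mult by (intro add_mono mult_left_mono) auto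
        finally show "norm (bfactor \<alpha>1 \<kappa>) \<le> 2 * norm \<kappa>" using k(2) by simp
      qed (use b2 in auto)
      also have "\<dots> = 8 / norm \<kappa>" using \<kappa>0 by (simp add: power2_eq_square)
      finally show ?case by (simp add: \<kappa>_def)
    qed
  qed
  have "((\<lambda>z. (char_fun q \<alpha>1 \<beta> z / char_lead \<alpha>1 \<beta> z) / (char_fun q \<alpha>2 \<beta> z / char_lead \<alpha>2 \<beta> z) * (char_lead \<alpha>1 \<beta> z / char_lead \<alpha>2 \<beta> z / z)) \<longlongrightarrow> 1 / 1 * 0) imag_infinity"
    by (intro tendsto_mult tendsto_divide char_fun_asymptotic q lead) simp
  then have "((\<lambda>z. (char_fun q \<alpha>1 \<beta> z / char_lead \<alpha>1 \<beta> z) / (char_fun q \<alpha>2 \<beta> z / char_lead \<alpha>2 \<beta> z) * (char_lead \<alpha>1 \<beta> z / char_lead \<alpha>2 \<beta> z / z)) \<longlongrightarrow> 0) imag_infinity"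
    by simp
  moreover have "\<forall>\<^sub>F z in imag_infinity. (char_fun q \<alpha>1 \<beta> z / char_lead \<alpha>1 \<beta> z) / (char_fun q \<alpha>2 \<beta> z / char_lead \<alpha>2 \<beta> z) * (char_lead \<alpha>1 \<beta> z / char_lead \<alpha>2 \<beta> z / z) = char_fun q \<alpha>1 \<beta> z / char_fun q \<alpha>2 \<beta> z / z"
    using char_lead_nonzero[of \<alpha>1 \<beta>] char_lead_nonzero[of \<alpha>2 \<beta>] by eventually_elim simp
  ultimately show ?thesis by (rule Lim_transform_eventually)
qed

subsection \<open>Consequences of the spectral data\<close>

lemma isCont_entire:
  assumes "f holomorphic_on UNIV" shows "isCont f z"
  using holomorphic_on_imp_continuous_on[OF assms] by (simp add: continuous_on_eq_continuous_at)

lemma enumerates_char_fun: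
  assumes "potential q" "enumerates_incr a (sl_spectrum q \<alpha> \<beta>)"
  shows "char_fun q \<alpha> \<beta> z = 0 \<longleftrightarrow> z \<in> range (\<lambda>n. complex_of_real (a n))" "inj a"
proof -
  have "{z. char_fun q \<alpha> \<beta> z = 0} = range (\<lambda>n. complex_of_real (a n))" "strict_mono a"
    using assms by (auto simp: enumerates_incr_def sl_spectrum_eq[OF assms(1)])
  then show "char_fun q \<alpha> \<beta> z = 0 \<longleftrightarrow> z \<in> range (\<lambda>n. complex_of_real (a n))" "inj a"
    by (auto simp: strict_mono_imp_inj_on)
qed

lemma filterlim_imag_line: "filterlim (\<lambda>y. \<i> * complex_of_real y) imag_infinity at_top"
  unfolding filterlim_iff eventually_imag_infinity
proof (intro allI impI, elim exE)
  fix P R assume *: "\<forall>z. Re z = 0 \<longrightarrow> R \<le> norm z \<longrightarrow> P z"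
  show "\<forall>\<^sub>F y in at_top. P (\<i> * complex_of_real y)"
    using eventually_ge_at_top[of "\<bar>R\<bar>"]
    by eventually_elim (use * in \<open>auto simp: norm_mult\<close>)
qed

text \<open>Two facts are added to the representation: it has no linear term, and the measure is
  nonzero. The second makes the lower bound for the imaginary part effective.\<close>

lemma spectral_data_m_fun:
  assumes q: "potential q" and sin: "sin (\<alpha>2 - \<alpha>1) \<noteq> 0" and data: "spectral_data q \<alpha>1 \<alpha>2 \<beta> a b \<gamma>"
  obtains \<mu> d where "sets \<mu> = sets borel" "integrable \<mu> (\<lambda>t. 1 / (1 + t\<^sup>2))"
    "\<And>n. \<gamma> n = measure \<mu> {a n}"
    "\<And>z. Im z \<noteq> 0 \<Longrightarrow> char_fun q \<alpha>1 \<beta> z / char_fun q \<alpha>2 \<beta> z / of_real (sin (\<alpha>2 - \<alpha>1)) = of_real d + Herglotz_integral \<mu> z"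
    "integral\<^sup>L \<mu> (\<lambda>t. 1 / (1 + t\<^sup>2)) > 0"
proof -
  from data obtain \<mu> where a: "enumerates_incr a (sl_spectrum q \<alpha>2 \<beta>)" and b: "enumerates_incr b (sl_spectrum q \<alpha>1 \<beta>)"
    and sm: "spectral_measure q \<alpha>1 \<alpha>2 \<beta> \<mu>" and \<gamma>: "\<And>n. \<gamma> n = measure \<mu> {a n}"
    by (auto simp: spectral_data_def)
  define \<Delta>1 where "\<Delta>1 = char_fun q \<alpha>1 \<beta>"
  define \<Delta>2 where "\<Delta>2 = char_fun q \<alpha>2 \<beta>"
  define s where "s = complex_of_real (sin (\<alpha>2 - \<alpha>1))"
  from sm obtain c d where sets: "sets \<mu> = sets borel" and int: "integrable \<mu> (\<lambda>t. 1 / (1 + t\<^sup>2))"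
    and rep: "\<And>z. \<Delta>2 z \<noteq> 0 \<Longrightarrow> \<Delta>1 z / \<Delta>2 z / s = of_real c * z + of_real d + Herglotz_integral \<mu> z"
    unfolding spectral_measure_def sl_spectrum_eq[OF q] m_fun_eq[OF q] Herglotz_integral_def \<Delta>1_def \<Delta>2_def s_def by auto
  have nz2: "\<Delta>2 z \<noteq> 0" and nz1: "\<Delta>1 z \<noteq> 0" if "Im z \<noteq> 0" for z
    using enumerates_char_fun(1)[OF q a] enumerates_char_fun(1)[OF q b] that by (auto simp: \<Delta>1_def \<Delta>2_def)
  \<comment> \<open>Divide by \<open>z\<close> along the imaginary axis: the quotient of
    characteristic functions, the constant and the integral all become negligible.\<close>
  have c0: "c = 0"
  proof -
    define z where "z = (\<lambda>y. \<i> * complex_of_real y)"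
    have z: "filterlim z imag_infinity at_top" unfolding z_def by (rule filterlim_imag_line)
    have zinf: "filterlim z at_infinity at_top"
      unfolding z_def by (rule filterlim_norm_at_top_imp_at_infinity) (simp add: norm_mult filterlim_abs_real)
    have l1: "((\<lambda>y. \<Delta>1 (z y) / \<Delta>2 (z y) / z y) \<longlongrightarrow> 0) at_top"
      unfolding \<Delta>1_def \<Delta>2_def by (rule filterlim_compose[OF char_fun_ratio_sublinear[OF q] z])
    have l2: "((\<lambda>y. Herglotz_integral \<mu> (z y) / z y) \<longlongrightarrow> 0) at_top"
      unfolding z_def by (rule Herglotz_integral_sublinear[OF sets int])
    have l3: "((\<lambda>y. of_real d / z y) \<longlongrightarrow> 0) at_top"
      by (rule tendsto_divide_0[OF tendsto_const zinf])
    have lim: "((\<lambda>y. \<Delta>1 (z y) / \<Delta>2 (z y) / z y / s - of_real d / z y - Herglotz_integral \<mu> (z y) / z y) \<longlongrightarrow> 0 / s - 0 - 0) at_top"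
      by (intro tendsto_diff tendsto_divide l1 l2 l3 tendsto_const) (use sin in \<open>simp add: s_def\<close>)
    have ev: "\<forall>\<^sub>F y in at_top. \<Delta>1 (z y) / \<Delta>2 (z y) / z y / s - of_real d / z y - Herglotz_integral \<mu> (z y) / z y = of_real c"
      using eventually_gt_at_top[of 0]
    proof eventually_elim
      case (elim y)
      then have zy: "Im (z y) \<noteq> 0" "z y \<noteq> 0" by (auto simp: z_def)
      have "\<Delta>1 (z y) / \<Delta>2 (z y) / z y / s = (of_real c * z y + of_real d + Herglotz_integral \<mu> (z y)) / z y"
        unfolding rep[OF nz2[OF zy(1)], symmetric] by simp
      then show ?case using zy(2) by (simp add: add_divide_distrib)
    qed
    have "((\<lambda>y. complex_of_real c) \<longlongrightarrow> 0 / s - 0 - 0) (at_top :: real filter)"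
      by (rule Lim_transform_eventually[OF lim ev])
    then show ?thesis by (simp add: tendsto_const_iff)
  qed
  have rep': "\<Delta>1 z / \<Delta>2 z / s = of_real d + Herglotz_integral \<mu> z" if "Im z \<noteq> 0" for z
    using rep[OF nz2[OF that]] c0 by simp
  have "integral\<^sup>L \<mu> (\<lambda>t. 1 / (1 + t\<^sup>2)) > 0"
  proof (rule ccontr)
    assume "\<not> integral\<^sup>L \<mu> (\<lambda>t. 1 / (1 + t\<^sup>2)) > 0"
    moreover have "integral\<^sup>L \<mu> (\<lambda>t. 1 / (1 + t\<^sup>2)) \<ge> 0" by (rule integral_nonneg_AE) simp
    ultimately have W: "integral\<^sup>L \<mu> (\<lambda>t. 1 / (1 + t\<^sup>2)) = 0" by simp
    \<comment> \<open>Without mass the \<open>m\<close>-function would be constant, and a zero of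
      the second characteristic function would be one of the first.\<close>
    have const: "\<Delta>1 z = of_real d * s * \<Delta>2 z" if "Im z \<noteq> 0" for z
    proof -
      have "Herglotz_integral \<mu> z = 0" using Herglotz_integral_bound[OF sets int that] W by simp
      then show ?thesis using rep'[OF that] nz2[OF that] sin by (simp add: s_def field_simps)
    qed
    have "(\<lambda>z. \<Delta>1 z - of_real d * s * \<Delta>2 z) holomorphic_on UNIV"
      unfolding \<Delta>1_def \<Delta>2_def by (intro holomorphic_intros char_fun_holomorphic q)
    then have "\<Delta>1 z - of_real d * s * \<Delta>2 z = 0" for z
      by (rule entire_eq_zero_of_nonreal) (use const in simp)
    then have all: "\<Delta>1 z = of_real d * s * \<Delta>2 z" for z by simp
    have "\<Delta>2 (of_real (a 0)) = 0" "\<Delta>1 (of_real (b 0)) = 0"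
      using enumerates_char_fun(1)[OF q a] enumerates_char_fun(1)[OF q b] by (auto simp: \<Delta>1_def \<Delta>2_def)
    then have "\<Delta>1 (of_real (a 0)) = 0" "\<Delta>2 (of_real (a 0)) = 0" using all by auto
    then show False using char_fun_no_common_zero[OF q sin] by (auto simp: \<Delta>1_def \<Delta>2_def)
  qed
  then show thesis
    using that sets int \<gamma> rep' unfolding \<Delta>1_def \<Delta>2_def s_def by blast
qed

lemma spectral_data_bounds:
  assumes q: "potential q" and sin: "sin (\<alpha>2 - \<alpha>1) \<noteq> 0" and data: "spectral_data q \<alpha>1 \<alpha>2 \<beta> a b \<gamma>"
  obtains C where "C \<ge> 0"
    "\<And>z. Im z \<noteq> 0 \<Longrightarrow> norm (char_fun q \<alpha>1 \<beta> z) \<le> C * (1 + (norm z)\<^sup>2) / \<bar>Im z\<bar> * norm (char_fun q \<alpha>2 \<beta> z)"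
    "\<And>z. Im z \<noteq> 0 \<Longrightarrow> norm (char_fun q \<alpha>2 \<beta> z) \<le> C * (1 + (norm z)\<^sup>2) / \<bar>Im z\<bar> * norm (char_fun q \<alpha>1 \<beta> z)"
proof -
  have zeros: "enumerates_incr a (sl_spectrum q \<alpha>2 \<beta>)" "enumerates_incr b (sl_spectrum q \<alpha>1 \<beta>)"
    using data by (auto simp: spectral_data_def)
  obtain \<mu> d where sets: "sets \<mu> = sets borel" and int: "integrable \<mu> (\<lambda>t. 1 / (1 + t\<^sup>2))"
    and rep: "\<And>z. Im z \<noteq> 0 \<Longrightarrow> char_fun q \<alpha>1 \<beta> z / char_fun q \<alpha>2 \<beta> z / of_real (sin (\<alpha>2 - \<alpha>1)) = of_real d + Herglotz_integral \<mu> z"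
    and W: "integral\<^sup>L \<mu> (\<lambda>t. 1 / (1 + t\<^sup>2)) > 0"
    by (rule spectral_data_m_fun[OF q sin data]) blast
  define W where "W = integral\<^sup>L \<mu> (\<lambda>t. 1 / (1 + t\<^sup>2))"
  define s where "s = \<bar>sin (\<alpha>2 - \<alpha>1)\<bar>"
  have s: "s > 0" using sin by (simp add: s_def)
  \<comment> \<open>The first entry stems from the upper bound for the representation, the second
    from \<open>norm m \<ge> \<bar>Im m\<bar>\<close>.\<close>
  define C where "C = max ((\<bar>d\<bar> + 2 * W) * s) (2 / (s * W))"
  have C: "C \<ge> (\<bar>d\<bar> + 2 * W) * s" "C \<ge> 2 / (s * W)" by (auto simp: C_def)
  have Wp: "W > 0" using W by (simp add: W_def)
  have C0: "C \<ge> 0" using C(2) s Wp order_trans[of 0 "2 / (s * W)" C] by simp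
  have *: "norm (char_fun q \<alpha>1 \<beta> z) \<le> C * (1 + (norm z)\<^sup>2) / \<bar>Im z\<bar> * norm (char_fun q \<alpha>2 \<beta> z) \<and>
     norm (char_fun q \<alpha>2 \<beta> z) \<le> C * (1 + (norm z)\<^sup>2) / \<bar>Im z\<bar> * norm (char_fun q \<alpha>1 \<beta> z)" if z: "Im z \<noteq> 0" for z
  proof -
    define A where "A = norm (char_fun q \<alpha>1 \<beta> z)"
    define B where "B = norm (char_fun q \<alpha>2 \<beta> z)"
    define g where "g = (1 + (norm z)\<^sup>2) / \<bar>Im z\<bar>"
    have "char_fun q \<alpha>1 \<beta> z \<noteq> 0" "char_fun q \<alpha>2 \<beta> z \<noteq> 0"
      using enumerates_char_fun(1)[OF q zeros(1)] enumerates_char_fun(1)[OF q zeros(2)] z by auto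
    then have AB: "A > 0" "B > 0" by (auto simp: A_def B_def)
    have g1: "g \<ge> 1"
    proof -
      have "\<bar>Im z\<bar> \<le> norm z" by (rule abs_Im_le_cmod)
      also have "\<dots> \<le> 1 + (norm z)\<^sup>2"
        using sum_squares_bound[of 1 "norm z"] norm_ge_zero[of z] unfolding power_one mult_1_right by linarith
      finally show ?thesis using z by (simp add: g_def pos_le_divide_eq)
    qed
    have m: "A / B / s = norm (of_real d + Herglotz_integral \<mu> z)"
      unfolding rep[OF z, symmetric] by (simp add: A_def B_def s_def norm_divide norm_mult)
    have "A / B / s \<le> \<bar>d\<bar> + 2 * g * W"
      using norm_triangle_ineq[of "of_real d" "Herglotz_integral \<mu> z"] Herglotz_integral_bound[OF sets int z]
      unfolding m W_def g_def by simp
    also have "\<dots> \<le> g * (\<bar>d\<bar> + 2 * W)"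
      using mult_right_mono[OF g1, of "\<bar>d\<bar>"] by (simp add: algebra_simps)
    finally have "A \<le> g * (\<bar>d\<bar> + 2 * W) * s * B" using AB s by (simp add: field_simps)
    also have "\<dots> = ((\<bar>d\<bar> + 2 * W) * s) * (g * B)" by simp
    also have "\<dots> \<le> C * (g * B)" using C(1) g1 AB by (intro mult_right_mono) auto
    finally have 1: "A \<le> C * g * B" by simp
    have "W / (2 * g) \<le> \<bar>Im (Herglotz_integral \<mu> z)\<bar>"
      using Herglotz_integral_Im[OF sets int z] by (simp add: W_def g_def mult.commute)
    also have "\<dots> \<le> norm (of_real d + Herglotz_integral \<mu> z)"
      using abs_Im_le_cmod[of "of_real d + Herglotz_integral \<mu> z"] by simp
    finally have "W / (2 * g) \<le> A / B / s" unfolding m .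
    then have "B \<le> (2 / (s * W)) * (g * A)" using AB s Wp g1 by (simp add: field_simps)
    also have "\<dots> \<le> C * (g * A)" using C(2) g1 AB by (intro mult_right_mono) auto
    finally have "B \<le> C * g * A" by simp
    with 1 show ?thesis by (simp add: A_def B_def g_def)
  qed
  then show thesis using that[OF C0] by blast
qed

text \<open>The second formula is how the point masses enter: once the second characteristic
  functions agree, so do their derivatives, and equal masses at \<open>a n\<close> give equal values
  of the first ones there.\<close>

lemma spectral_data_residue:
  assumes q: "potential q" and sin: "sin (\<alpha>2 - \<alpha>1) \<noteq> 0" and data: "spectral_data q \<alpha>1 \<alpha>2 \<beta> a b \<gamma>"
  shows "deriv (char_fun q \<alpha>2 \<beta>) (of_real (a n)) \<noteq> 0"
    "char_fun q \<alpha>1 \<beta> (of_real (a n)) = - of_real (\<gamma> n * sin (\<alpha>2 - \<alpha>1)) * deriv (char_fun q \<alpha>2 \<beta>) (of_real (a n))"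
proof -
  have zeros: "enumerates_incr a (sl_spectrum q \<alpha>2 \<beta>)" "enumerates_incr b (sl_spectrum q \<alpha>1 \<beta>)"
    using data by (auto simp: spectral_data_def)
  obtain \<mu> d where sets: "sets \<mu> = sets borel" and int: "integrable \<mu> (\<lambda>t. 1 / (1 + t\<^sup>2))"
    and \<gamma>: "\<And>n. \<gamma> n = measure \<mu> {a n}"
    and rep: "\<And>z. Im z \<noteq> 0 \<Longrightarrow> char_fun q \<alpha>1 \<beta> z / char_fun q \<alpha>2 \<beta> z / of_real (sin (\<alpha>2 - \<alpha>1)) = of_real d + Herglotz_integral \<mu> z"
    by (rule spectral_data_m_fun[OF q sin data]) blast
  obtain C where C: "\<And>z. Im z \<noteq> 0 \<Longrightarrow> norm (char_fun q \<alpha>1 \<beta> z) \<le> C * (1 + (norm z)\<^sup>2) / \<bar>Im z\<bar> * norm (char_fun q \<alpha>2 \<beta> z)"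
    by (rule spectral_data_bounds[OF q sin data]) blast
  define \<Delta>1 where "\<Delta>1 = char_fun q \<alpha>1 \<beta>"
  define \<Delta>2 where "\<Delta>2 = char_fun q \<alpha>2 \<beta>"
  define s where "s = complex_of_real (sin (\<alpha>2 - \<alpha>1))"
  define c where "c = complex_of_real (a n)"
  have s: "s \<noteq> 0" using sin by (simp add: s_def)
  have h: "\<Delta>1 holomorphic_on UNIV" "\<Delta>2 holomorphic_on UNIV"
    unfolding \<Delta>1_def \<Delta>2_def by (rule char_fun_holomorphic[OF q])+
  have z2: "\<Delta>2 c = 0" using enumerates_char_fun(1)[OF q zeros(1)] by (auto simp: \<Delta>2_def c_def)
  have z1: "\<Delta>1 c \<noteq> 0"
    using z2 char_fun_no_common_zero[OF q sin] by (auto simp: \<Delta>1_def \<Delta>2_def)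
  show d: "deriv (char_fun q \<alpha>2 \<beta>) (of_real (a n)) \<noteq> 0"
    by (rule deriv_nonzero_of_vertical_bound[OF h(2)[unfolded \<Delta>2_def] h(1)[unfolded \<Delta>1_def] C])
      (use z1 z2 in \<open>auto simp: \<Delta>1_def \<Delta>2_def c_def\<close>)
  define w where "w = (\<lambda>n. c + \<i> * complex_of_real (1 / real (Suc n)))"
  have "filterlim (\<lambda>n. 1 / real (Suc n)) (at_right 0) sequentially"
    unfolding filterlim_at_right_to_top[symmetric] filterlim_at by (auto intro!: LIMSEQ_Suc[OF lim_1_over_n] simp del: of_nat_Suc)
  then have w: "filterlim w (at c) sequentially"
    unfolding w_def by (rule filterlim_compose[OF tendsto_imag_approach])
  then have wn: "w \<longlonglongrightarrow> c" by (simp add: filterlim_at)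
  have "(\<Delta>2 has_field_derivative deriv \<Delta>2 c) (at c)" by (rule holomorphic_derivI[OF h(2)]) auto
  then have "((\<lambda>z. \<Delta>2 z / (z - c)) \<longlongrightarrow> deriv \<Delta>2 c) (at c)" by (simp add: has_field_derivative_iff z2)
  then have l2: "(\<lambda>n. \<Delta>2 (w n) / (w n - c)) \<longlonglongrightarrow> deriv \<Delta>2 c" by (rule filterlim_compose[OF _ w])
  have l1: "(\<lambda>n. \<Delta>1 (w n)) \<longlonglongrightarrow> \<Delta>1 c" by (rule isCont_tendsto_compose[OF isCont_entire[OF h(1)] wn])
  have wc: "w n - c = \<i> * of_real (1 / real (Suc n))" for n by (simp add: w_def)
  have wc0: "w n - c \<noteq> 0" for n unfolding wc by (simp add: complex_eq_iff del: of_nat_Suc)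
  have lim1: "(\<lambda>n. - (\<Delta>1 (w n) / (\<Delta>2 (w n) / (w n - c)) / s)) \<longlonglongrightarrow> - (\<Delta>1 c / deriv \<Delta>2 c / s)"
    using d s by (intro tendsto_intros l1 l2) (auto simp: \<Delta>2_def c_def)
  \<comment> \<open>Multiplying the representation by \<open>- (w n - c)\<close> makes the constant
    disappear in the limit and leaves the point mass.\<close>
  have eq: "- (\<Delta>1 (w n) / (\<Delta>2 (w n) / (w n - c)) / s) = - (w n - c) * of_real d + - (w n - c) * Herglotz_integral \<mu> (w n)" for n
  proof -
    have "Im (w n) \<noteq> 0" by (simp add: w_def c_def del: of_nat_Suc)
    from rep[OF this] have "\<Delta>1 (w n) / \<Delta>2 (w n) / s = of_real d + Herglotz_integral \<mu> (w n)"
      by (simp add: \<Delta>1_def \<Delta>2_def s_def)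
    moreover have "- (\<Delta>1 (w n) / (\<Delta>2 (w n) / (w n - c)) / s) = - (w n - c) * (\<Delta>1 (w n) / \<Delta>2 (w n) / s)"
    proof -
      have "- (x / (y / d) / s) = - d * (x / y / s)" for x y d :: complex by (simp add: mult.commute)
      then show ?thesis .
    qed
    ultimately show ?thesis by (simp only: distrib_left)
  qed
  have "(\<lambda>n. - (w n - c) * of_real d + - (w n - c) * Herglotz_integral \<mu> (w n)) \<longlonglongrightarrow> - (c - c) * of_real d + of_real (measure \<mu> {a n})"
  proof (intro tendsto_add)
    show "(\<lambda>n. - (w n - c) * of_real d) \<longlonglongrightarrow> - (c - c) * of_real d" by (intro tendsto_intros wn)
    show "(\<lambda>n. - (w n - c) * Herglotz_integral \<mu> (w n)) \<longlonglongrightarrow> of_real (measure \<mu> {a n})"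
      using Herglotz_integral_point_mass[OF sets int, of "a n"] unfolding wc w_def c_def by simp
  qed
  then have "(\<lambda>n. - (\<Delta>1 (w n) / (\<Delta>2 (w n) / (w n - c)) / s)) \<longlonglongrightarrow> of_real (\<gamma> n)"
    unfolding eq \<gamma> by simp
  then have "- (\<Delta>1 c / deriv \<Delta>2 c / s) = of_real (\<gamma> n)"
    using lim1 LIMSEQ_unique by blast
  then have "\<Delta>1 c = - (of_real (\<gamma> n) * s * deriv \<Delta>2 c)"
  proof -
    have "x = - (g * s * y)" if "- (x / y / s) = g" "y \<noteq> 0" for x y g :: complex
    proof -
      have "- x = g * s * y" using that s by (auto simp: field_simps)
      then have "- (- x) = - (g * s * y)" by (rule arg_cong)
      then show ?thesis by (simp only: minus_minus)
    qed
    from this[OF \<open>- (\<Delta>1 c / deriv \<Delta>2 c / s) = of_real (\<gamma> n)\<close> d[folded \<Delta>2_def c_def]]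
    show ?thesis .
  qed
  then show "char_fun q \<alpha>1 \<beta> (of_real (a n)) = - of_real (\<gamma> n * sin (\<alpha>2 - \<alpha>1)) * deriv (char_fun q \<alpha>2 \<beta>) (of_real (a n))"
    by (simp add: \<Delta>1_def \<Delta>2_def c_def s_def)
qed

section \<open>Equality of the second characteristic functions\<close>

lemma char_fun_growth:
  assumes q: "potential q"
  obtains K R where "R \<ge> 1" "K \<ge> 1"
    "\<And>z. norm z \<ge> R \<Longrightarrow> norm (char_fun q \<alpha> \<beta> z) \<le> K * exp (K * sqrt (norm z))"
proof -
  define R where "R = max 1 ((2 * pot_norm q)\<^sup>2)"
  have "norm (char_fun q \<alpha> \<beta> z) \<le> 14 * exp (14 * sqrt (norm z))" if z: "norm z \<ge> R" for z
  proof -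
    define y where "y = ivp_sol q (of_real (sin \<alpha>)) (of_real (cos \<alpha>)) z"
    define y' where "y' = ivp_der q (of_real (sin \<alpha>)) (of_real (cos \<alpha>)) z"
    have s: "solves q z (\<lambda>_. 0) y y'" unfolding y_def y'_def by (rule sl_ivp(1)[OF q])
    have "norm (char_fun q \<alpha> \<beta> z) \<le> norm (complex_of_real (cos \<beta>)) * norm (y pi) + norm (complex_of_real (sin \<beta>)) * norm (y' pi)"
      unfolding char_fun_def y_def[symmetric] y'_def[symmetric] norm_mult[symmetric] by (rule norm_triangle_ineq)
    also have "\<dots> \<le> 1 * norm (y pi) + 1 * norm (y' pi)"
      by (intro add_mono mult_right_mono) auto
    also have "\<dots> \<le> 7 * (norm (y 0) + norm (y' 0)) * exp (5 * sqrt (norm z))"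
      using solves_growth[OF q s z[unfolded R_def], of pi] by simp
    also have "\<dots> \<le> 7 * (1 + 1) * exp (14 * sqrt (norm z))"
      by (intro mult_mono add_mono) (auto simp: y_def y'_def sl_ivp(2,3)[OF q])
    finally show ?thesis by simp
  qed
  then show thesis using that[of R 14] by (simp add: R_def)
qed

text \<open>The growth estimate read backwards: the solution has size at least \<open>1\<close> at
  \<open>pi\<close>, so its initial values cannot be smaller than a multiple of
  \<open>exp (- 5 * sqrt (norm z))\<close>.\<close>

lemma terminal_solution_lower_bound:
  assumes q: "potential q" and s: "solves q z (\<lambda>_. 0) u v"
    and T: "u pi = of_real (sin \<beta>)" "v pi = - of_real (cos \<beta>)"
    and z: "norm z \<ge> max 1 ((2 * pot_norm q)\<^sup>2)"
  shows "1 \<le> 7 * (norm (u 0) + norm (v 0)) * exp (5 * sqrt (norm z))"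
proof -
  have "1 = \<bar>cos \<beta>\<bar>\<^sup>2 + \<bar>sin \<beta>\<bar>\<^sup>2" by simp
  also have "\<dots> \<le> \<bar>cos \<beta>\<bar> * 1 + \<bar>sin \<beta>\<bar> * 1"
    unfolding power2_eq_square by (intro add_mono mult_left_mono) auto
  also have "\<dots> = norm (u pi) + norm (v pi)" by (simp add: T)
  also have "\<dots> \<le> 7 * (norm (u 0) + norm (v 0)) * exp (5 * sqrt (norm z))"
    by (rule solves_growth[OF q s z]) auto
  finally show ?thesis .
qed

text \<open>Quantitative form of Cramer's rule; with the lower bound for initial values it prevents
  both characteristic functions from being small at once.\<close>

lemma initial_values_le_char_fun:
  fixes \<alpha>1 \<alpha>2 :: real and x y :: complex
  assumes "sin (\<alpha>2 - \<alpha>1) \<noteq> 0"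
  shows "\<bar>sin (\<alpha>2 - \<alpha>1)\<bar> * (norm x + norm y) \<le>
    2 * (norm (of_real (cos \<alpha>1) * x - of_real (sin \<alpha>1) * y) + norm (of_real (cos \<alpha>2) * x - of_real (sin \<alpha>2) * y))"
proof -
  define A where "A = of_real (cos \<alpha>1) * x - of_real (sin \<alpha>1) * y"
  define B where "B = of_real (cos \<alpha>2) * x - of_real (sin \<alpha>2) * y"
  have d: "complex_of_real (sin (\<alpha>2 - \<alpha>1)) = of_real (sin \<alpha>2) * of_real (cos \<alpha>1) - of_real (cos \<alpha>2) * of_real (sin \<alpha>1)"
    by (simp add: sin_diff)
  have e: "of_real (sin (\<alpha>2 - \<alpha>1)) * x = of_real (sin \<alpha>2) * A - of_real (sin \<alpha>1) * B"
    "of_real (sin (\<alpha>2 - \<alpha>1)) * y = of_real (cos \<alpha>2) * A - of_real (cos \<alpha>1) * B"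
    unfolding d A_def B_def by (simp_all add: algebra_simps)
  have le: "norm (of_real c * A - of_real c' * B) \<le> norm A + norm B" if "\<bar>c\<bar> \<le> 1" "\<bar>c'\<bar> \<le> 1" for c c' :: real
  proof -
    have "norm (of_real c * A - of_real c' * B) \<le> \<bar>c\<bar> * norm A + \<bar>c'\<bar> * norm B"
      by (rule order_trans[OF norm_triangle_ineq4]) (simp add: norm_mult)
    also have "\<dots> \<le> 1 * norm A + 1 * norm B" using that by (intro add_mono mult_right_mono) auto
    finally show ?thesis by simp
  qed
  have "\<bar>sin (\<alpha>2 - \<alpha>1)\<bar> * norm x \<le> norm A + norm B"
    using le[of "sin \<alpha>2" "sin \<alpha>1"] unfolding e(1)[symmetric] by (simp add: norm_mult)
  moreover have "\<bar>sin (\<alpha>2 - \<alpha>1)\<bar> * norm y \<le> norm A + norm B"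
    using le[of "cos \<alpha>2" "cos \<alpha>1"] unfolding e(2)[symmetric] by (simp add: norm_mult)
  ultimately show ?thesis by (simp add: A_def B_def distrib_left)
qed

text \<open>The point is the growth of the quotient \<open>Q\<close>, which needs a lower bound for
  its denominator. The sum of both characteristic functions is bounded below through the initial
  values, and the Herglotz bound trades the first for the second off the real axis.\<close>

lemma char_fun_eq_of_same_zeros:
  assumes q: "potential q" and q': "potential q'" and sin: "sin (\<alpha>2 - \<alpha>1) \<noteq> 0"
    and data: "spectral_data q \<alpha>1 \<alpha>2 \<beta> a b \<gamma>" and data': "spectral_data q' \<alpha>1 \<alpha>2 \<beta> a b' \<gamma>'"
  shows "char_fun q \<alpha>2 \<beta> z = char_fun q' \<alpha>2 \<beta> z"
proof -
  define \<Delta>1 where "\<Delta>1 = char_fun q \<alpha>1 \<beta>"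
  define \<Delta>2 where "\<Delta>2 = char_fun q \<alpha>2 \<beta>"
  define \<Delta>2' where "\<Delta>2' = char_fun q' \<alpha>2 \<beta>"
  have h: "\<Delta>2 holomorphic_on UNIV" "\<Delta>2' holomorphic_on UNIV"
    unfolding \<Delta>2_def \<Delta>2'_def by (rule char_fun_holomorphic, fact)+
  have a: "enumerates_incr a (sl_spectrum q \<alpha>2 \<beta>)" "enumerates_incr a (sl_spectrum q' \<alpha>2 \<beta>)"
    using data data' by (auto simp: spectral_data_def)
  have zeros: "\<Delta>2 z = 0 \<longleftrightarrow> z \<in> range (\<lambda>n. complex_of_real (a n))" "\<Delta>2' z = 0 \<longleftrightarrow> z \<in> range (\<lambda>n. complex_of_real (a n))" for z
    unfolding \<Delta>2_def \<Delta>2'_def using enumerates_char_fun(1) q q' a by blast+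
  have simple: "deriv \<Delta>2 z \<noteq> 0" if "\<Delta>2 z = 0" for z
    using that zeros spectral_data_residue(1)[OF q sin data] by (auto simp: \<Delta>2_def)
  obtain Q where Q: "Q holomorphic_on UNIV" "\<And>z. \<Delta>2' z = Q z * \<Delta>2 z"
    using entire_divide_simple_zeros[OF h(2,1)] zeros simple by blast
  obtain C where C: "C \<ge> 0" "\<And>z. Im z \<noteq> 0 \<Longrightarrow> norm (\<Delta>1 z) \<le> C * (1 + (norm z)\<^sup>2) / \<bar>Im z\<bar> * norm (\<Delta>2 z)"
    unfolding \<Delta>1_def \<Delta>2_def by (rule spectral_data_bounds[OF q sin data]) blast
  obtain K R1 where K: "R1 \<ge> 1" "K \<ge> 1" "\<And>z. norm z \<ge> R1 \<Longrightarrow> norm (\<Delta>2' z) \<le> K * exp (K * sqrt (norm z))"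
    unfolding \<Delta>2'_def by (rule char_fun_growth[OF q']) blast
  define R where "R = max R1 (max 1 ((2 * pot_norm q)\<^sup>2))"
  define s where "s = \<bar>sin (\<alpha>2 - \<alpha>1)\<bar>"
  have s: "s > 0" using sin by (simp add: s_def)
  \<comment> \<open>Here \<open>14 / s\<close> combines the \<open>7\<close> of the growth estimate
    with the \<open>2 / s\<close> of Cramer's rule, and \<open>2 * C + 1\<close> comes from
    replacing the first characteristic function by the second.\<close>
  define L where "L = 14 / s * (2 * C + 1)"
  have L: "L > 0" using s C(1) by (simp add: L_def)
  have lower: "1 \<le> L * norm z * exp (norm z / \<bar>Im z\<bar>) * exp (5 * sqrt (norm z)) * norm (\<Delta>2 z)"
    if z: "Im z \<noteq> 0" "norm z \<ge> R" for z
  proof -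
    obtain u v where uv: "solves q z (\<lambda>_. 0) u v" "u pi = of_real (sin \<beta>)" "v pi = - of_real (cos \<beta>)"
      by (rule sl_sol[OF q])
    define t where "t = norm z / \<bar>Im z\<bar>"
    have t1: "t \<ge> 1" using z abs_Im_le_cmod[of z] by (simp add: t_def pos_le_divide_eq)
    have n1: "norm z \<ge> 1" using z(2) by (simp add: R_def)
    have "C * (1 + (norm z)\<^sup>2) / \<bar>Im z\<bar> \<le> C * (2 * (norm z)\<^sup>2) / \<bar>Im z\<bar>"
      using C(1) n1 by (intro divide_right_mono mult_left_mono) (auto simp: one_le_power)
    also have "\<dots> = 2 * C * norm z * t" by (simp add: t_def power2_eq_square)
    also have "\<dots> \<le> 2 * C * norm z * exp t"
      using order_trans[OF _ exp_ge_add_one_self[of t], of t] C(1) by (intro mult_left_mono) auto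
    finally have q1: "C * (1 + (norm z)\<^sup>2) / \<bar>Im z\<bar> \<le> 2 * C * norm z * exp t" .
    have "norm (\<Delta>1 z) \<le> 2 * C * norm z * exp t * norm (\<Delta>2 z)"
      by (rule order_trans[OF C(2)[OF z(1)] mult_right_mono[OF q1]]) simp
    moreover have "1 * norm (\<Delta>2 z) \<le> norm z * exp t * norm (\<Delta>2 z)"
      using mult_mono[OF n1, of 1 "exp t"] t1 by (intro mult_right_mono) auto
    ultimately have D12: "norm (\<Delta>1 z) + norm (\<Delta>2 z) \<le> (2 * C + 1) * norm z * exp t * norm (\<Delta>2 z)"
      by (simp add: algebra_simps)
    have "s * (norm (u 0) + norm (v 0)) \<le> 2 * (norm (\<Delta>1 z) + norm (\<Delta>2 z))"
      unfolding s_def \<Delta>1_def \<Delta>2_def char_fun_terminal[OF q uv] by (rule initial_values_le_char_fun[OF sin])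
    also have "\<dots> \<le> 2 * ((2 * C + 1) * norm z * exp t * norm (\<Delta>2 z))"
      by (rule mult_left_mono[OF D12]) simp
    finally have "s * (norm (u 0) + norm (v 0)) \<le> 2 * ((2 * C + 1) * norm z * exp t * norm (\<Delta>2 z))" .
    then have uv0: "norm (u 0) + norm (v 0) \<le> 2 / s * ((2 * C + 1) * norm z * exp t * norm (\<Delta>2 z))"
      using s by (simp add: field_simps)
    have "1 \<le> 7 * (norm (u 0) + norm (v 0)) * exp (5 * sqrt (norm z))"
      by (rule terminal_solution_lower_bound[OF q uv]) (use z(2) in \<open>simp add: R_def\<close>)
    also have "\<dots> \<le> 7 * (2 / s * ((2 * C + 1) * norm z * exp t * norm (\<Delta>2 z))) * exp (5 * sqrt (norm z))"
      using uv0 by (intro mult_right_mono mult_left_mono) auto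
    also have "\<dots> = L * norm z * exp t * exp (5 * sqrt (norm z)) * norm (\<Delta>2 z)"
    proof -
      have "7 * (2 / s * (k * n * e * d)) * f = (14 / s * k) * n * e * f * d" for k n e d f :: real by simp
      then show ?thesis unfolding L_def .
    qed
    finally show ?thesis unfolding t_def .
  qed
  have Q_le: "norm (Q z) \<le> K * L * norm z * exp ((K + 5) * sqrt (norm z)) * exp (norm z / \<bar>Im z\<bar>)"
    if z: "Im z \<noteq> 0" "norm z \<ge> R" for z
  proof -
    have nz: "norm (\<Delta>2 z) > 0" using zeros(1)[of z] z by auto
    have "norm (Q z) * norm (\<Delta>2 z) = norm (\<Delta>2' z) * 1" by (simp add: Q(2) norm_mult)
    also have "\<dots> \<le> (K * exp (K * sqrt (norm z))) * (L * norm z * exp (norm z / \<bar>Im z\<bar>) * exp (5 * sqrt (norm z)) * norm (\<Delta>2 z))"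
      using K(2) by (intro mult_mono K(3) lower z) (use z in \<open>auto simp: R_def\<close>)
    also have "\<dots> = (K * L * norm z * exp ((K + 5) * sqrt (norm z)) * exp (norm z / \<bar>Im z\<bar>)) * norm (\<Delta>2 z)"
      by (simp add: distrib_right exp_add)
    finally show ?thesis by (rule mult_right_le_imp_le) (rule nz)
  qed
  \<comment> \<open>The exponent uses \<open>sqrt (2 * norm z) \<le> 2 * sqrt (norm z)\<close>, and
    \<open>norm z \<le> exp (sqrt (norm z)) ^ 2\<close> adds the last \<open>2\<close>.\<close>
  define K' where "K' = max (2 * K * L * exp 40) (2 * (K + 5) + 2)"
  \<comment> \<open>The radius is \<open>4 * R\<close> because the estimate is invoked at points
    \<open>w\<close> with \<open>norm w \<ge> norm z / 4\<close>.\<close>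
  have QL: "Q z = 1" for z
  proof (rule entire_eq_limit[OF Q(1), where K = K' and R = "4 * R"])
    have "((\<lambda>z. \<Delta>2' z / \<Delta>2 z) \<longlongrightarrow> 1) imag_infinity"
      unfolding \<Delta>2'_def \<Delta>2_def by (rule char_fun_ratio[OF q' q])
    moreover have "\<forall>\<^sub>F z in imag_infinity. \<Delta>2' z / \<Delta>2 z = Q z"
      unfolding eventually_imag_infinity
    proof (intro exI[of _ 1] allI impI)
      fix z :: complex assume "Re z = 0" "norm z \<ge> 1"
      then have "Im z \<noteq> 0" by (auto simp: complex_eq_iff cmod_eq_Im)
      then have "\<Delta>2 z \<noteq> 0" using zeros by auto
      then show "\<Delta>2' z / \<Delta>2 z = Q z" by (simp add: Q(2))
    qed
    ultimately show "(Q \<longlongrightarrow> 1) imag_infinity" by (rule Lim_transform_eventually)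
    fix z :: complex assume z: "norm z \<ge> 4 * R"
    have R1: "R \<ge> 1" by (simp add: R_def)
    have KL: "K * L \<ge> 0" using K(2) L by simp
    have "norm (Q z) \<le> (K * L * (2 * norm z) * exp ((K + 5) * sqrt (2 * norm z))) * exp (40 * 1)"
    proof (rule holomorphic_bound_off_real_axis[OF Q(1)])
      fix w assume w: "Im w \<noteq> 0" "norm z / 4 \<le> norm w" "norm w \<le> 2 * norm z"
      have "norm (Q w) \<le> K * L * norm w * exp ((K + 5) * sqrt (norm w)) * exp (norm w / \<bar>Im w\<bar>)"
        by (rule Q_le[OF w(1)]) (use w z in simp)
      also have "\<dots> \<le> K * L * (2 * norm z) * exp ((K + 5) * sqrt (2 * norm z)) * exp (1 * norm w / \<bar>Im w\<bar>)"
        using w KL K(2) by (intro mult_mono mult_left_mono) auto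
      finally show "norm (Q w) \<le> K * L * (2 * norm z) * exp ((K + 5) * sqrt (2 * norm z)) * exp (1 * norm w / \<bar>Im w\<bar>)" .
    qed (use z R1 KL in auto)
    also have "\<dots> = (2 * K * L * exp 40) * (norm z * exp ((K + 5) * sqrt (2 * norm z)))" by simp
    also have "\<dots> \<le> (2 * K * L * exp 40) * (exp (sqrt (norm z)) ^ 2 * exp ((K + 5) * (2 * sqrt (norm z))))"
    proof (intro mult_left_mono mult_mono)
      have "norm z = sqrt (norm z) ^ 2" by simp
      also have "\<dots> \<le> exp (sqrt (norm z)) ^ 2"
        using order_trans[OF _ exp_ge_add_one_self, of "sqrt (norm z)" "sqrt (norm z)"] by (intro power_mono) auto
      finally show "norm z \<le> exp (sqrt (norm z)) ^ 2" .
      have "sqrt (2 * norm z) \<le> sqrt (4 * norm z)" by simp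
      also have "\<dots> = 2 * sqrt (norm z)" by (simp add: real_sqrt_mult)
      finally show "exp ((K + 5) * sqrt (2 * norm z)) \<le> exp ((K + 5) * (2 * sqrt (norm z)))"
        using K(2) by simp
    qed (use KL in auto)
    also have "\<dots> = (2 * K * L * exp 40) * exp ((2 * (K + 5) + 2) * sqrt (norm z))"
      by (simp add: algebra_simps flip: exp_add exp_of_nat_mult)
    also have "\<dots> \<le> K'' * exp (K'' * sqrt (norm z))"
      if "K'' = max (2 * K * L * exp 40) (2 * (K + 5) + 2)" for K''
      using KL that by (intro mult_mono) (auto intro!: mult_right_mono simp: le_max_iff_disj)
    finally show "norm (Q z) \<le> K' * exp (K' * sqrt (norm z))" unfolding K'_def by simp
  qed
  show ?thesis using Q(2)[of z] QL by (simp add: \<Delta>2_def \<Delta>2'_def)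
qed

subsection \<open>Uniqueness of the potential\<close>

text \<open>A Green's function on the diagonal, with the left solution taken from one potential and
  the right solution from the other. The exponentials over \<open>[0, x]\<close> and
  \<open>[x, pi]\<close> multiply to that of the characteristic function, and one factor
  \<open>1 / \<kappa>\<close> remains.\<close>

lemma product_tends_to_zero:
  fixes \<beta> x :: real
  assumes q: "potential q" and q': "potential q'" and x: "0 \<le> x" "x \<le> pi"
  defines "U \<equiv> \<lambda>z. ivp_sol (\<lambda>x. q' (pi - x)) (of_real (sin \<beta>)) (of_real (cos \<beta>)) z"
  shows "((\<lambda>z. ivp_sol q 0 1 z x * U z (pi - x) / char_fun q' 0 \<beta> z) \<longlongrightarrow> 0) imag_infinity"
proof -
  define qr where "qr = (\<lambda>x. q' (pi - x))"
  have qr: "potential qr" unfolding qr_def by (rule potential_reflect[OF q'])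
  obtain K where K: "K \<ge> 1" "\<And>\<kappa>. norm \<kappa> \<ge> K \<Longrightarrow> norm (of_real (cos \<beta>) - \<kappa> * of_real (sin \<beta>)) \<le> 3 * norm (bfactor \<beta> \<kappa>)"
    "\<And>\<kappa>. norm \<kappa> \<ge> K \<Longrightarrow> norm (bfactor \<beta> \<kappa>) \<ge> 1/4"
    by (rule boundary_factor_bound[of \<beta>]) (auto simp: bfactor_def)
  have lim: "((\<lambda>z. 32 / norm (csqrt (- z))) \<longlongrightarrow> 0) imag_infinity"
  proof -
    have "((\<lambda>k. 32 / k) \<longlongrightarrow> (0::real)) at_top" by real_asymp
    then show ?thesis by (rule filterlim_compose[OF _ filterlim_norm_csqrt])
  qed
  have "\<forall>\<^sub>F z in imag_infinity. norm (csqrt (- z)) \<ge> max (max 1 K) (max (2 * pot_norm q) (2 * pot_norm qr))"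
    by (rule eventually_norm_csqrt_ge)
  moreover have "\<forall>\<^sub>F z in imag_infinity. Re z = 0" by (auto simp: eventually_imag_infinity)
  moreover have "\<forall>\<^sub>F z in imag_infinity. dist (char_fun q' 0 \<beta> z / char_lead 0 \<beta> z) 1 < 1/2"
    using char_fun_asymptotic[OF q', of 0 \<beta>] by (rule tendstoD) simp
  ultimately have "\<forall>\<^sub>F z in imag_infinity. norm (ivp_sol q 0 1 z x * U z (pi - x) / char_fun q' 0 \<beta> z) \<le> 32 / norm (csqrt (- z))"
  proof eventually_elim
    case (elim z)
    define \<kappa> where "\<kappa> = csqrt (- z)"
    have \<kappa>2: "- (\<kappa>\<^sup>2) = z" by (simp add: \<kappa>_def)
    have k: "norm \<kappa> \<ge> 1" "norm \<kappa> \<ge> K" "norm \<kappa> \<ge> 2 * pot_norm q" "norm \<kappa> \<ge> 2 * pot_norm qr"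
      using elim(1) unfolding \<kappa>_def max.bounded_iff by linarith+
    have \<kappa>0: "\<kappa> \<noteq> 0" using k(1) by auto
    have Re: "Re \<kappa> \<ge> norm \<kappa> / 2" unfolding \<kappa>_def by (rule Re_csqrt_imag_axis[OF elim(2)])
    have Re0: "Re \<kappa> \<ge> 0" by (rule order_trans[OF _ Re]) simp
    have nk: "norm \<kappa> > 0" using \<kappa>0 by simp
    define b where "b = norm (bfactor \<beta> \<kappa>)"
    have b: "b > 0" unfolding b_def by (rule less_le_trans[OF _ K(3)[OF k(2)]]) simp
    have u1: "norm (ivp_sol q 0 1 z x) \<le> 2 * exp (Re \<kappa> * x) / norm \<kappa>"
      using solution_estimate(1)[OF q, of \<kappa>, unfolded \<kappa>2, OF sl_ivp(1)[OF q, of z 0 1] Re0 \<kappa>0 k(3) x] nk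
      by (simp add: sl_ivp(2,3)[OF q] field_simps)
    have x': "0 \<le> pi - x" "pi - x \<le> pi" using x by auto
    have "norm \<kappa> * norm (U z (pi - x)) \<le> (norm (of_real (cos \<beta>) + \<kappa> * of_real (sin \<beta>)) + norm (of_real (cos \<beta>) - \<kappa> * of_real (sin \<beta>))) * exp (Re \<kappa> * (pi - x))"
      using solution_estimate(1)[OF qr, of \<kappa>, unfolded \<kappa>2, OF sl_ivp(1)[OF qr, of z "of_real (sin \<beta>)" "of_real (cos \<beta>)"] Re0 \<kappa>0 k(4) x']
      unfolding sl_ivp(2,3)[OF qr] by (simp add: U_def qr_def)
    also have "\<dots> \<le> (b + 3 * b) * exp (Re \<kappa> * (pi - x))"
      using K(2)[OF k(2)] unfolding b_def bfactor_def by (intro mult_right_mono add_mono) auto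
    finally have u2: "norm (U z (pi - x)) \<le> 4 * b * exp (Re \<kappa> * (pi - x)) / norm \<kappa>"
      using nk by (simp add: field_simps)
    have lead: "norm (char_lead 0 \<beta> z) = exp (Re \<kappa> * pi) * b / (2 * norm \<kappa>)"
      by (simp add: char_lead_def Let_def bfactor_def[of 0] norm_mult norm_divide b_def flip: \<kappa>_def)
    have c: "norm (char_fun q' 0 \<beta> z) \<ge> exp (Re \<kappa> * pi) * b / (4 * norm \<kappa>)"
    proof -
      have "1 - norm (char_fun q' 0 \<beta> z / char_lead 0 \<beta> z) \<le> norm (char_fun q' 0 \<beta> z / char_lead 0 \<beta> z - 1)"
        using norm_triangle_ineq2[of 1 "char_fun q' 0 \<beta> z / char_lead 0 \<beta> z"] by (simp add: norm_minus_commute)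
      then have "norm (char_fun q' 0 \<beta> z) / norm (char_lead 0 \<beta> z) \<ge> 1/2"
        using elim(3) by (simp add: dist_norm norm_divide)
      moreover have "norm (char_lead 0 \<beta> z) > 0" unfolding lead using b nk by simp
      ultimately have "norm (char_fun q' 0 \<beta> z) \<ge> norm (char_lead 0 \<beta> z) / 2" by (simp add: field_simps)
      then show ?thesis by (simp add: lead)
    qed
    have cpos: "exp (Re \<kappa> * pi) * b / (4 * norm \<kappa>) > 0" using b nk by simp
    have "norm (ivp_sol q 0 1 z x * U z (pi - x) / char_fun q' 0 \<beta> z) = norm (ivp_sol q 0 1 z x) * norm (U z (pi - x)) / norm (char_fun q' 0 \<beta> z)"
      by (simp add: norm_mult norm_divide)
    \<comment> \<open>The \<open>2\<close> comes from the data \<open>(0, 1)\<close>, the first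
      \<open>4 = 1 + 3\<close> from the boundary factors at \<open>pi\<close>, and the last
      \<open>4\<close> from the characteristic function being at least half its leading
      term.\<close>
    also have "\<dots> \<le> (2 * exp (Re \<kappa> * x) / norm \<kappa>) * (4 * b * exp (Re \<kappa> * (pi - x)) / norm \<kappa>) / (exp (Re \<kappa> * pi) * b / (4 * norm \<kappa>))"
      using u1 u2 c cpos b nk by (intro frac_le mult_mono) auto
    also have "\<dots> = 32 / norm \<kappa> * (exp (Re \<kappa> * x) * exp (Re \<kappa> * (pi - x)) / exp (Re \<kappa> * pi))"
      using b nk by (simp add: field_simps)
    also have "exp (Re \<kappa> * x) * exp (Re \<kappa> * (pi - x)) = exp (Re \<kappa> * pi)"
      by (simp add: algebra_simps flip: exp_add)
    finally show ?case by (simp add: \<kappa>_def)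
  qed
  then show ?thesis by (rule Lim_null_comparison[OF _ lim])
qed

text \<open>The terminal solutions are \<open>char_fun 0\<close> times \<open>\<theta>\<close> minus
  \<open>char_fun (pi / 2)\<close> times \<open>\<phi>\<close>, with the same coefficients for both
  potentials. Multiplied by \<open>char_fun 0\<close>, the function \<open>f\<close> thus becomes a
  difference of mixed products of left and right solutions, to which
  \<open>product_tends_to_zero\<close> applies.\<close>

lemma fundamental_solutions_parallel:
  assumes q: "potential q" and q': "potential q'"
    and eq: "\<And>z. char_fun q 0 \<beta> z = char_fun q' 0 \<beta> z" "\<And>z. char_fun q (pi / 2) \<beta> z = char_fun q' (pi / 2) \<beta> z"
    and x: "0 \<le> x" "x \<le> pi"
  shows "ivp_sol q 0 1 z x * ivp_sol q' 1 0 z x = ivp_sol q 1 0 z x * ivp_sol q' 0 1 z x"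
proof -
  define f where "f = (\<lambda>z. ivp_sol q 0 1 z x * ivp_sol q' 1 0 z x - ivp_sol q 1 0 z x * ivp_sol q' 0 1 z x)"
  have hol: "f holomorphic_on UNIV"
    unfolding f_def by (intro holomorphic_intros ivp_holomorphic q q' x)
  define U where "U = (\<lambda>z. ivp_sol (\<lambda>x. q (pi - x)) (of_real (sin \<beta>)) (of_real (cos \<beta>)) z)"
  define U' where "U' = (\<lambda>z. ivp_sol (\<lambda>x. q' (pi - x)) (of_real (sin \<beta>)) (of_real (cos \<beta>)) z)"
  have dec: "U z (pi - x) = char_fun q 0 \<beta> z * ivp_sol q 1 0 z x + (- char_fun q (pi / 2) \<beta> z) * ivp_sol q 0 1 z x"
    if q: "potential q" and U: "U = (\<lambda>z. ivp_sol (\<lambda>x. q (pi - x)) (of_real (sin \<beta>)) (of_real (cos \<beta>)) z)" for q U z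
  proof -
    define V where "V = ivp_der (\<lambda>x. q (pi - x)) (of_real (sin \<beta>)) (of_real (cos \<beta>)) z"
    note T = terminal_solution[OF q, where \<beta> = \<beta> and z = z, folded V_def]
    have UT: "ivp_sol (\<lambda>x. q (pi - x)) (of_real (sin \<beta>)) (of_real (cos \<beta>)) z = U z" by (simp add: U)
    note T = T[unfolded UT]
    have c: "char_fun q 0 \<beta> z = U z (pi - 0)" "- char_fun q (pi / 2) \<beta> z = - V (pi - 0)"
      using char_fun_terminal[OF q T, of 0] char_fun_terminal[OF q T, of "pi / 2"] by simp_all
    have "U z (pi - x) = ivp_sol q (U z (pi - 0)) (- V (pi - 0)) z x"
      by (rule solves_eq_ivp(1)[OF q T(1) x])
    also have "\<dots> = ivp_sol q (U z (pi - 0) * 1 + (- V (pi - 0)) * 0) (U z (pi - 0) * 0 + (- V (pi - 0)) * 1) z x" by simp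
    also have "\<dots> = U z (pi - 0) * ivp_sol q 1 0 z x + (- V (pi - 0)) * ivp_sol q 0 1 z x"
      by (rule ivp_lincomb(1)[OF q x])
    finally show ?thesis unfolding c .
  qed
  have fz: "f z * char_fun q 0 \<beta> z = ivp_sol q 0 1 z x * U' z (pi - x) - ivp_sol q' 0 1 z x * U z (pi - x)" for z
    unfolding dec[OF q U_def] dec[OF q' U'_def] f_def eq[symmetric] by (simp add: algebra_simps)
  have "f z = 0" for z
  proof -
    define R where "R = max (max 1 ((2 * pot_norm q)\<^sup>2)) ((2 * pot_norm q')\<^sup>2)"
    \<comment> \<open>Two products of two such factors give the constant
      \<open>98 = 2 * 7 * 7\<close>.\<close>
    have bound: "norm (ivp_sol p c d z x) \<le> 7 * exp (5 * sqrt (norm z))"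
      if "potential p" "norm z \<ge> max 1 ((2 * pot_norm p)\<^sup>2)" "norm c + norm d = 1" for p c d z
    proof -
      have "norm (ivp_sol p c d z x) + norm (ivp_der p c d z x) \<le> 7 * exp (5 * sqrt (norm z))"
        using solves_growth[OF that(1) sl_ivp(1)[OF that(1), of z c d] that(2) x] that(3)
        by (simp add: sl_ivp(2,3)[OF that(1)])
      then show ?thesis using norm_ge_zero[of "ivp_der p c d z x"] by linarith
    qed
    show ?thesis
    proof (rule entire_eq_limit[OF hol, where K = 98 and R = R])
      fix z :: complex assume "norm z \<ge> R"
      then have z: "norm z \<ge> max 1 ((2 * pot_norm q)\<^sup>2)" "norm z \<ge> max 1 ((2 * pot_norm q')\<^sup>2)"
        by (auto simp: R_def)
      define E where "E = 7 * exp (5 * sqrt (norm z))"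
      have "norm (f z) \<le> norm (ivp_sol q 0 1 z x) * norm (ivp_sol q' 1 0 z x) + norm (ivp_sol q 1 0 z x) * norm (ivp_sol q' 0 1 z x)"
        unfolding f_def norm_mult[symmetric] by (rule norm_triangle_ineq4)
      also have "\<dots> \<le> E * E + E * E"
        unfolding E_def by (intro add_mono mult_mono bound q q' z) auto
      also have "\<dots> = 98 * exp (10 * sqrt (norm z))" by (simp add: E_def flip: exp_add)
      also have "\<dots> \<le> 98 * exp (98 * sqrt (norm z))" by simp
      finally show "norm (f z) \<le> 98 * exp (98 * sqrt (norm z))" .
    next
      have "((\<lambda>z. ivp_sol q 0 1 z x * U' z (pi - x) / char_fun q' 0 \<beta> z - ivp_sol q' 0 1 z x * U z (pi - x) / char_fun q 0 \<beta> z) \<longlongrightarrow> 0 - 0) imag_infinity"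
        unfolding U_def U'_def by (intro tendsto_diff product_tends_to_zero q q' x)
      then have l: "((\<lambda>z. ivp_sol q 0 1 z x * U' z (pi - x) / char_fun q' 0 \<beta> z - ivp_sol q' 0 1 z x * U z (pi - x) / char_fun q 0 \<beta> z) \<longlongrightarrow> 0) imag_infinity"
        by simp
      have "\<forall>\<^sub>F z in imag_infinity. dist (char_fun q 0 \<beta> z / char_lead 0 \<beta> z) 1 < 1/2"
        using char_fun_asymptotic[OF q, of 0 \<beta>] by (rule tendstoD) simp
      then have "\<forall>\<^sub>F z in imag_infinity. ivp_sol q 0 1 z x * U' z (pi - x) / char_fun q' 0 \<beta> z - ivp_sol q' 0 1 z x * U z (pi - x) / char_fun q 0 \<beta> z = f z"
      proof eventually_elim
        case (elim z)
        then have nz: "char_fun q 0 \<beta> z \<noteq> 0" by (auto simp: dist_norm)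
        have "ivp_sol q 0 1 z x * U' z (pi - x) / char_fun q' 0 \<beta> z - ivp_sol q' 0 1 z x * U z (pi - x) / char_fun q 0 \<beta> z
          = f z * char_fun q 0 \<beta> z / char_fun q 0 \<beta> z"
          unfolding fz eq(1)[symmetric] by (simp add: diff_divide_distrib)
        then show ?case using nz by simp
      qed
      then show "(f \<longlongrightarrow> 0) imag_infinity" by (rule Lim_transform_eventually[OF l])
    qed
  qed
  then show ?thesis by (simp add: f_def)
qed

text \<open>
  By Henstock's lemma: the Riemann sums of \<open>norm \<circ> f\<close> are sums of \<open>norm (content k *\<^sub>R f x - integral k f)\<close>,
  as all integrals over subintervals vanish.
\<close>

lemma AE_zero_of_indefinite_integral:
  fixes f :: "real \<Rightarrow> complex"
  assumes f: "f absolutely_integrable_on {0..pi}" and zero: "\<And>x. 0 \<le> x \<Longrightarrow> x \<le> pi \<Longrightarrow> integral {0..x} f = 0"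
  shows "AE x in lebesgue_on {0<..<pi}. f x = 0"
proof -
  have fi: "f integrable_on cbox 0 pi" using f by (simp add: absolutely_integrable_on_def)
  have sub0: "integral {c..d} f = 0" if "0 \<le> c" "d \<le> pi" for c d
  proof (cases "c \<le> d")
    case True
    have "integral {0..c} f + integral {c..d} f = integral {0..d} f"
      by (rule Henstock_Kurzweil_Integration.integral_combine)
        (use True that absint_integrable_on_sub(1)[OF f, of 0 d] in auto)
    then show ?thesis using zero[of c] zero[of d] True that by simp
  qed simp
  have "((\<lambda>x. norm (f x)) has_integral 0) (cbox 0 pi)"
    unfolding has_integral
  proof (intro allI impI)
    fix e :: real assume "e > 0"
    obtain \<gamma> where \<gamma>: "gauge \<gamma>"
      "\<And>p. p tagged_partial_division_of (cbox 0 pi) \<Longrightarrow> \<gamma> fine p \<Longrightarrow> (\<Sum>(x,k)\<in>p. norm (measure lborel k *\<^sub>R f x - integral k f)) < e"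
      by (rule Henstock_lemma[OF fi \<open>e > 0\<close>]) blast
    have "norm ((\<Sum>(x,k)\<in>p. measure lborel k *\<^sub>R norm (f x)) - 0) < e" if p: "p tagged_division_of cbox 0 pi" "\<gamma> fine p" for p
    proof -
      have "(\<Sum>(x,k)\<in>p. measure lborel k *\<^sub>R norm (f x)) = (\<Sum>(x,k)\<in>p. norm (measure lborel k *\<^sub>R f x - integral k f))"
      proof (rule sum.cong[OF refl], clarify)
        fix x k assume xk: "(x, k) \<in> p"
        obtain c d where k: "k = cbox c d" using tagged_division_ofD(4)[OF p(1) xk] by blast
        have "integral k f = 0"
        proof (cases "c \<le> d")
          case True
          then have "c \<in> k" "d \<in> k" by (auto simp: k)
          then have "0 \<le> c" "d \<le> pi" using tagged_division_ofD(3)[OF p(1) xk] by auto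
          then show ?thesis using sub0 by (simp add: k)
        qed (simp add: k)
        then show "measure lborel k *\<^sub>R norm (f x) = norm (measure lborel k *\<^sub>R f x - integral k f)" by simp
      qed
      moreover have "(\<Sum>(x,k)\<in>p. norm (measure lborel k *\<^sub>R f x - integral k f)) < e"
        using p by (intro \<gamma>(2)) (auto simp: tagged_division_of_def)
      moreover have "(\<Sum>(x,k)\<in>p. measure lborel k *\<^sub>R norm (f x)) \<ge> 0"
        by (intro sum_nonneg) auto
      ultimately show ?thesis by simp
    qed
    note fine_sum = this
    show "\<exists>\<gamma>. gauge \<gamma> \<and> (\<forall>\<D>. \<D> tagged_division_of cbox 0 pi \<and> \<gamma> fine \<D> \<longrightarrow> norm ((\<Sum>(x,k)\<in>\<D>. measure lborel k *\<^sub>R norm (f x)) - 0) < e)"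
    proof (intro exI conjI allI impI, rule \<gamma>(1), elim conjE)
      fix p assume "p tagged_division_of cbox 0 pi" "\<gamma> fine p"
      then show "norm ((\<Sum>(x,k)\<in>p. measure lborel k *\<^sub>R norm (f x)) - 0) < e" by (rule fine_sum)
    qed
  qed
  then have I0: "integral {0..pi} (\<lambda>x. norm (f x)) = 0" by (simp add: integral_unique)
  have nf: "(\<lambda>x. norm (f x)) absolutely_integrable_on {0..pi}"
    using absolutely_integrable_norm[OF f] by (simp add: o_def)
  have "integral\<^sup>L lebesgue (\<lambda>x. indicator {0..pi} x *\<^sub>R norm (f x)) = 0"
    using set_lebesgue_integral_eq_integral(2)[OF nf] I0 by (simp add: set_lebesgue_integral_def)
  then have "AE x in lebesgue. indicator {0..pi} x *\<^sub>R norm (f x) = 0"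
    using nf by (subst (asm) integral_nonneg_eq_0_iff_AE) (auto simp: set_integrable_def)
  then have "AE x in lebesgue. x \<in> {0<..<pi} \<longrightarrow> f x = 0"
    by eventually_elim (auto simp: indicator_def split: if_splits)
  then show ?thesis by (subst AE_restrict_space_iff) auto
qed

section \<open>Recovering the potential from the fundamental solutions\<close>

lemma ac_deriv_zero_continuous:
  assumes "ac_deriv (\<lambda>x. 0) g" and g: "continuous_on {0..pi} g" and x: "0 \<le> x" "x \<le> pi"
  shows "g x = 0"
proof -
  have zero: "integral {0..y} g = 0" if "0 \<le> y" "y \<le> pi" for y
    using ac_deriv_eq[OF assms(1) that] by simp
  have "((\<lambda>u. integral {0..u} g) has_vector_derivative g x) (at x within {0..pi})"
    by (rule integral_has_vector_derivative[OF g]) (use x in auto)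
  moreover have "((\<lambda>u. integral {0..u} g) has_vector_derivative 0) (at x within {0..pi})"
    by (rule has_vector_derivative_transform[where f = "\<lambda>_. 0"]) (use x zero in auto)
  ultimately show "g x = 0"
    using vector_derivative_unique_within_closed_interval[of 0 pi x] x by auto
qed

text \<open>Parallel pairs differ by a scalar function \<open>l\<close>. Both Wronskians being
  \<open>1\<close> forces \<open>l * l = 1\<close>, and continuity with \<open>l 0 = 1\<close>
  excludes the other sign.\<close>

theorem potential_unique:
  assumes q: "potential q" and q': "potential q'"
    and eq: "\<And>z. char_fun q 0 \<beta> z = char_fun q' 0 \<beta> z" "\<And>z. char_fun q (pi / 2) \<beta> z = char_fun q' (pi / 2) \<beta> z"
  shows "AE x in lebesgue_on {0<..<pi}. q' x = q x"
proof -
  \<comment> \<open>The spectral parameter has done its work in the parallelism; from here on one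
    value suffices, and \<open>0\<close> removes a term.\<close>
  define z where "z = (0::complex)"
  define S where "S = ivp_sol q 0 1 z" define S1 where "S1 = ivp_der q 0 1 z"
  define C where "C = ivp_sol q 1 0 z" define C1 where "C1 = ivp_der q 1 0 z"
  define S' where "S' = ivp_sol q' 0 1 z" define S1' where "S1' = ivp_der q' 0 1 z"
  define C' where "C' = ivp_sol q' 1 0 z" define C1' where "C1' = ivp_der q' 1 0 z"
  have s: "solves q z (\<lambda>_. 0) S S1" "solves q z (\<lambda>_. 0) C C1" "solves q' z (\<lambda>_. 0) S' S1'" "solves q' z (\<lambda>_. 0) C' C1'"
    unfolding S_def S1_def C_def C1_def S'_def S1'_def C'_def C1'_def by (rule sl_ivp(1), fact)+
  have init: "S 0 = 0" "S1 0 = 1" "C 0 = 1" "C1 0 = 0" "S' 0 = 0" "S1' 0 = 1" "C' 0 = 1" "C1' 0 = 0"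
    unfolding S_def S1_def C_def C1_def S'_def S1'_def C'_def C1'_def by (simp_all add: sl_ivp(2,3) q q')
  have par: "S x * C' x = C x * S' x" if "0 \<le> x" "x \<le> pi" for x
    unfolding S_def C_def S'_def C'_def by (rule fundamental_solutions_parallel[OF q q' eq that])
  have W: "C x * S1 x - C1 x * S x = 1" and W': "C' x * S1' x - C1' x * S' x = 1" if "0 \<le> x" "x \<le> pi" for x
    using Wronskian_constant[OF s(2,1) that] Wronskian_constant[OF s(4,3) that] by (simp_all add: init)
  note cont = solves_continuous[OF s(1)] solves_continuous[OF s(2)] solves_continuous[OF s(3)] solves_continuous[OF s(4)]
  have ac: "ac_deriv S S1" "ac_deriv C C1" "ac_deriv S' S1'" "ac_deriv C' C1'" using s by (auto simp: solves_def)
  have dpar: "S1 x * C' x + S x * C1' x = C1 x * S' x + C x * S1' x" if x: "0 \<le> x" "x \<le> pi" for x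
  proof -
    define g where "g = (\<lambda>x. (S1 x * C' x + S x * C1' x) - (C1 x * S' x + C x * S1' x))"
    have "ac_deriv (\<lambda>x. 1 * (S x * C' x) + (-1) * (C x * S' x)) (\<lambda>x. 1 * (S1 x * C' x + S x * C1' x) + (-1) * (C1 x * S' x + C x * S1' x))"
      by (intro ac_deriv_lincomb ac_deriv_mult ac cont)
    then have "ac_deriv (\<lambda>x. 0) g"
      by (rule ac_deriv_cong) (auto simp: g_def par)
    moreover have "continuous_on {0..pi} g" unfolding g_def by (intro continuous_intros cont)
    ultimately have "g x = 0" using x by (rule ac_deriv_zero_continuous)
    then show ?thesis by (simp add: g_def)
  qed
  define l where "l = (\<lambda>x. C' x * S1 x - S' x * C1 x)"
  have lC: "C' x = l x * C x" "S' x = l x * S x" if x: "0 \<le> x" "x \<le> pi" for x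
    using W[OF x] par[OF x] unfolding l_def by algebra+
  \<comment> \<open>Differentiating the parallelism gives a second expression for \<open>l\<close>;
    multiplied by \<open>l\<close>, it becomes the Wronskian of the second potential.\<close>
  have l2: "l x * l x = 1" if x: "0 \<le> x" "x \<le> pi" for x
  proof -
    have "l x = C x * S1' x - S x * C1' x" using dpar[OF x] unfolding l_def by algebra
    then show ?thesis using lC[OF x] W'[OF x] by algebra
  qed
  have "l constant_on {0..pi}"
  proof (rule continuous_finite_range_constant)
    show "continuous_on {0..pi} l" unfolding l_def by (intro continuous_intros cont)
    have "l x \<in> {1, -1}" if "x \<in> {0..pi}" for x
      using l2[of x] that square_eq_1_iff[of "l x"] by simp
    then have "l ` {0..pi} \<subseteq> {1, -1}" by blast
    then show "finite (l ` {0..pi})" by (rule finite_subset) simp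
  qed simp
  moreover have "l 0 = 1" by (simp add: l_def init)
  ultimately have l1: "l x = 1" if "0 \<le> x" "x \<le> pi" for x
    using that pi_ge_zero unfolding constant_on_def by (metis atLeastAtMost_iff order_refl)
  have eqs: "C' x = C x" "S' x = S x" if "0 \<le> x" "x \<le> pi" for x
    using lC[OF that] l1[OF that] by simp_all
  have AE: "AE x in lebesgue_on {0<..<pi}. (of_real (q x) - of_real (q' x)) * u x = 0"
    if u: "solves q z (\<lambda>_. 0) u v" and u': "solves q' z (\<lambda>_. 0) u' v'" and e: "\<And>x. 0 \<le> x \<Longrightarrow> x \<le> pi \<Longrightarrow> u' x = u x" for u v u' v'
  proof -
    have ac: "ac_deriv u v" "ac_deriv u' v'" "ac_deriv v (\<lambda>x. of_real (q x) * u x)" "ac_deriv v' (\<lambda>x. of_real (q' x) * u' x)"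
      using u u' by (auto simp: solves_def z_def)
    have vv: "v' x = v x" if x: "0 \<le> x" "x \<le> pi" for x
    proof -
      have "ac_deriv (\<lambda>x. 1 * u x + (-1) * u' x) (\<lambda>x. 1 * v x + (-1) * v' x)" by (intro ac_deriv_lincomb ac)
      then have "ac_deriv (\<lambda>x. 0) (\<lambda>x. v x - v' x)" by (rule ac_deriv_cong) (auto simp: e)
      moreover have "continuous_on {0..pi} (\<lambda>x. v x - v' x)"
        by (intro continuous_intros solves_continuous(2)[OF u] solves_continuous(2)[OF u'])
      ultimately have "v x - v' x = 0" using x by (rule ac_deriv_zero_continuous)
      then show ?thesis by simp
    qed
    have "ac_deriv (\<lambda>x. 1 * v x + (-1) * v' x) (\<lambda>x. 1 * (of_real (q x) * u x) + (-1) * (of_real (q' x) * u' x))"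
      by (intro ac_deriv_lincomb ac)
    then have z0: "ac_deriv (\<lambda>x. 0) (\<lambda>x. (of_real (q x) - of_real (q' x)) * u x)"
      by (rule ac_deriv_cong) (auto simp: e vv algebra_simps)
    show ?thesis
      by (rule AE_zero_of_indefinite_integral[OF ac_deriv_absint[OF z0]]) (use ac_deriv_eq[OF z0] in simp)
  qed
  \<comment> \<open>The difference of the potentials is tested against \<open>C\<close> and against
    \<open>S\<close>, which have no common zero by the Wronskian.\<close>
  have AE1: "AE x in lebesgue_on {0<..<pi}. (of_real (q x) - of_real (q' x)) * C x = 0"
    by (rule AE[OF s(2,4) eqs(1)])
  have AE2: "AE x in lebesgue_on {0<..<pi}. (of_real (q x) - of_real (q' x)) * S x = 0"
    by (rule AE[OF s(1,3) eqs(2)])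
  have "AE x in lebesgue_on {0<..<pi}. x \<in> {0<..<pi}" by (rule AE_I2) simp
  with AE1 AE2 show ?thesis
  proof eventually_elim
    case (elim x)
    then have "C x * S1 x - C1 x * S x = 1" by (intro W) auto
    then have "C x \<noteq> 0 \<or> S x \<noteq> 0" by auto
    then have "complex_of_real (q x) - of_real (q' x) = 0" using elim by auto
    then have "complex_of_real (q x) = of_real (q' x)" by simp
    then show ?case by (simp only: of_real_eq_iff)
  qed
qed

text \<open>Once the second characteristic functions agree,
  \<open>entire_eq_of_shifted_zeros\<close> applies to the first ones. Agreement for two boundary
  angles passes through Cramer's rule to \<open>u 0\<close> and \<open>v 0\<close>, hence to the
  angles \<open>0\<close> and \<open>pi / 2\<close> used by \<open>potential_unique\<close>.\<close>

theorem mixed_data_determine_potential: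
  assumes q: "potential q" and sin: "sin (\<alpha>2 - \<alpha>1) \<noteq> 0"
    and data: "spectral_data q \<alpha>1 \<alpha>2 \<beta> a b \<gamma>"
    and pos: "\<And>n. 0 < a n" "\<And>n. 0 < b n"
    and k: "strict_mono k"
    and sum: "summable (\<lambda>n. \<bar>a (k n) / b (l n) - 1\<bar>)"
  shows "determines_potential q \<alpha>1 \<alpha>2 \<beta> a b \<gamma> k l"
  unfolding determines_potential_def
proof (intro allI impI, elim conjE)
  fix q' a' b' \<gamma>'
  assume q': "potential q'" and data': "spectral_data q' \<alpha>1 \<alpha>2 \<beta> a' b' \<gamma>'"
    and a': "\<forall>n. a' n = a n" and b': "\<forall>j. j \<notin> range l \<longrightarrow> b' j = b j" and \<gamma>': "\<forall>n. \<gamma>' (k n) = \<gamma> (k n)"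
  have "a' = a" using a' by auto
  note data' = data'[unfolded this]
  define f where "f = char_fun q \<alpha>1 \<beta>"
  define f' where "f' = char_fun q' \<alpha>1 \<beta>"
  define g where "g = char_fun q \<alpha>2 \<beta>"
  have g: "char_fun q' \<alpha>2 \<beta> = g"
    unfolding g_def using char_fun_eq_of_same_zeros[OF q q' sin data data'] by auto
  have zeros: "enumerates_incr a (sl_spectrum q \<alpha>2 \<beta>)" "enumerates_incr b (sl_spectrum q \<alpha>1 \<beta>)" "enumerates_incr b' (sl_spectrum q' \<alpha>1 \<beta>)"
    using data data' by (auto simp: spectral_data_def)
  obtain C1 where C1: "C1 \<ge> 0" "\<And>z. Im z \<noteq> 0 \<Longrightarrow> norm (g z) \<le> C1 * (1 + (norm z)\<^sup>2) / \<bar>Im z\<bar> * norm (f z)"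
    unfolding f_def g_def by (rule spectral_data_bounds[OF q sin data]) blast
  obtain C2 where C2: "C2 \<ge> 0" "\<And>z. Im z \<noteq> 0 \<Longrightarrow> norm (f' z) \<le> C2 * (1 + (norm z)\<^sup>2) / \<bar>Im z\<bar> * norm (g z)"
    unfolding f'_def g[symmetric] by (rule spectral_data_bounds[OF q' sin data']) blast
  define C where "C = max C1 C2"
  have le: "c * (1 + (norm z)\<^sup>2) / \<bar>Im z\<bar> * y \<le> C * (1 + (norm z)\<^sup>2) / \<bar>Im z\<bar> * y" if "c \<le> C" "y \<ge> 0" for c y and z :: complex
    using that by (intro mult_right_mono divide_right_mono) auto
  have eq1: "f z = f' z" for z
  proof (rule entire_eq_of_shifted_zeros[where f = f and f' = f' and g = g and C = C and p = "\<lambda>n. a (k n)" and r = "\<lambda>n. b (l n)"])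
    show "f holomorphic_on UNIV" "f' holomorphic_on UNIV" "g holomorphic_on UNIV"
      unfolding f_def f'_def g_def by (rule char_fun_holomorphic, fact)+
    show "norm (f' z) \<le> C * (1 + (norm z)\<^sup>2) / \<bar>Im z\<bar> * norm (g z)" if "Im z \<noteq> 0" for z
      by (rule order_trans[OF C2(2)[OF that] le]) (auto simp: C_def)
    show "norm (g z) \<le> C * (1 + (norm z)\<^sup>2) / \<bar>Im z\<bar> * norm (f z)" if "Im z \<noteq> 0" for z
      by (rule order_trans[OF C1(2)[OF that] le]) (auto simp: C_def)
    show "Im z = 0 \<and> g z \<noteq> 0 \<and> (f' z = 0 \<or> z \<in> range (\<lambda>n. complex_of_real (b (l n))))" if fz: "f z = 0" for z
    proof -
      obtain j where j: "z = of_real (b j)"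
        using fz enumerates_char_fun(1)[OF q zeros(2)] by (auto simp: f_def)
      have "f' z = 0 \<or> z \<in> range (\<lambda>n. complex_of_real (b (l n)))"
      proof (cases "j \<in> range l")
        case True
        then show ?thesis using j by auto
      next
        case False
        then have "z = of_real (b' j)" using b' j by simp
        then show ?thesis using enumerates_char_fun(1)[OF q' zeros(3), of z] by (auto simp: f'_def)
      qed
      moreover have "g z \<noteq> 0"
        using char_fun_no_common_zero[OF q sin] fz by (simp add: f_def g_def)
      ultimately show ?thesis using j by simp
    qed
    show "inj (\<lambda>n. a (k n))"
      using inj_compose[OF enumerates_char_fun(2)[OF q zeros(1)] strict_mono_imp_inj_on[OF k]] by (simp add: o_def)
    show "g (of_real (a (k n))) = 0" for n
      using enumerates_char_fun(1)[OF q zeros(1)] by (auto simp: g_def)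
    \<comment> \<open>Equal masses, multiplied by the derivative of the same function
      \<open>g\<close>, give equal values.\<close>
    show "f (of_real (a (k n))) = f' (of_real (a (k n)))" for n
      using spectral_data_residue(2)[OF q sin data, of "k n"] spectral_data_residue(2)[OF q' sin data', of "k n"] \<gamma>'
      unfolding g f_def[symmetric] f'_def[symmetric] g_def[symmetric] by simp
    show "((\<lambda>z. f' z / f z) \<longlongrightarrow> 1) imag_infinity"
      unfolding f_def f'_def by (rule char_fun_ratio[OF q' q])
  qed (use pos sum in auto)
  have eq: "char_fun q 0 \<beta> z = char_fun q' 0 \<beta> z" "char_fun q (pi / 2) \<beta> z = char_fun q' (pi / 2) \<beta> z" for z
  proof -
    obtain u v where uv: "solves q z (\<lambda>_. 0) u v" "u pi = of_real (sin \<beta>)" "v pi = - of_real (cos \<beta>)"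
      by (rule sl_sol[OF q])
    obtain u' v' where uv': "solves q' z (\<lambda>_. 0) u' v'" "u' pi = of_real (sin \<beta>)" "v' pi = - of_real (cos \<beta>)"
      by (rule sl_sol[OF q'])
    have e1: "of_real (cos \<alpha>1) * (u 0 - u' 0) - of_real (sin \<alpha>1) * (v 0 - v' 0) = 0"
      using eq1[of z] unfolding f_def f'_def char_fun_terminal[OF q uv] char_fun_terminal[OF q' uv'] by (simp add: algebra_simps)
    have e2: "of_real (cos \<alpha>2) * (u 0 - u' 0) - of_real (sin \<alpha>2) * (v 0 - v' 0) = 0"
      using fun_cong[OF g, of z] unfolding g_def char_fun_terminal[OF q uv] char_fun_terminal[OF q' uv'] by (simp add: algebra_simps)
    have "u 0 = u' 0" "v 0 = v' 0" using initial_values_of_char_fun[OF sin e1 e2] by simp_all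
    then show "char_fun q 0 \<beta> z = char_fun q' 0 \<beta> z" "char_fun q (pi / 2) \<beta> z = char_fun q' (pi / 2) \<beta> z"
      unfolding char_fun_terminal[OF q uv] char_fun_terminal[OF q' uv'] by simp_all
  qed
  show "AE x in lebesgue_on {0<..<pi}. q' x = q x"
    by (rule potential_unique[OF q q' eq])
qed

theorem theorem4p14:
  fixes q :: "real \<Rightarrow> real" and \<alpha>1 \<alpha>2 \<beta> :: real
    and a b \<gamma> :: "nat \<Rightarrow> real" and k l :: "nat \<Rightarrow> nat"
  assumes "potential q"
    and "\<alpha>1 \<in> {0..<pi}" "\<alpha>2 \<in> {0..<pi}" "\<beta> \<in> {0..<pi}" "sin (\<alpha>2 - \<alpha>1) \<noteq> 0"
    and "spectral_data q \<alpha>1 \<alpha>2 \<beta> a b \<gamma>"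
    and "\<forall>n. 0 < a n" "\<forall>n. 0 < b n"
    and "strict_mono k" "strict_mono l"
    and "summable (\<lambda>n. \<bar>a (k n) / b (l n) - 1\<bar>)"
  shows "(\<alpha>1 = 0 \<or> \<alpha>2 = 0 \<longrightarrow> determines_potential q \<alpha>1 \<alpha>2 \<beta> a b \<gamma> k l) \<and>
    (\<alpha>1 \<noteq> 0 \<and> \<alpha>2 \<noteq> 0 \<and> (\<exists>N. \<forall>n>N. k n \<noteq> l n) \<longrightarrow>
       determines_potential q \<alpha>1 \<alpha>2 \<beta> a b \<gamma> k l)"
  using mixed_data_determine_potential[of q \<alpha>2 \<alpha>1 \<beta> a b \<gamma> k l] assms by blast

end
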